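(* Let $M$ be a closed Riemannian manifold, $\mathcal{F}$ a foliation on $M$ with closed leaves, and $p>1$. Assume there exists an extremal function $f_0$ for the $p$-modulus of $\mathcal{F}$ such that $\mathrm{ess\,inf}_M f_0>0$. Then the measure $\mu=f_0^{p-1}\mu_M$ is $\mathcal{F}$-harmonic.
   Context: A measure $\mu$ on a Riemannian manifold $M$ with a foliation $\mathcal{F}$ is $\mathcal{F}$-harmonic if $\int_M\Delta_{\mathcal{F}}f\,d\mu=0$ for all smooth functions $f$ on $M$, where $\Delta_{\mathcal{F}}f=\mathrm{div}_{\mathcal{F}}\big((\nabla f)^\top\big)$, $(\cdot)^\top$ is the component tangent to $\mathcal{F}$ and $\mathrm{div}_{\mathcal{F}}$ is the divergence along the leaves. $\mu_M$ and $\mu_L$ denote the Lebesgue (Riemannian volume) measures on $M$ and on a leaf $L\in\mathcal{F}$. A property holds for almost every $L\in\mathcal{F}$ if the union of the leaves for which it fails has $\mu_M$-measure zero. $\mathrm{adm}_p(\mathcal{F})$ is the family of all nonnegative $f\in L^p(M)$ such that $\int_L f\,d\mu_L\geq 1$ for almost every $L\in\mathcal{F}$; $\mathrm{mod}_p(\mathcal{F})=\inf_{f\in\mathrm{adm}_p(\mathcal{F})}\|f\|_p$ if $\mathrm{adm}_p(\mathcal{F})\neq\emptyset$ and $\mathrm{mod}_p(\mathcal{F})=\infty$ otherwise. A function $f_0\in\mathrm{adm}_p(\mathcal{F})$ is extremal for the $p$-modulus of $\mathcal{F}$ if $\mathrm{mod}_p(\mathcal{F})=\|f_0\|_p$. 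*)

theory Defs
  imports "HOL-Analysis.Analysis" "HOL-Probability.Essential_Supremum"
begin

section \<open>Smooth maps between Euclidean spaces\<close>

definition partial :: "'n::finite \<Rightarrow> (real^'n \<Rightarrow> 'b::real_normed_vector) \<Rightarrow> real^'n \<Rightarrow> 'b" where
  "partial i u y = frechet_derivative u (at y) (axis i 1)"

text \<open>Both notions below are meant for open \<open>S\<close>.\<close>

primrec C_on :: "nat \<Rightarrow> (real^'n::finite) set \<Rightarrow> (real^'n \<Rightarrow> 'b::real_normed_vector) \<Rightarrow> bool" where
  "C_on 0 S u \<longleftrightarrow> continuous_on S u"
| "C_on (Suc k) S u \<longleftrightarrow> (\<forall>y\<in>S. u differentiable (at y)) \<and> (\<forall>i. C_on k S (partial i u))"

definition smooth_on :: "(real^'n::finite) set \<Rightarrow> (real^'n \<Rightarrow> 'b::real_normed_vector) \<Rightarrow> bool" where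
  "smooth_on S u \<longleftrightarrow> (\<forall>k. C_on k S u)"

section \<open>Smooth manifolds\<close>

text \<open>
  The manifold is a whole topological type \<open>'a\<close>, of dimension \<open>CARD('n)\<close>. A chart is a pair of its
  domain and its coordinate map; the values of the map outside the domain are irrelevant.
\<close>

type_synonym ('a, 'n) chart = "'a set \<times> ('a \<Rightarrow> real^'n)"

abbreviation chart_dom :: "('a, 'n::finite) chart \<Rightarrow> 'a set" where "chart_dom \<equiv> fst"
abbreviation chart_map :: "('a, 'n::finite) chart \<Rightarrow> 'a \<Rightarrow> real^'n" where "chart_map \<equiv> snd"

definition chart_inv :: "('a, 'n::finite) chart \<Rightarrow> real^'n \<Rightarrow> 'a" where
  "chart_inv c = inv_into (chart_dom c) (chart_map c)"

definition is_chart :: "('a::topological_space, 'n::finite) chart \<Rightarrow> bool" where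
  "is_chart c \<longleftrightarrow> open (chart_dom c) \<and> open (chart_map c ` chart_dom c) \<and>
     homeomorphism (chart_dom c) (chart_map c ` chart_dom c) (chart_map c) (chart_inv c)"

definition transition :: "('a, 'n::finite) chart \<Rightarrow> ('a, 'n) chart \<Rightarrow> real^'n \<Rightarrow> real^'n" where
  "transition c c' = chart_map c' \<circ> chart_inv c"

definition smoothly_compatible :: "('a, 'n::finite) chart \<Rightarrow> ('a, 'n) chart \<Rightarrow> bool" where
  "smoothly_compatible c c' \<longleftrightarrow>
     smooth_on (chart_map c ` (chart_dom c \<inter> chart_dom c')) (transition c c') \<and>
     smooth_on (chart_map c' ` (chart_dom c \<inter> chart_dom c')) (transition c' c)"

definition smooth_atlas :: "('a::topological_space, 'n::finite) chart set \<Rightarrow> bool" where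
  "smooth_atlas A \<longleftrightarrow> (\<forall>c\<in>A. is_chart c) \<and> (\<Union>c\<in>A. chart_dom c) = UNIV \<and>
     (\<forall>c\<in>A. \<forall>c'\<in>A. smoothly_compatible c c')"

definition maximal_atlas :: "('a::topological_space, 'n::finite) chart set \<Rightarrow> ('a, 'n) chart set" where
  "maximal_atlas A = {c. is_chart c \<and> (\<forall>c'\<in>A. smoothly_compatible c c')}"

definition smooth_fun :: "('a::topological_space, 'n::finite) chart set \<Rightarrow> ('a \<Rightarrow> real) \<Rightarrow> bool" where
  "smooth_fun A f \<longleftrightarrow>
     (\<forall>c\<in>maximal_atlas A. smooth_on (chart_map c ` chart_dom c) (f \<circ> chart_inv c))"

section \<open>Riemannian metrics\<close>

text \<open>
  A metric is given by its Gram matrices: \<open>g c x\<close> is the matrix of the inner product on the tangent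
  space at \<open>x\<close> with respect to the coordinate basis of the chart \<open>c\<close>. The last condition is the
  transformation law of a covariant 2-tensor.
\<close>

type_synonym ('a, 'n) metric = "('a, 'n) chart \<Rightarrow> 'a \<Rightarrow> real^'n^'n"

definition riemannian_metric ::
    "('a::topological_space, 'n::finite) chart set \<Rightarrow> ('a, 'n) metric \<Rightarrow> bool" where
  "riemannian_metric A g \<longleftrightarrow>
     (\<forall>c\<in>maximal_atlas A.
        smooth_on (chart_map c ` chart_dom c) (g c \<circ> chart_inv c) \<and>
        (\<forall>x\<in>chart_dom c. transpose (g c x) = g c x \<and> (\<forall>v. v \<noteq> 0 \<longrightarrow> 0 < v \<bullet> (g c x *v v)))) \<and>
     (\<forall>c\<in>maximal_atlas A. \<forall>c'\<in>maximal_atlas A. \<forall>x\<in>chart_dom c \<inter> chart_dom c'.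
        let J = jacobian (transition c c') (at (chart_map c x))
        in g c x = transpose J ** g c' x ** J)"

text \<open>The Lebesgue measure of the metric: \<open>sqrt (det g) dy\<close> in every chart, completed.\<close>

definition riemannian_volume ::
    "('a::topological_space, 'n::finite) chart set \<Rightarrow> ('a, 'n) metric \<Rightarrow> 'a measure" where
  "riemannian_volume A g = completion (THE \<mu>. sets \<mu> = sets borel \<and>
     (\<forall>c\<in>maximal_atlas A. \<forall>B\<in>sets borel. B \<subseteq> chart_dom c \<longrightarrow>
        emeasure \<mu> B = (\<integral>\<^sup>+ y \<in> chart_map c ` B. ennreal (sqrt (det (g c (chart_inv c y)))) \<partial>lborel)))"

section \<open>Foliations\<close>

text \<open>
  The coordinates with index in \<open>I\<close> are the leaf coordinates of a foliated chart, those with index in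
  \<open>- I\<close> the transverse ones, so the leaves have dimension \<open>card I\<close>. Transitions between foliated charts
  locally have the form \<open>(x, y) \<mapsto> (\<alpha>(x, y), \<beta>(y))\<close>: near each point, equality of the transverse
  coordinates in one chart implies their equality in the other.
\<close>

definition foliated_atlas ::
    "('a::topological_space, 'n::finite) chart set \<Rightarrow> 'n set \<Rightarrow> ('a, 'n) chart set \<Rightarrow> bool" where
  "foliated_atlas A I \<Phi> \<longleftrightarrow> \<Phi> \<subseteq> maximal_atlas A \<and> (\<Union>c\<in>\<Phi>. chart_dom c) = UNIV \<and>
     (\<forall>c\<in>\<Phi>. \<forall>c'\<in>\<Phi>. \<forall>x\<in>chart_dom c \<inter> chart_dom c'.
        \<exists>W. open W \<and> x \<in> W \<and> W \<subseteq> chart_dom c \<inter> chart_dom c' \<and>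
          (\<forall>y\<in>W. \<forall>z\<in>W. (\<forall>j\<in>-I. chart_map c y $ j = chart_map c z $ j) \<longrightarrow>
                       (\<forall>j\<in>-I. chart_map c' y $ j = chart_map c' z $ j)))"

definition slice :: "'n::finite set \<Rightarrow> ('a, 'n) chart \<Rightarrow> 'a \<Rightarrow> 'a set" where
  "slice I c x = {y \<in> chart_dom c. \<forall>j\<in>-I. chart_map c y $ j = chart_map c x $ j}"

text \<open>
  Chart domains are arbitrary open sets, so the plaques are the connected components of the slices.
  Leaves are the classes of points that can be joined by finite chains of plaques.
\<close>

definition leaf_rel :: "'n::finite set \<Rightarrow> ('a::topological_space, 'n) chart set \<Rightarrow> ('a \<times> 'a) set" where
  "leaf_rel I \<Phi> = {(x, y). \<exists>c\<in>\<Phi>. y \<in> connected_component_set (slice I c x) x}\<^sup>*"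

definition leaves :: "'n::finite set \<Rightarrow> ('a::topological_space, 'n) chart set \<Rightarrow> 'a set set" where
  "leaves I \<Phi> = UNIV // leaf_rel I \<Phi>"

text \<open>
  The Gram matrix of the induced metric on the leaves, extended by the identity in the transverse
  directions: this keeps the type, and changes neither the determinant of the leaf block nor its
  inverse.
\<close>

definition leaf_gram :: "'n::finite set \<Rightarrow> real^'n^'n \<Rightarrow> real^'n^'n" where
  "leaf_gram I G = (\<chi> i j. if i \<in> I \<and> j \<in> I then G $ i $ j else if i = j then 1 else 0)"

definition glue :: "'n::finite set \<Rightarrow> ('n \<Rightarrow> real) \<Rightarrow> ('n \<Rightarrow> real) \<Rightarrow> real^'n" where
  "glue I z t = (\<chi> i. if i \<in> I then z i else t i)"

text \<open>
  The Lebesgue measure of a leaf \<open>L\<close> with its induced metric, completed. A leaf meets a chart domain in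
  a disjoint union of (parts of) slices, labelled by their transverse coordinates \<open>t\<close>; on each of them
  the measure is \<open>sqrt (det h) dz\<close> with \<open>h\<close> the induced Gram matrix, and the contributions of the slices
  are summed up, which is the integral over the counting measure.
\<close>

definition leaf_volume ::
    "('a::topological_space, 'n::finite) metric \<Rightarrow> 'n set \<Rightarrow> ('a, 'n) chart set \<Rightarrow> 'a set \<Rightarrow> 'a measure" where
  "leaf_volume g I \<Phi> L = completion (THE \<mu>. sets \<mu> = sets (restrict_space borel L) \<and>
     (\<forall>c\<in>\<Phi>. \<forall>B\<in>sets (restrict_space borel L). B \<subseteq> chart_dom c \<longrightarrow>
        emeasure \<mu> B =
          (\<integral>\<^sup>+ t. (\<integral>\<^sup>+ z. ennreal (sqrt (det (leaf_gram I (g c (chart_inv c (glue I z t))))))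
                          * indicator (chart_map c ` B) (glue I z t)
                   \<partial>(\<Pi>\<^sub>M i\<in>I. lborel))
           \<partial>count_space (\<Pi>\<^sub>E i\<in>-I. UNIV))))"

section \<open>The leafwise Laplacian and harmonic measures\<close>

text \<open>Vector fields are represented by their components, as functions of the coordinates \<open>y\<close> of a chart.\<close>

definition gradient ::
    "('a, 'n::finite) metric \<Rightarrow> ('a, 'n) chart \<Rightarrow> ('a \<Rightarrow> real) \<Rightarrow> real^'n \<Rightarrow> real^'n" where
  "gradient g c f y = matrix_inv (g c (chart_inv c y)) *v (\<chi> i. partial i (f \<circ> chart_inv c) y)"

text \<open>Orthogonal projection, for the inner product with matrix \<open>G\<close>, onto the span of the leaf directions.\<close>

definition tangential_part :: "'n::finite set \<Rightarrow> real^'n^'n \<Rightarrow> real^'n \<Rightarrow> real^'n" where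
  "tangential_part I G v = (THE w. (\<forall>j\<in>-I. w $ j = 0) \<and>
     (\<forall>u. (\<forall>j\<in>-I. u $ j = 0) \<longrightarrow> u \<bullet> (G *v (v - w)) = 0))"

text \<open>The Riemannian divergence, on the leaves, of a vector field tangent to the leaves.\<close>

definition leaf_divergence ::
    "('a, 'n::finite) metric \<Rightarrow> 'n set \<Rightarrow> ('a, 'n) chart \<Rightarrow> (real^'n \<Rightarrow> real^'n) \<Rightarrow> real^'n \<Rightarrow> real" where
  "leaf_divergence g I c X y =
     (let \<rho> = (\<lambda>u. sqrt (det (leaf_gram I (g c (chart_inv c u)))))
      in (\<Sum>i\<in>I. partial i (\<lambda>u. \<rho> u * X u $ i) y) / \<rho> y)"

text \<open>The value at a point is the one common to all foliated charts around it.\<close>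

definition leafwise_laplacian ::
    "('a, 'n::finite) metric \<Rightarrow> 'n set \<Rightarrow> ('a, 'n) chart set \<Rightarrow> ('a \<Rightarrow> real) \<Rightarrow> 'a \<Rightarrow> real" where
  "leafwise_laplacian g I \<Phi> f x = (THE r. \<forall>c\<in>\<Phi>. x \<in> chart_dom c \<longrightarrow>
     r = leaf_divergence g I c
           (\<lambda>y. tangential_part I (g c (chart_inv c y)) (gradient g c f y)) (chart_map c x))"

text \<open>Integrability is stated since the Bochner integral of a non-integrable function is 0 by convention.\<close>

definition harmonic_measure ::
    "('a::topological_space, 'n::finite) chart set \<Rightarrow> ('a, 'n) metric \<Rightarrow> 'n set \<Rightarrow> ('a, 'n) chart set
      \<Rightarrow> 'a measure \<Rightarrow> bool" where
  "harmonic_measure A g I \<Phi> \<mu> \<longleftrightarrow> (\<forall>f. smooth_fun A f \<longrightarrow>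
     integrable \<mu> (leafwise_laplacian g I \<Phi> f) \<and> (\<integral>x. leafwise_laplacian g I \<Phi> f x \<partial>\<mu>) = 0)"

section \<open>The modulus of a foliation\<close>

definition Lp :: "'a measure \<Rightarrow> real \<Rightarrow> ('a \<Rightarrow> real) set" where
  "Lp \<mu> p = {f \<in> borel_measurable \<mu>. integrable \<mu> (\<lambda>x. \<bar>f x\<bar> powr p)}"

definition Lp_norm :: "'a measure \<Rightarrow> real \<Rightarrow> ('a \<Rightarrow> real) \<Rightarrow> real" where
  "Lp_norm \<mu> p f = (\<integral>x. \<bar>f x\<bar> powr p \<partial>\<mu>) powr (1 / p)"

definition ess_inf :: "'a measure \<Rightarrow> ('a \<Rightarrow> real) \<Rightarrow> ereal" where
  "ess_inf \<mu> f = - esssup \<mu> (\<lambda>x. - ereal (f x))"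

definition almost_every_leaf ::
    "('a::topological_space, 'n::finite) chart set \<Rightarrow> ('a, 'n) metric \<Rightarrow> 'n set \<Rightarrow> ('a, 'n) chart set
      \<Rightarrow> ('a set \<Rightarrow> bool) \<Rightarrow> bool" where
  "almost_every_leaf A g I \<Phi> P \<longleftrightarrow> \<Union>{L \<in> leaves I \<Phi>. \<not> P L} \<in> null_sets (riemannian_volume A g)"

text \<open>
  The integrals over leaves are taken in \<open>[0, \<infinity>]\<close>. Their existence, i.e. measurability of \<open>f\<close> on almost
  every leaf, is part of the condition.
\<close>

definition adm ::
    "('a::topological_space, 'n::finite) chart set \<Rightarrow> ('a, 'n) metric \<Rightarrow> 'n set \<Rightarrow> ('a, 'n) chart set
      \<Rightarrow> real \<Rightarrow> ('a \<Rightarrow> real) set" where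
  "adm A g I \<Phi> p = {f \<in> Lp (riemannian_volume A g) p. (\<forall>x. 0 \<le> f x) \<and>
     almost_every_leaf A g I \<Phi> (\<lambda>L. f \<in> borel_measurable (leaf_volume g I \<Phi> L) \<and>
        1 \<le> (\<integral>\<^sup>+ x. ennreal (f x) \<partial>leaf_volume g I \<Phi> L))}"

text \<open>The infimum of the empty set in \<open>ennreal\<close> is \<open>\<infinity>\<close>.\<close>

definition modulus ::
    "('a::topological_space, 'n::finite) chart set \<Rightarrow> ('a, 'n) metric \<Rightarrow> 'n set \<Rightarrow> ('a, 'n) chart set
      \<Rightarrow> real \<Rightarrow> ennreal" where
  "modulus A g I \<Phi> p = (INF f\<in>adm A g I \<Phi> p. ennreal (Lp_norm (riemannian_volume A g) p f))"

definition extremal ::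
    "('a::topological_space, 'n::finite) chart set \<Rightarrow> ('a, 'n) metric \<Rightarrow> 'n set \<Rightarrow> ('a, 'n) chart set
      \<Rightarrow> real \<Rightarrow> ('a \<Rightarrow> real) \<Rightarrow> bool" where
  "extremal A g I \<Phi> p f \<longleftrightarrow>
     f \<in> adm A g I \<Phi> p \<and> modulus A g I \<Phi> p = ennreal (Lp_norm (riemannian_volume A g) p f)"

end

theory Submission
  imports Defs
begin

text \<open>
  Let \<open>h\<close> be the leafwise Laplacian of a smooth function. It is bounded, and it has mean zero on every
  leaf of finite volume: a partition of unity reduces this to the divergence theorem in foliated
  charts. Truncating \<open>f\<^sub>0\<close> from below at a constant \<open>c > 0\<close> below its essential infimum changes it on a
  null set only, and then \<open>max f\<^sub>0 c + t h\<close> is admissible for small \<open>\<bar>t\<bar>\<close>: its integral over a leaf of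
  finite volume is that of \<open>max f\<^sub>0 c\<close>, and its integral over a leaf of infinite volume is infinite. So
  the \<open>p\<close>-norm is minimal at \<open>t = 0\<close>, and the first variation \<open>\<integral> f\<^sub>0\<^sup>p\<^sup>-\<^sup>1 h\<close> vanishes.

  The volumes and the Laplacian are given by unique existence, so their invariance under changes of
  charts has to be shown. Both follow from the change of variables formula; for the Laplacian this goes
  through its weak form, which avoids second derivatives of the transition maps.
\<close>

section \<open>Calculus of \<open>C\<^sup>k\<close> maps\<close>

text \<open>A null set of the manifold may meet every leaf in a large set, so
  \<open>f\<^sub>0\<close> cannot simply be redefined where it drops below \<open>c\<close>. The
  maximum with \<open>c\<close> only raises the leaf integrals, and so admissibility survives. The
  perturbation is kept below \<open>c / 2\<close>, which leaves the perturbed function bounded away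
  from 0.

  The obstacle is dimension. Leaves are modelled on the coordinates in \<open>I\<close>, while
  derivatives and the change of variables formula live on all of \<open>real^'n\<close>. Slices are
  therefore thickened by a cube of dummy transverse coordinates, and transitions between slices act
  on the dummies as the identity. The case \<open>I = UNIV\<close> then covers the Riemannian volume
  as well.

  A priori a leaf meets a chart in infinitely many slices. Signed functions on it are handled by
  equating the integrals of their positive and negative parts in \<open>[0, \<infinity>]\<close>;
  only finite volume turns this into a vanishing integral.

  The cutoff functions are merely C^2, which is why the Laplacian is studied on the class
  \<open>C2_fun\<close>.\<close>

lemma partial_eqI: "(u has_derivative D) (at y) \<Longrightarrow> partial i u y = D (axis i 1)"
  unfolding partial_def using frechet_derivative_at by metis

lemma partial_cong:
  assumes "open S" "y \<in> S" "\<And>z. z \<in> S \<Longrightarrow> u z = v z"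
  shows "partial i u y = partial i v y"
proof -
  have "(u has_derivative D) (at y) \<longleftrightarrow> (v has_derivative D) (at y)" for D
    using assms by (metis has_derivative_transform_within_open)
  then show ?thesis unfolding partial_def frechet_derivative_def by simp
qed

lemma differentiable_cong_open:
  assumes "open S" "y \<in> S" "\<And>z. z \<in> S \<Longrightarrow> u z = v z"
  shows "u differentiable (at y) \<longleftrightarrow> v differentiable (at y)"
  using assms unfolding differentiable_def by (metis has_derivative_transform_within_open)

lemma has_derivative_partial_sum:
  fixes u :: "real^'n::finite \<Rightarrow> 'b::real_normed_vector"
  assumes "u differentiable (at y)"
  shows "(u has_derivative (\<lambda>h. \<Sum>i\<in>UNIV. h $ i *\<^sub>R partial i u y)) (at y)"
proof -
  let ?D = "frechet_derivative u (at y)"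
  have D: "(u has_derivative ?D) (at y)"
    using assms frechet_derivative_works by blast
  have "?D h = (\<Sum>i\<in>UNIV. h $ i *\<^sub>R partial i u y)" for h
  proof -
    interpret linear ?D using D has_derivative_linear by blast
    have "?D h = ?D (\<Sum>i\<in>UNIV. h $ i *\<^sub>R axis i 1)"
      using basis_expansion[of h] by (simp add: scalar_mult_eq_scaleR)
    then show ?thesis by (simp add: sum scale partial_def)
  qed
  then show ?thesis using D by (metis (no_types, lifting) ext)
qed

lemma C_on_cong:
  assumes "open S" "\<And>y. y \<in> S \<Longrightarrow> u y = v y"
  shows "C_on k S u \<longleftrightarrow> C_on k S v"
  using assms(2)
proof (induction k arbitrary: u v)
  case 0
  then show ?case by (auto cong: continuous_on_cong)
next
  case (Suc k)
  have "C_on k S (partial i u) = C_on k S (partial i v)" for i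
    by (rule Suc.IH) (use partial_cong[OF assms(1)] Suc.prems in blast)
  moreover have "(\<forall>y\<in>S. u differentiable at y) = (\<forall>y\<in>S. v differentiable at y)"
    using differentiable_cong_open[OF assms(1)] Suc.prems by blast
  ultimately show ?case by simp
qed

lemma C_on_subset: "C_on k S u \<Longrightarrow> T \<subseteq> S \<Longrightarrow> C_on k T u"
  by (induction k arbitrary: u) (auto intro: continuous_on_subset)

text \<open>\<open>C_on\<close> is built from derivatives \<open>at y\<close> in the full space, so
  it may be tested on open neighbourhoods even if they are not contained in
  \<open>S\<close>.\<close>

lemma C_on_local:
  assumes "\<And>y. y \<in> S \<Longrightarrow> \<exists>W. open W \<and> y \<in> W \<and> C_on k W u"
  shows "C_on k S u"
  using assms
proof (induction k arbitrary: u)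
  case 0
  then show ?case
    by (metis C_on.simps(1) continuous_at_imp_continuous_on continuous_on_eq_continuous_at)
next
  case (Suc k)
  have "C_on k S (partial i u)" for i
    by (rule Suc.IH) (use Suc.prems in fastforce)
  moreover have "u differentiable at y" if "y \<in> S" for y
    using Suc.prems[OF that] by auto
  ultimately show ?case by simp
qed

lemma C_on_imp_continuous: "C_on k S u \<Longrightarrow> continuous_on S u"
  by (cases k) (auto simp: continuous_at_imp_continuous_on differentiable_imp_continuous_within)

lemma C_on_Suc_imp: "C_on (Suc k) S u \<Longrightarrow> C_on k S u"
proof (induction k arbitrary: u)
  case 0
  then show ?case using C_on_imp_continuous by (metis C_on.simps(1))
next
  case (Suc k)
  then show ?case by auto
qed

lemma C_on_mono: "C_on k S u \<Longrightarrow> j \<le> k \<Longrightarrow> C_on j S u"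
  by (induction k) (use C_on_Suc_imp le_Suc_eq in auto)

lemma C_on_has_derivative:
  "C_on (Suc k) S u \<Longrightarrow> y \<in> S \<Longrightarrow> (u has_derivative frechet_derivative u (at y)) (at y)"
  using frechet_derivative_works by auto

text \<open>The induction step of the closure rules below: an explicit derivative \<open>D\<close>
  leaves only its values on the axis vectors to be checked, and these are made of functions covered
  by the induction hypothesis or by earlier rules.\<close>

lemma C_on_SucI:
  assumes "open S" "\<And>y. y \<in> S \<Longrightarrow> (u has_derivative D y) (at y)"
    and "\<And>i. C_on k S (\<lambda>y. D y (axis i 1))"
  shows "C_on (Suc k) S u"
proof -
  have "C_on k S (partial i u) = C_on k S (\<lambda>y. D y (axis i 1))" for i
    by (rule C_on_cong[OF assms(1)]) (rule partial_eqI[OF assms(2)])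
  then show ?thesis using assms by (auto simp: differentiable_def)
qed

lemma C_on_const [simp]: "C_on k (S :: (real^'n::finite) set) (\<lambda>y. a)"
proof (induction k arbitrary: a)
  case (Suc k)
  have "partial i (\<lambda>y. a) = (\<lambda>y. 0)" for i :: 'n
    by (rule ext) (rule partial_eqI, rule has_derivative_const)
  then show ?case using Suc by simp
qed simp

lemma C_on_bounded_linear:
  assumes "bounded_linear L" "open S" "C_on k S u"
  shows "C_on k S (\<lambda>y. L (u y))"
  using assms(3)
proof (induction k arbitrary: u)
  case 0
  then show ?case using assms(1) by (simp add: bounded_linear.continuous_on)
next
  case (Suc k)
  have 1: "((\<lambda>y. L (u y)) has_derivative (\<lambda>h. L (frechet_derivative u (at y) h))) (at y)" if "y \<in> S" for y
    by (rule bounded_linear.has_derivative[OF assms(1) C_on_has_derivative[OF Suc.prems that]])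
  have "C_on k S (\<lambda>y. L (partial i u y))" for i
    using Suc by simp
  then show ?case by (intro C_on_SucI[OF assms(2) 1]) (simp_all add: partial_def)
qed

lemma C_on_add:
  assumes "open S" "C_on k S u" "C_on k S v"
  shows "C_on k S (\<lambda>y. u y + v y)"
  using assms(2,3)
proof (induction k arbitrary: u v)
  case 0
  then show ?case by (simp add: continuous_on_add)
next
  case (Suc k)
  have 1: "((\<lambda>y. u y + v y) has_derivative (\<lambda>h. frechet_derivative u (at y) h + frechet_derivative v (at y) h)) (at y)" if "y \<in> S" for y
    by (rule has_derivative_add; rule C_on_has_derivative[OF _ that]; fact)
  have "C_on k S (\<lambda>y. partial i u y + partial i v y)" for i
    using Suc by simp
  then show ?case by (intro C_on_SucI[OF assms(1) 1]) (simp_all add: partial_def)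
qed

lemma C_on_sum:
  assumes "open S" "\<And>i. i \<in> F \<Longrightarrow> C_on k S (u i)"
  shows "C_on k S (\<lambda>y. \<Sum>i\<in>F. u i y)"
  using assms(2) by (induction F rule: infinite_finite_induct) (auto intro: C_on_add[OF assms(1)])

lemma C_on_scaleR:
  assumes "open S" "C_on k S u" "C_on k S v"
  shows "C_on k S (\<lambda>y. u y *\<^sub>R v y)"
  using assms(2,3)
proof (induction k arbitrary: u v)
  case 0
  then show ?case by (simp add: continuous_on_scaleR)
next
  case (Suc k)
  have 1: "((\<lambda>y. u y *\<^sub>R v y) has_derivative (\<lambda>h. u y *\<^sub>R frechet_derivative v (at y) h + frechet_derivative u (at y) h *\<^sub>R v y)) (at y)" if "y \<in> S" for y
    by (rule has_derivative_scaleR; rule C_on_has_derivative[OF _ that]; fact)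
  have "C_on k S (\<lambda>y. u y *\<^sub>R partial i v y + partial i u y *\<^sub>R v y)" for i
    using Suc.prems C_on_Suc_imp[OF Suc.prems(1)] C_on_Suc_imp[OF Suc.prems(2)]
    by (intro C_on_add assms Suc.IH) auto
  then show ?case by (intro C_on_SucI[OF assms(1) 1]) (simp_all add: partial_def)
qed

lemma C_on_mult:
  fixes u v :: "real^'n::finite \<Rightarrow> real"
  shows "open S \<Longrightarrow> C_on k S u \<Longrightarrow> C_on k S v \<Longrightarrow> C_on k S (\<lambda>y. u y * v y)"
  using C_on_scaleR[of S k u v] by simp

lemma C_on_minus: "open S \<Longrightarrow> C_on k S u \<Longrightarrow> C_on k S (\<lambda>y. - u y)"
  using C_on_bounded_linear[OF bounded_linear_minus[OF bounded_linear_ident]] .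

lemma C_on_diff: "open S \<Longrightarrow> C_on k S u \<Longrightarrow> C_on k S v \<Longrightarrow> C_on k S (\<lambda>y. u y - v y)"
  using C_on_add[of S k u "\<lambda>y. - v y"] C_on_minus[of S k v] by simp

lemma C_on_prod:
  fixes u :: "'i \<Rightarrow> real^'n::finite \<Rightarrow> real"
  assumes "open S" "\<And>i. i \<in> F \<Longrightarrow> C_on k S (u i)"
  shows "C_on k S (\<lambda>y. \<Prod>i\<in>F. u i y)"
  using assms(2) by (induction F rule: infinite_finite_induct) (auto intro: C_on_mult[OF assms(1)])

lemma C_on_nth: "open S \<Longrightarrow> C_on k S u \<Longrightarrow> C_on k S (\<lambda>y. u y $ i)"
  using C_on_bounded_linear[OF bounded_linear_vec_nth] .

lemma C_on_ident [simp]: "C_on k (S :: (real^'n::finite) set) (\<lambda>y. y)"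
proof (cases k)
  case (Suc j)
  have "partial i (\<lambda>y. y) = (\<lambda>y. axis i 1)" for i :: 'n
    by (rule ext) (rule partial_eqI, rule has_derivative_ident)
  then show ?thesis using Suc by simp
qed simp

lemma C_on_vec:
  fixes u :: "real^'n::finite \<Rightarrow> real^'m::finite"
  assumes "open S" "\<And>i. C_on k S (\<lambda>y. u y $ i)"
  shows "C_on k S u"
proof -
  have "C_on k S (\<lambda>y. \<Sum>i\<in>UNIV. (u y $ i) *\<^sub>R (axis i 1 :: real^'m))"
    by (intro C_on_sum C_on_scaleR assms C_on_const)
  moreover have "(\<Sum>i\<in>UNIV. (u y $ i) *\<^sub>R (axis i 1 :: real^'m)) = u y" for y
    using basis_expansion[of "u y"] by (simp add: scalar_mult_eq_scaleR)
  ultimately show ?thesis by simp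
qed

text \<open>The chain rule produces \<open>partial i u\<close> composed with the same
  \<open>\<tau>\<close>; the induction therefore varies \<open>u\<close> and keeps
  \<open>\<tau>\<close> fixed.\<close>

lemma C_on_compose:
  fixes \<tau> :: "real^'n::finite \<Rightarrow> real^'m::finite"
  assumes "open S" "open T" "C_on k T u" "C_on k S \<tau>" "\<tau> ` S \<subseteq> T"
  shows "C_on k S (\<lambda>y. u (\<tau> y))"
  using assms(3,4)
proof (induction k arbitrary: u)
  case 0
  then show ?case using assms(5) by (auto intro: continuous_on_compose2)
next
  case (Suc k)
  have 1: "((\<lambda>y. u (\<tau> y)) has_derivative (\<lambda>h. \<Sum>i\<in>UNIV. frechet_derivative \<tau> (at y) h $ i *\<^sub>R partial i u (\<tau> y))) (at y)"
    if "y \<in> S" for y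
  proof -
    have "\<tau> y \<in> T" using assms(5) that by auto
    then have "u differentiable at (\<tau> y)" "\<tau> differentiable at y" using Suc.prems that by auto
    then show ?thesis
      using has_derivative_compose[OF _ has_derivative_partial_sum] frechet_derivative_works by blast
  qed
  have "C_on k S (\<lambda>y. partial i u (\<tau> y))" for i
    by (rule Suc.IH) (use Suc.prems C_on_Suc_imp in auto)
  then have "C_on k S (\<lambda>y. \<Sum>i\<in>UNIV. partial j \<tau> y $ i *\<^sub>R partial i u (\<tau> y))" for j
    using Suc.prems by (intro C_on_sum C_on_scaleR C_on_nth assms) auto
  then show ?case by (intro C_on_SucI[OF assms(1) 1]) (simp_all add: partial_def)
qed

text \<open>The derivative is again built from \<open>inverse (u y)\<close> and a partial derivative
  of \<open>u\<close>, so the induction on \<open>k\<close> closes. The square root below is treated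
  alike, its derivative containing \<open>inverse (sqrt (u y))\<close>.\<close>

lemma C_on_inverse:
  fixes u :: "real^'n::finite \<Rightarrow> real"
  assumes "open S" "C_on k S u" "\<And>y. y \<in> S \<Longrightarrow> u y \<noteq> 0"
  shows "C_on k S (\<lambda>y. inverse (u y))"
  using assms(2)
proof (induction k)
  case 0
  then show ?case using assms(3) by (auto intro: continuous_on_inverse)
next
  case (Suc k)
  have 1: "((\<lambda>y. inverse (u y)) has_derivative (\<lambda>h. - (inverse (u y) * frechet_derivative u (at y) h * inverse (u y)))) (at y)" if "y \<in> S" for y
    by (rule Deriv.has_derivative_inverse[OF assms(3)[OF that] C_on_has_derivative[OF Suc.prems that]])
  have "C_on k S (\<lambda>y. - (inverse (u y) * partial i u y * inverse (u y)))" for i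
    using Suc.prems C_on_Suc_imp[OF Suc.prems(1)]
    by (intro C_on_minus C_on_mult assms Suc.IH) auto
  then show ?case by (intro C_on_SucI[OF assms(1) 1]) (simp_all add: partial_def)
qed

lemma C_on_divide:
  fixes u v :: "real^'n::finite \<Rightarrow> real"
  assumes "open S" "C_on k S u" "C_on k S v" "\<And>y. y \<in> S \<Longrightarrow> v y \<noteq> 0"
  shows "C_on k S (\<lambda>y. u y / v y)"
  unfolding divide_inverse by (intro C_on_mult C_on_inverse assms)

lemma C_on_sqrt:
  fixes u :: "real^'n::finite \<Rightarrow> real"
  assumes "open S" "C_on k S u" "\<And>y. y \<in> S \<Longrightarrow> 0 < u y"
  shows "C_on k S (\<lambda>y. sqrt (u y))"
  using assms(2)
proof (induction k)
  case 0
  then show ?case by (auto intro: continuous_on_real_sqrt)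
next
  case (Suc k)
  have 1: "((\<lambda>y. sqrt (u y)) has_derivative (\<lambda>h. frechet_derivative u (at y) h * (inverse (sqrt (u y)) / 2))) (at y)" if "y \<in> S" for y
  proof (rule has_derivative_real_sqrt)
    show "(u has_derivative frechet_derivative u (at y)) (at y)"
      using Suc.prems that C_on_has_derivative by auto
  qed (use assms(3) that in auto)
  have "C_on k S (\<lambda>y. partial i u y * (inverse (sqrt (u y)) / 2))" for i
    using Suc.prems C_on_Suc_imp[OF Suc.prems(1)] assms(3)
    by (intro C_on_mult C_on_divide C_on_inverse assms(1) Suc.IH) (auto dest: assms(3))
  then show ?case by (intro C_on_SucI[OF assms(1) 1]) (simp_all add: partial_def)
qed

section \<open>Determinants and inverse matrices\<close>

lemma C_on_det:
  fixes M :: "real^'n::finite \<Rightarrow> real^'m::finite^'m"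
  assumes "open S" "\<And>i j. C_on k S (\<lambda>y. M y $ i $ j)"
  shows "C_on k S (\<lambda>y. det (M y))"
  unfolding det_def by (intro C_on_sum C_on_mult C_on_prod assms C_on_const)

lemma matrix_inv_inverse:
  fixes M :: "real^'m::finite^'m"
  assumes "det M \<noteq> 0"
  shows "M ** matrix_inv M = mat 1" "matrix_inv M ** M = mat 1"
proof -
  have "\<exists>N. M ** N = mat 1 \<and> N ** M = mat 1"
    using assms by (simp add: invertible_det_nz[symmetric] invertible_def)
  then show "M ** matrix_inv M = mat 1" "matrix_inv M ** M = mat 1"
    unfolding matrix_inv_def using someI_ex[of "\<lambda>N. M ** N = mat 1 \<and> N ** M = mat 1"] by blast+
qed

lemma matrix_vector_mult_left_cancel:
  fixes M :: "real^'m::finite^'m"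
  assumes "det M \<noteq> 0" "M *v x = M *v y"
  shows "x = y"
proof -
  have "matrix_inv M *v (M *v x) = matrix_inv M *v (M *v y)" by (simp only: assms(2))
  then show ?thesis by (simp add: matrix_vector_mul_assoc matrix_inv_inverse(2)[OF assms(1)])
qed

text \<open>\<open>matrix_inv\<close> is given by a choice operator. Its regularity is read off
  Cramer's rule, which presents the solution of a linear system as a quotient of
  determinants.\<close>

lemma C_on_solve:
  fixes M :: "real^'n::finite \<Rightarrow> real^'m::finite^'m"
  assumes "open S" "\<And>i j. C_on k S (\<lambda>y. M y $ i $ j)" "\<And>i. C_on k S (\<lambda>y. b y $ i)"
    and "\<And>y. y \<in> S \<Longrightarrow> det (M y) \<noteq> 0"
  shows "C_on k S (\<lambda>y. (matrix_inv (M y) *v b y) $ i)"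
proof -
  have *: "(matrix_inv (M y) *v b y) $ i
      = det (\<chi> r s. if s = i then b y $ r else M y $ r $ s) / det (M y)" if "y \<in> S" for y
  proof -
    have "M y ** matrix_inv (M y) = mat 1"
      using assms(4)[OF that] by (simp add: matrix_inv_inverse)
    then have "M y *v (matrix_inv (M y) *v b y) = b y"
      by (simp add: matrix_vector_mul_assoc)
    then show ?thesis using cramer[OF assms(4)[OF that], of "matrix_inv (M y) *v b y" "b y"]
      by (simp add: vec_eq_iff)
  qed
  have **: "C_on k S (\<lambda>y. det (\<chi> r s. if s = i then b y $ r else M y $ r $ s) / det (M y))"
  proof (intro C_on_divide C_on_det assms)
    show "C_on k S (\<lambda>y. (\<chi> r s. if s = i then b y $ r else M y $ r $ s) $ r $ s)" for r s
      using assms(2,3) by (cases "s = i") simp_all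
  qed
  show ?thesis
    by (rule iffD2[OF C_on_cong[OF assms(1)] **]) (rule *)
qed


section \<open>Measures defined chartwise\<close>

text \<open>The unique existence behind both volumes. A finite cover is cut into disjoint pieces
  \<open>P i\<close>, and a set is measured piece by piece with the \<open>\<nu>\<close> of the
  chart that owns the piece; consistency makes the result independent of this choice. Additivity of
  \<open>\<nu> c\<close> is asked for inside \<open>U c\<close> only, since a chart measures nothing
  beyond its domain.\<close>

lemma measure_gluing:
  fixes M :: "'a measure" and U :: "'c \<Rightarrow> 'a set" and \<nu> :: "'c \<Rightarrow> 'a set \<Rightarrow> ennreal"
  assumes F: "finite F" "F \<subseteq> C" "space M \<subseteq> (\<Union>c\<in>F. U c)"
    and U: "\<And>c. c \<in> C \<Longrightarrow> U c \<inter> space M \<in> sets M"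
    and empty: "\<And>c. c \<in> C \<Longrightarrow> \<nu> c {} = 0"
    and additive: "\<And>c A. c \<in> C \<Longrightarrow> range A \<subseteq> sets M \<Longrightarrow> disjoint_family A \<Longrightarrow> (\<Union>i. A i) \<subseteq> U c
        \<Longrightarrow> (\<Sum>i. \<nu> c (A i)) = \<nu> c (\<Union>i::nat. A i)"
    and consistent: "\<And>c c' B. c \<in> C \<Longrightarrow> c' \<in> C \<Longrightarrow> B \<in> sets M \<Longrightarrow> B \<subseteq> U c \<Longrightarrow> B \<subseteq> U c' \<Longrightarrow> \<nu> c B = \<nu> c' B"
  shows "\<exists>!\<mu>. sets \<mu> = sets M \<and> (\<forall>c\<in>C. \<forall>B\<in>sets M. B \<subseteq> U c \<longrightarrow> emeasure \<mu> B = \<nu> c B)"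
proof -
  obtain f :: "nat \<Rightarrow> 'c" and n where f: "F = f ` {i. i < n}"
    using finite_imp_nat_seg_image_inj_on[OF F(1)] by blast
  have fC: "f i \<in> C" if "i < n" for i using f F(2) that by auto
  define P where "P i = (U (f i) \<inter> space M) - (\<Union>j<i. U (f j) \<inter> space M)" for i
  have P_sets: "P i \<in> sets M" if "i < n" for i
    unfolding P_def using U fC that by (intro sets.Diff sets.finite_UN) (auto intro: U fC)
  have PU: "P i \<subseteq> U (f i)" for i by (auto simp: P_def)
  have disj: "disjoint_family_on P {..<n}"
    unfolding disjoint_family_on_def
  proof (intro ballI impI)
    fix i j :: nat assume "i \<noteq> j"
    then show "P i \<inter> P j = {}" by (cases "i < j") (auto simp: P_def)
  qed
  have cover: "(\<Union>i<n. B \<inter> P i) = B" if "B \<in> sets M" for B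
  proof -
    have "x \<in> (\<Union>i<n. B \<inter> P i)" if x: "x \<in> B" for x
    proof -
      have xs: "x \<in> space M" using x \<open>B \<in> sets M\<close> sets.sets_into_space by blast
      then have ex: "\<exists>i. i < n \<and> x \<in> U (f i)" using F(3) f by auto
      define i where "i = (LEAST i. i < n \<and> x \<in> U (f i))"
      have i: "i < n" "x \<in> U (f i)" unfolding i_def using LeastI_ex[OF ex] by auto
      have "x \<notin> U (f j)" if "j < i" for j
        using not_less_Least[OF that[unfolded i_def]] that i(1) by auto
      then have "x \<in> P i" using i xs by (auto simp: P_def)
      then show ?thesis using i x by auto
    qed
    then show ?thesis by auto
  qed
  have fin_add: "\<nu> c B = (\<Sum>i<n. \<nu> (f i) (B \<inter> P i))" if "c \<in> C" "B \<in> sets M" "B \<subseteq> U c" for c B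
  proof -
    \<comment> \<open>Empty sets extend the finite partition to a sequence, the form in which
      additivity is assumed.\<close>
    let ?A = "\<lambda>i. if i < n then B \<inter> P i else {}"
    have un: "(\<Union>i. ?A i) = B" using cover[OF that(2)] by (auto split: if_splits)
    have "\<nu> c B = (\<Sum>i. \<nu> c (?A i))"
    proof (subst additive)
      show "disjoint_family ?A"
        using disj unfolding disjoint_family_on_def by auto
    qed (use that P_sets un in auto)
    also have "\<dots> = (\<Sum>i<n. \<nu> c (?A i))"
      by (rule suminf_finite) (use empty that in auto)
    also have "\<dots> = (\<Sum>i<n. \<nu> (f i) (B \<inter> P i))"
    proof (rule sum.cong)
      fix i assume "i \<in> {..<n}"
      then have "\<nu> c (B \<inter> P i) = \<nu> (f i) (B \<inter> P i)"
        using that PU[of i] by (intro consistent fC sets.Int P_sets) auto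
      with \<open>i \<in> {..<n}\<close> show "\<nu> c (?A i) = \<nu> (f i) (B \<inter> P i)" by simp
    qed simp
    finally show ?thesis .
  qed
  define \<mu>0 where "\<mu>0 B = (\<Sum>i<n. \<nu> (f i) (B \<inter> P i))" for B
  define \<mu> where "\<mu> = measure_of (space M) (sets M) \<mu>0"
  have sets_\<mu>: "sets \<mu> = sets M" by (simp add: \<mu>_def sets.sigma_sets_eq)
  have em: "emeasure \<mu> B = \<mu>0 B" if "B \<in> sets M" for B
    unfolding \<mu>_def
  proof (rule emeasure_measure_of_sigma)
    show "sigma_algebra (space M) (sets M)" by (rule sets.sigma_algebra_axioms)
    show "positive (sets M) \<mu>0"
      unfolding positive_def \<mu>0_def using empty fC by auto
    show "countably_additive (sets M) \<mu>0"
      unfolding countably_additive_def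
    proof (intro allI impI)
      fix A :: "nat \<Rightarrow> 'a set" assume A: "range A \<subseteq> sets M" "disjoint_family A"
      have "(\<Sum>k. \<mu>0 (A k)) = (\<Sum>i<n. \<Sum>k. \<nu> (f i) (A k \<inter> P i))"
        unfolding \<mu>0_def by (rule suminf_sum) simp
      also have "\<dots> = (\<Sum>i<n. \<nu> (f i) (\<Union>k. A k \<inter> P i))"
      proof (rule sum.cong)
        fix i assume "i \<in> {..<n}"
        then show "(\<Sum>k. \<nu> (f i) (A k \<inter> P i)) = \<nu> (f i) (\<Union>k. A k \<inter> P i)"
          using A fC[of i] P_sets[of i] PU[of i]
          by (intro additive) (auto simp: disjoint_family_on_def dest: subsetD)
      qed simp
      finally show "(\<Sum>k. \<mu>0 (A k)) = \<mu>0 (\<Union> (range A))"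
        by (simp add: \<mu>0_def)
    qed
  qed (rule that)
  show ?thesis
  proof (rule ex1I[of _ \<mu>])
    show "sets \<mu> = sets M \<and> (\<forall>c\<in>C. \<forall>B\<in>sets M. B \<subseteq> U c \<longrightarrow> emeasure \<mu> B = \<nu> c B)"
      using sets_\<mu> em fin_add by (simp add: \<mu>0_def)
    fix \<mu>' assume \<mu>': "sets \<mu>' = sets M \<and> (\<forall>c\<in>C. \<forall>B\<in>sets M. B \<subseteq> U c \<longrightarrow> emeasure \<mu>' B = \<nu> c B)"
    show "\<mu>' = \<mu>"
    proof (rule measure_eqI)
      fix B assume "B \<in> sets \<mu>'"
      then have B: "B \<in> sets M" using \<mu>' by simp
      have "(\<Sum>i<n. emeasure \<mu>' (B \<inter> P i)) = emeasure \<mu>' (\<Union>i<n. B \<inter> P i)"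
        by (rule sum_emeasure)
           (use \<mu>' B P_sets disj in \<open>auto simp: disjoint_family_on_def\<close>)
      moreover have "emeasure \<mu>' (B \<inter> P i) = \<nu> (f i) (B \<inter> P i)" if "i < n" for i
        using \<mu>' fC[OF that] B P_sets[OF that] le_infI2[OF PU, of B i] by blast
      ultimately show "emeasure \<mu>' B = emeasure \<mu> B"
        using cover[OF B] em[OF B] by (simp add: \<mu>0_def)
    qed (use \<mu>' sets_\<mu> in simp)
  qed
qed

section \<open>Integration in coordinates\<close>

lemma sigma_finite_lborel_family: "product_sigma_finite (\<lambda>_. lborel :: 'a::euclidean_space measure)"
  unfolding product_sigma_finite_def by (simp add: sigma_finite_lborel)

lemma borel_measurable_vec_lambda:
  fixes f :: "'a \<Rightarrow> 'n::finite \<Rightarrow> real"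
  assumes "\<And>i. (\<lambda>x. f x i) \<in> borel_measurable M"
  shows "(\<lambda>x. \<chi> i. f x i) \<in> borel_measurable M"
  unfolding borel_measurable_euclidean_space[of "\<lambda>x. \<chi> i. f x i"]
  using assms by (auto simp: Basis_vec_def inner_axis)

lemma continuous_on_glue: "continuous_on S (\<lambda>y. glue I (($) y) t)"
  unfolding glue_def
proof (rule continuous_on_vec_lambda)
  show "continuous_on S (\<lambda>y. if i \<in> I then y $ i else t i)" for i
    by (cases "i \<in> I") (auto intro: continuous_intros)
qed

lemma nth_vec_lambda: "($) (vec_lambda z) = z"
  by (rule ext) simp

lemma glue_vec_measurable: "(\<lambda>y. glue I (($) y) t) \<in> borel_measurable borel"
  by (intro borel_measurable_continuous_onI continuous_on_glue)

text \<open>Both measures assign to a box the product of its side lengths. This links the product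
  measures in \<open>leaf_volume\<close> with \<open>lborel\<close> on
  \<open>real^'n\<close>.\<close>

lemma distr_PiM_lborel:
  "distr (Pi\<^sub>M (UNIV::'n::finite set) (\<lambda>_. lborel)) borel (\<lambda>z. \<chi> i. z i) = (lborel :: (real^'n) measure)"
proof (rule lborel_eqI[symmetric])
  interpret product_sigma_finite "\<lambda>_::'n. lborel :: real measure" by (rule sigma_finite_lborel_family)
  have m: "(\<lambda>z. \<chi> i. z i) \<in> borel_measurable (Pi\<^sub>M (UNIV::'n set) (\<lambda>_. lborel :: real measure))"
    by (rule borel_measurable_vec_lambda) auto
  fix l u :: "real^'n" assume lu: "\<And>b. b \<in> Basis \<Longrightarrow> l \<bullet> b \<le> u \<bullet> b"
  have lu': "l $ i \<le> u $ i" for i using lu[of "axis i 1"] by (simp add: inner_axis)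
  have "(\<lambda>z. \<chi> i. z i) -` box l u \<inter> space (Pi\<^sub>M (UNIV::'n set) (\<lambda>_. lborel))
      = Pi\<^sub>E UNIV (\<lambda>i. {l $ i <..< u $ i})"
    by (fastforce simp: mem_box_cart space_PiM PiE_def)
  then have "emeasure (distr (Pi\<^sub>M (UNIV::'n set) (\<lambda>_. lborel)) borel (\<lambda>z. \<chi> i. z i)) (box l u)
      = (\<Prod>i\<in>UNIV. emeasure lborel {l $ i <..< u $ i})"
    by (simp add: emeasure_distr m emeasure_PiM)
  also have "\<dots> = ennreal (\<Prod>i\<in>UNIV. (u - l) $ i)"
    using lu' by (simp add: prod_ennreal)
  also have "(\<Prod>i\<in>UNIV. (u - l) $ i) = (\<Prod>b\<in>Basis. (u - l) \<bullet> b)"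
    unfolding Basis_vec_def
    by (simp add: prod.UNION_disjoint axis_eq_axis inner_axis)
  finally show "emeasure (distr (Pi\<^sub>M (UNIV::'n set) (\<lambda>_. lborel)) borel (\<lambda>z. \<chi> i. z i)) (box l u)
      = ennreal (\<Prod>b\<in>Basis. (u - l) \<bullet> b)" .
qed simp

definition cube :: "'n::finite set \<Rightarrow> (real^'n) set" where
  "cube I = {y. \<forall>j\<in>-I. 0 \<le> y $ j \<and> y $ j \<le> 1}"

lemma cube_borel [measurable]: "cube (I :: 'n::finite set) \<in> sets borel"
proof -
  have "closed (\<Inter>j\<in>-I. {y::real^'n. 0 \<le> y $ j} \<inter> {y. y $ j \<le> 1})"
    by (intro closed_INT ballI closed_Int closed_Collect_le continuous_intros)
  moreover have "cube I = (\<Inter>j\<in>-I. {y. 0 \<le> y $ j} \<inter> {y. y $ j \<le> 1})"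
    by (auto simp: cube_def)
  ultimately show ?thesis by (simp add: borel_closed)
qed

text \<open>
  The unit cube in the transverse directions turns integrals over \<open>\<real>\<^sup>I\<close> into integrals over the whole
  coordinate space, where the change of variables formula is available.
\<close>

lemma nn_integral_slice:
  fixes G :: "real^'n::finite \<Rightarrow> ennreal"
  assumes G[measurable]: "G \<in> borel_measurable borel"
  shows "(\<integral>\<^sup>+ z. G (glue I z t) \<partial>(\<Pi>\<^sub>M i\<in>I. lborel))
       = (\<integral>\<^sup>+ y. G (glue I (($) y) t) * indicator (cube I) y \<partial>lborel)"
proof -
  interpret product_sigma_finite "\<lambda>_::'n. lborel :: real measure" by (rule sigma_finite_lborel_family)
  let ?M = "\<lambda>J. Pi\<^sub>M (J::'n set) (\<lambda>_. lborel :: real measure)"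
  have m: "(\<lambda>z. \<chi> i. z i) \<in> borel_measurable (?M UNIV)"
    by (rule borel_measurable_vec_lambda) auto
  have mH: "(\<lambda>y. G (glue I (($) y) t) * indicator (cube I) y) \<in> borel_measurable borel"
    using measurable_compose[OF glue_vec_measurable G] by measurable
  have "(\<integral>\<^sup>+ y. G (glue I (($) y) t) * indicator (cube I) y \<partial>lborel)
      = (\<integral>\<^sup>+ z. G (glue I z t) * indicator (cube I) (\<chi> i. z i) \<partial>?M (I \<union> -I))"
    by (subst distr_PiM_lborel[symmetric], subst nn_integral_distr[OF m])
       (use mH in \<open>auto simp: nth_vec_lambda\<close>)
  \<comment> \<open>Fubini splits leaf and transverse coordinates. The integrand depends on the
    latter only through the indicator of a cube of measure 1.\<close>
  also have "\<dots> = (\<integral>\<^sup>+ x. (\<integral>\<^sup>+ y. G (glue I (merge I (-I) (x, y)) t) *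
        indicator (cube I) (\<chi> i. merge I (-I) (x, y) i) \<partial>?M (-I)) \<partial>?M I)"
  proof (rule product_nn_integral_fold)
    have "(\<lambda>z. G (glue I (($) (\<chi> i. z i)) t) * indicator (cube I) (\<chi> i. z i)) \<in> borel_measurable (?M UNIV)"
      using measurable_compose[OF m mH] .
    then show "(\<lambda>z. G (glue I z t) * indicator (cube I) (\<chi> i. z i)) \<in> borel_measurable (?M (I \<union> - I))"
      by (simp add: nth_vec_lambda)
  qed auto
  also have "\<dots> = (\<integral>\<^sup>+ x. (\<integral>\<^sup>+ y. G (glue I x t) * indicator (Pi\<^sub>E (-I) (\<lambda>_. {0..1})) y \<partial>?M (-I)) \<partial>?M I)"
  proof (intro nn_integral_cong)
    fix x y assume "x \<in> space (?M I)" "y \<in> space (?M (-I))"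
    then have "glue I (merge I (-I) (x, y)) t = glue I x t"
      "(\<chi> i. merge I (-I) (x, y) i) \<in> cube I \<longleftrightarrow> y \<in> Pi\<^sub>E (-I) (\<lambda>_. {0..1})"
      by (auto simp: glue_def merge_def vec_eq_iff cube_def space_PiM PiE_def)
    then show "G (glue I (merge I (-I) (x, y)) t) * indicator (cube I) (\<chi> i. merge I (-I) (x, y) i)
      = G (glue I x t) * indicator (Pi\<^sub>E (-I) (\<lambda>_. {0..1})) y"
      by (simp add: indicator_def)
  qed
  also have "\<dots> = (\<integral>\<^sup>+ x. G (glue I x t) \<partial>?M I)"
  proof (intro nn_integral_cong)
    fix x
    have "Pi\<^sub>E (-I) (\<lambda>_. {0..1::real}) \<in> sets (?M (-I))"
      by (rule sets_PiM_I_finite) auto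
    moreover have "emeasure (?M (-I)) (Pi\<^sub>E (-I) (\<lambda>_. {0..1})) = 1"
      by (subst emeasure_PiM) auto
    ultimately show "(\<integral>\<^sup>+ y. G (glue I x t) * indicator (Pi\<^sub>E (-I) (\<lambda>_. {0..1})) y \<partial>?M (-I)) = G (glue I x t)"
      by (simp add: nn_integral_cmult_indicator)
  qed
  finally show ?thesis ..
qed

text \<open>The known formula speaks of vector-valued functions that are absolutely integrable on a
  set with respect to \<open>lebesgue\<close>. Borel measurability of both integrands carries it
  over to Bochner integrals over \<open>lborel\<close>.\<close>

lemma lborel_change_of_variables:
  fixes g :: "real^'m::{finite,wellorder} \<Rightarrow> real^'m::_" and w :: "real^'m::_ \<Rightarrow> real"
  assumes D: "D \<in> sets borel"
    and der: "\<And>x. x \<in> D \<Longrightarrow> (g has_derivative g' x) (at x within D)"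
    and inj: "inj_on g D"
    and W: "(\<lambda>y. indicator (g ` D) y * w y) \<in> borel_measurable borel"
    and V: "(\<lambda>x. indicator D x * (\<bar>det (matrix (g' x))\<bar> * w (g x))) \<in> borel_measurable borel"
  shows integrable_lborel_change_of_variables:
      "integrable lborel (\<lambda>y. indicator (g ` D) y * w y) \<longleftrightarrow>
       integrable lborel (\<lambda>x. indicator D x * (\<bar>det (matrix (g' x))\<bar> * w (g x)))" (is "?iW \<longleftrightarrow> ?iV")
    and integral_lborel_change_of_variables:
      "(\<integral>y. indicator (g ` D) y * w y \<partial>lborel) =
       (\<integral>x. indicator D x * (\<bar>det (matrix (g' x))\<bar> * w (g x)) \<partial>lborel)" (is "?W = ?V")
proof -
  let ?v = "\<lambda>x. \<bar>det (matrix (g' x))\<bar> * w (g x)"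
  \<comment> \<open>Real functions enter as maps to \<open>real^1\<close>. Since \<open>b\<close> is
    free, one equivalence yields both the transfer of integrability and the equality of the
    integrals.\<close>
  have main: "(?v absolutely_integrable_on D \<and> integral D ?v = b) \<longleftrightarrow>
      (w absolutely_integrable_on (g ` D) \<and> integral (g ` D) w = b)" for b
    using has_absolute_integral_change_of_variables[OF _ der inj, of "\<lambda>y. vec (w y) :: real^1" "vec b"] D
    unfolding absolutely_integrable_on_1_iff integral_on_1_eq by (simp add: vec_eq_iff)
  have iW: "w absolutely_integrable_on (g ` D) \<longleftrightarrow> ?iW"
    using W by (simp add: set_integrable_def integrable_completion)
  have iV: "?v absolutely_integrable_on D \<longleftrightarrow> ?iV"
    using V by (simp add: set_integrable_def integrable_completion)
  show iff: "?iW \<longleftrightarrow> ?iV"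
    using main[of "integral D ?v"] main[of "integral (g ` D) w"] iW iV by blast
  show "?W = ?V"
  proof (cases ?iW)
    case True
    then have "w absolutely_integrable_on (g ` D)" "?v absolutely_integrable_on D"
      using iff iW iV by auto
    then have "integral (g ` D) w = (LINT x:(g ` D)|lebesgue. w x)" "integral D ?v = (LINT x:D|lebesgue. ?v x)"
      by (simp_all add: set_lebesgue_integral_eq_integral(2))
    moreover have "(LINT x:(g ` D)|lebesgue. w x) = ?W" "(LINT x:D|lebesgue. ?v x) = ?V"
      using W V by (simp_all add: set_lebesgue_integral_def integral_completion)
    moreover have "integral (g ` D) w = integral D ?v"
      using main[of "integral (g ` D) w"] \<open>w absolutely_integrable_on (g ` D)\<close> by simp
    ultimately show ?thesis by simp
  next
    case False
    then show ?thesis using iff by (simp add: not_integrable_integral_eq)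
  qed
qed

text \<open>For integrable functions this is the signed formula. Otherwise integrability fails on
  both sides, and for nonnegative measurable functions both integrals are then infinite.\<close>

lemma nn_integral_lborel_change_of_variables:
  fixes g :: "real^'m::{finite,wellorder} \<Rightarrow> real^'m::_" and w :: "real^'m::_ \<Rightarrow> real"
  assumes D: "D \<in> sets borel"
    and der: "\<And>x. x \<in> D \<Longrightarrow> (g has_derivative g' x) (at x within D)"
    and inj: "inj_on g D"
    and W: "(\<lambda>y. indicator (g ` D) y * w y) \<in> borel_measurable borel"
    and V: "(\<lambda>x. indicator D x * (\<bar>det (matrix (g' x))\<bar> * w (g x))) \<in> borel_measurable borel"
    and nonneg: "\<And>y. y \<in> g ` D \<Longrightarrow> 0 \<le> w y"
  shows "(\<integral>\<^sup>+y. ennreal (indicator (g ` D) y * w y) \<partial>lborel) =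
       (\<integral>\<^sup>+x. ennreal (indicator D x * (\<bar>det (matrix (g' x))\<bar> * w (g x))) \<partial>lborel)"
proof -
  let ?W = "\<lambda>y. indicator (g ` D) y * w y" and ?V = "\<lambda>x. indicator D x * (\<bar>det (matrix (g' x))\<bar> * w (g x))"
  have nn: "0 \<le> ?W y" "0 \<le> ?V x" for x y
    using nonneg by (auto simp: indicator_def)
  show ?thesis
  proof (cases "integrable lborel ?W")
    case True
    then have "integrable lborel ?V"
      using integrable_lborel_change_of_variables[OF D der inj W V] by simp
    with True show ?thesis
      using integral_lborel_change_of_variables[OF D der inj W V] nn
      by (simp add: nn_integral_eq_integral)
  next
    case False
    then have "\<not> integrable lborel ?V"
      using integrable_lborel_change_of_variables[OF D der inj W V] by simp
    moreover have "nn_integral lborel (\<lambda>x. ennreal (u x)) = \<infinity>"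
      if "\<not> integrable lborel u" "u \<in> borel_measurable borel" "\<And>x. 0 \<le> u x" for u :: "real^'m::_ \<Rightarrow> real"
    proof (rule ccontr)
      assume "nn_integral lborel (\<lambda>x. ennreal (u x)) \<noteq> \<infinity>"
      then have "integrable lborel u"
        by (intro integrableI_nonneg) (use that in \<open>simp_all add: less_top\<close>)
      with that show False by simp
    qed
    ultimately show ?thesis using False W V nn by presburger
  qed
qed

text \<open>
  The difference quotients in a fixed direction integrate to zero by translation invariance and
  converge boundedly to the derivative.
\<close>

lemma integral_directional_derivative_eq_0:
  fixes v D :: "'a::euclidean_space \<Rightarrow> real"
  assumes der: "\<And>y. ((\<lambda>s. v (y + s *\<^sub>R e)) has_real_derivative D y) (at 0)"
    and v: "v \<in> borel_measurable borel" "\<And>y. \<bar>v y\<bar> \<le> K" "\<And>y. \<bar>D y\<bar> \<le> K"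
    and supp: "\<And>y. v y \<noteq> 0 \<Longrightarrow> norm y \<le> R"
  shows "integrable lborel D" "(\<integral>y. D y \<partial>lborel) = 0"
proof -
  define q where "q n y = (v (y + (1 / real (Suc n)) *\<^sub>R e) - v y) * real (Suc n)" for n y
  have q_lim: "(\<lambda>n. q n y) \<longlonglongrightarrow> D y" for y
  proof -
    have "((\<lambda>s. (v (y + s *\<^sub>R e) - v y) / s) \<longlongrightarrow> D y) (at 0)"
      using der[of y] by (simp add: has_field_derivative_iff)
    moreover have "filterlim (\<lambda>n. 1 / real (Suc n)) (at 0) sequentially"
      unfolding filterlim_at using LIMSEQ_inverse_real_of_nat by (simp add: inverse_eq_divide)
    ultimately show ?thesis
      using filterlim_compose by (fastforce simp: q_def)
  qed
  have [measurable]: "v \<in> borel_measurable borel" by (rule v)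
  have q_meas: "q n \<in> borel_measurable lborel" for n
    unfolding q_def by measurable
  have D_meas: "D \<in> borel_measurable lborel"
    using borel_measurable_LIMSEQ_metric[of q lborel D] q_lim q_meas by blast
  have der_at: "((\<lambda>s. v (y + s *\<^sub>R e)) has_real_derivative D (y + s *\<^sub>R e)) (at s)" for y s
  proof -
    have "((\<lambda>r. v (y + (r + s) *\<^sub>R e)) has_real_derivative D (y + s *\<^sub>R e)) (at 0)"
      using der[of "y + s *\<^sub>R e"] by (simp add: algebra_simps)
    then show ?thesis
      using DERIV_shift[of "\<lambda>s. v (y + s *\<^sub>R e)" _ 0 s] by simp
  qed
  \<comment> \<open>By the mean value theorem a difference quotient is a value of \<open>D\<close>,
    so the bound on the derivative serves for all quotients.\<close>
  have q_bound: "\<bar>q n y\<bar> \<le> K" for n y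
  proof -
    let ?h = "1 / real (Suc n)"
    obtain z where z: "v (y + ?h *\<^sub>R e) - v (y + 0 *\<^sub>R e) = (?h - 0) * D (y + z *\<^sub>R e)"
      using MVT2[of 0 ?h "\<lambda>s. v (y + s *\<^sub>R e)" "\<lambda>s. D (y + s *\<^sub>R e)"] der_at by auto
    then have "q n y = D (y + z *\<^sub>R e)" by (simp add: q_def)
    then show ?thesis using v by simp
  qed
  \<comment> \<open>The translations have length at most \<open>norm e\<close>. All quotients vanish
    outside this enlarged ball, so a multiple of its indicator dominates them.\<close>
  let ?R = "R + norm e"
  have q_supp: "q n y = 0" if "y \<notin> cball 0 ?R" for n y
  proof -
    have "v (y + (1 / real (Suc n)) *\<^sub>R e) = 0"
    proof (rule ccontr)
      assume "\<not> ?thesis"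
      then have "norm (y + (1 / real (Suc n)) *\<^sub>R e) \<le> R" using supp by blast
      moreover have "norm ((1 / real (Suc n)) *\<^sub>R e) \<le> norm e"
        using mult_left_mono[of 1 "1 + real n" "norm e"] by (simp add: divide_le_eq)
      ultimately show False using that norm_diff_ineq[of y "(1 / real (Suc n)) *\<^sub>R e"] by simp
    qed
    moreover have "v y = 0"
    proof (rule ccontr)
      assume "v y \<noteq> 0"
      then have "norm y \<le> R" by (rule supp)
      with that norm_ge_zero[of e] show False by simp
    qed
    ultimately show ?thesis by (simp add: q_def)
  qed
  have K0: "0 \<le> K" using v(2)[of 0] by linarith
  define w where "w y = K * indicator (cball 0 ?R) y" for y :: 'a
  have w_int: "integrable lborel w"
    unfolding w_def
    by (intro integrable_mult_right integrable_real_indicator) (use emeasure_bounded_finite[OF bounded_cball] in \<open>auto simp: top.not_eq_extremum\<close>)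
  have q_w: "norm (q n y) \<le> w y" for n y
    using q_bound[of n y] q_supp[of y n] K0 by (auto simp: w_def indicator_def)
  have v_int: "integrable lborel v"
  proof (rule Bochner_Integration.integrable_bound)
    show "integrable lborel (\<lambda>y::'a. K * indicator (cball 0 R) y)"
      by (intro integrable_mult_right integrable_real_indicator) (use emeasure_bounded_finite[OF bounded_cball] in \<open>auto simp: top.not_eq_extremum\<close>)
    show "AE y in lborel. norm (v y) \<le> norm (K * indicator (cball 0 R) y)"
    proof (rule AE_I2)
      fix y show "norm (v y) \<le> norm (K * indicator (cball 0 R) y)"
        using supp[of y] v(2)[of y] K0 by (cases "v y = 0") auto
    qed
  qed simp
  have q_zero: "integral\<^sup>L lborel (q n) = 0" for n
  proof -
    let ?c = "(1 / real (Suc n)) *\<^sub>R e"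
    have *: "integrable (distr lborel borel ((+) ?c)) v" using v_int by (simp add: lborel_distr_plus)
    have i: "integrable lborel (\<lambda>y. v (?c + y))"
      using * by (subst (asm) integrable_distr_eq) auto
    have "integral\<^sup>L lborel (\<lambda>y. v (?c + y)) = integral\<^sup>L (distr lborel borel ((+) ?c)) v"
      by (subst integral_distr) auto
    then have "integral\<^sup>L lborel (\<lambda>y. v (?c + y)) = integral\<^sup>L lborel v"
      by (simp add: lborel_distr_plus)
    then show ?thesis
      unfolding q_def using i v_int by (simp add: add.commute)
  qed
  show "integrable lborel D"
    by (rule integrable_dominated_convergence[where s=q and w=w]) (use D_meas q_meas w_int q_lim q_w in auto)
  have "(\<lambda>n. integral\<^sup>L lborel (q n)) \<longlonglongrightarrow> integral\<^sup>L lborel D"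
    by (rule integral_dominated_convergence[where w=w]) (use D_meas q_meas w_int q_lim q_w in auto)
  then show "(\<integral>y. D y \<partial>lborel) = 0"
    by (simp add: q_zero LIMSEQ_const_iff)
qed


section \<open>Charts\<close>

lemma
  assumes "is_chart c"
  shows chart_inv_map: "x \<in> chart_dom c \<Longrightarrow> chart_inv c (chart_map c x) = x"
    and chart_map_inv: "y \<in> chart_map c ` chart_dom c \<Longrightarrow> chart_map c (chart_inv c y) = y"
    and chart_inv_in: "y \<in> chart_map c ` chart_dom c \<Longrightarrow> chart_inv c y \<in> chart_dom c"
    and chart_inj: "inj_on (chart_map c) (chart_dom c)"
    and chart_dom_open: "open (chart_dom c)"
    and chart_target_open: "open (chart_map c ` chart_dom c)"
    and continuous_on_chart: "continuous_on (chart_dom c) (chart_map c)"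
    and continuous_on_chart_inv: "continuous_on (chart_map c ` chart_dom c) (chart_inv c)"
  using assms unfolding is_chart_def homeomorphism_def by (auto intro: inj_on_inverseI)

text \<open>Images under a chart become preimages under \<open>chart_inv\<close>, whose continuity
  then gives openness and measurability.\<close>

lemma chart_image_eq:
  assumes "is_chart c" "B \<subseteq> chart_dom c"
  shows "chart_map c ` B = chart_inv c -` B \<inter> chart_map c ` chart_dom c"
proof
  show "chart_map c ` B \<subseteq> chart_inv c -` B \<inter> chart_map c ` chart_dom c"
    using assms chart_inv_map[OF assms(1)] by fastforce
  show "chart_inv c -` B \<inter> chart_map c ` chart_dom c \<subseteq> chart_map c ` B"
  proof
    fix y assume "y \<in> chart_inv c -` B \<inter> chart_map c ` chart_dom c"
    then have "chart_inv c y \<in> B" "chart_map c (chart_inv c y) = y"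
      using chart_map_inv[OF assms(1)] by auto
    then show "y \<in> chart_map c ` B" by (metis imageI)
  qed
qed

lemma chart_image_mem_iff:
  assumes "is_chart c" "B \<subseteq> chart_dom c" "x \<in> chart_dom c"
  shows "chart_map c x \<in> chart_map c ` B \<longleftrightarrow> x \<in> B"
  using assms chart_inj[OF assms(1)] by (auto dest: inj_onD)

lemma chart_image_open:
  assumes "is_chart c" "open W" "W \<subseteq> chart_dom c"
  shows "open (chart_map c ` W)"
  unfolding chart_image_eq[OF assms(1,3)] using continuous_on_chart_inv[OF assms(1)]
    chart_target_open[OF assms(1)] assms(2)
  by (simp add: continuous_on_open_vimage Int_commute)

lemma chart_image_borel:
  fixes c :: "('a::topological_space, 'n::finite) chart"
  assumes "is_chart c" "B \<in> sets borel" "B \<subseteq> chart_dom c"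
  shows "chart_map c ` B \<in> sets borel"
proof -
  have "chart_inv c \<in> borel_measurable (restrict_space borel (chart_map c ` chart_dom c))"
    by (intro borel_measurable_continuous_on_restrict continuous_on_chart_inv assms)
  from measurable_sets[OF this assms(2)] show ?thesis
    using chart_target_open[OF assms(1)] chart_image_eq[OF assms(1,3)]
    by (simp add: sets_restrict_space_iff space_restrict_space)
qed

lemma chart_vimage_open:
  assumes "is_chart c" "open V"
  shows "open (chart_dom c \<inter> chart_map c -` V)"
  using continuous_on_chart[OF assms(1)] chart_dom_open[OF assms(1)] assms(2)
  by (simp add: continuous_on_open_vimage Int_commute)

lemma transition_map: "is_chart c \<Longrightarrow> x \<in> chart_dom c \<Longrightarrow> transition c c' (chart_map c x) = chart_map c' x"
  by (simp add: transition_def chart_inv_map)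

lemma maximal_atlas_is_chart: "c \<in> maximal_atlas A \<Longrightarrow> is_chart c"
  by (simp add: maximal_atlas_def)

lemma atlas_subset_maximal: "smooth_atlas A \<Longrightarrow> A \<subseteq> maximal_atlas A"
  by (auto simp: smooth_atlas_def maximal_atlas_def)

text \<open>By definition, charts of the maximal atlas are compatible with the charts of
  \<open>A\<close> only. For two of them, the transition is factored near each point through a chart
  \<open>a\<close> of \<open>A\<close>.\<close>

lemma transition_C_on:
  fixes c c' :: "('a::topological_space, 'n::finite) chart"
  assumes A: "smooth_atlas A" and c: "c \<in> maximal_atlas A" and c': "c' \<in> maximal_atlas A"
  shows "C_on k (chart_map c ` (chart_dom c \<inter> chart_dom c')) (transition c c')"
proof (rule C_on_local)
  fix y assume "y \<in> chart_map c ` (chart_dom c \<inter> chart_dom c')"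
  then obtain x where x: "x \<in> chart_dom c" "x \<in> chart_dom c'" "y = chart_map c x" by auto
  obtain a where a: "a \<in> A" "x \<in> chart_dom a" using A unfolding smooth_atlas_def by blast
  have ch: "is_chart c" "is_chart c'" "is_chart a"
    using c c' a A by (auto simp: maximal_atlas_def smooth_atlas_def)
  define W where "W = chart_map c ` (chart_dom c \<inter> chart_dom c' \<inter> chart_dom a)"
  have W: "open W" unfolding W_def
    by (intro chart_image_open open_Int chart_dom_open ch) auto
  have 1: "C_on k W (transition c a)"
    using c a unfolding maximal_atlas_def smoothly_compatible_def smooth_on_def W_def
    by (auto intro: C_on_subset)
  have 2: "C_on k (chart_map a ` (chart_dom c' \<inter> chart_dom a)) (transition a c')"
    using c' a unfolding maximal_atlas_def smoothly_compatible_def smooth_on_def by auto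
  have "C_on k W (\<lambda>y. transition a c' (transition c a y))"
  proof (rule C_on_compose[OF W _ 2 1])
    show "open (chart_map a ` (chart_dom c' \<inter> chart_dom a))"
      by (intro chart_image_open open_Int chart_dom_open ch) auto
    show "transition c a ` W \<subseteq> chart_map a ` (chart_dom c' \<inter> chart_dom a)"
      unfolding W_def by (auto simp: transition_map[OF ch(1)])
  qed
  moreover have "transition a c' (transition c a y) = transition c c' y" if "y \<in> W" for y
    using that unfolding W_def by (auto simp: transition_map[OF ch(1)] transition_map[OF ch(3)])
  ultimately have "C_on k W (transition c c')"
    using C_on_cong[OF W] by (metis (no_types, lifting))
  moreover have "y \<in> W" using x a by (auto simp: W_def)
  ultimately show "\<exists>W. open W \<and> y \<in> W \<and> C_on k W (transition c c')" using W by blast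
qed

section \<open>Leaf blocks of Gram matrices\<close>

text \<open>The leaf coordinates of \<open>y\<close> are kept and the transverse ones replaced by
  \<open>t\<close>. Functions on a slice thus become functions on the whole coordinate space, in
  which the transverse entries of \<open>y\<close> are dummies.\<close>

abbreviation on_slice :: "'n::finite set \<Rightarrow> ('n \<Rightarrow> real) \<Rightarrow> real^'n \<Rightarrow> real^'n" where
  "on_slice I t y \<equiv> glue I (($) y) t"

lemma glue_nth: "glue I z t $ i = (if i \<in> I then z i else t i)"
  by (simp add: glue_def)

lemma glue_on_slice [simp]: "glue I (($) (glue I z t)) t' = glue I z t'"
  by (simp add: glue_def vec_eq_iff)

lemma glue_self [simp]: "glue I (($) y) (($) y) = y"
  by (simp add: glue_def vec_eq_iff)

lemma on_slice_C_on: "C_on k (S :: (real^'n::finite) set) (on_slice I t)"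
proof -
  have "C_on k (UNIV :: (real^'n) set) (on_slice I t)"
  proof (rule C_on_vec)
    show "C_on k UNIV (\<lambda>y::real^'n. on_slice I t y $ i)" for i
      by (cases "i \<in> I") (auto simp: glue_nth intro: C_on_nth)
  qed simp
  then show ?thesis by (rule C_on_subset) simp
qed

text \<open>The linear part of \<open>on_slice I t\<close> is the projection that kills the
  transverse axes.\<close>

lemma partial_on_slice:
  fixes u :: "real^'n::finite \<Rightarrow> 'b::real_normed_vector"
  assumes "u differentiable (at (on_slice I t y))"
  shows "partial j (\<lambda>y. u (on_slice I t y)) y = (if j \<in> I then partial j u (on_slice I t y) else 0)"
proof -
  let ?L = "\<lambda>h::real^'n. glue I (($) h) (\<lambda>_. 0)"
  have "bounded_linear ?L"
    by (intro linear_conv_bounded_linear[THEN iffD1] linearI) (auto simp: glue_def vec_eq_iff)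
  then have "(?L has_derivative ?L) (at y)" by (rule bounded_linear_imp_has_derivative)
  from has_derivative_add[OF this has_derivative_const[of "glue I (\<lambda>_. 0) t"]]
  have d: "(on_slice I t has_derivative ?L) (at y)"
    by (rule has_derivative_eq_rhs[OF has_derivative_transform[rotated 2]]) (auto simp: glue_def vec_eq_iff)
  have "((\<lambda>y. u (on_slice I t y)) has_derivative (\<lambda>h. frechet_derivative u (at (on_slice I t y)) (?L h))) (at y)"
    using has_derivative_compose[OF d] assms frechet_derivative_works by blast
  then have "partial j (\<lambda>y. u (on_slice I t y)) y = frechet_derivative u (at (on_slice I t y)) (?L (axis j 1))"
    by (rule partial_eqI)
  moreover have "?L (axis j 1) = (if j \<in> I then axis j 1 else 0)"
    by (auto simp: glue_def vec_eq_iff axis_def)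
  moreover have "frechet_derivative u (at (on_slice I t y)) 0 = 0"
    using assms by (simp add: linear_0 linear_frechet_derivative)
  ultimately show ?thesis by (simp add: partial_def)
qed

text \<open>These rules for \<open>I = UNIV\<close> reduce the constructions on slices to those on
  the manifold itself, which makes the Riemannian volume a special case.\<close>

lemma leaf_gram_UNIV [simp]: "leaf_gram UNIV G = G"
  by (simp add: leaf_gram_def vec_eq_iff)

lemma glue_UNIV [simp]: "glue UNIV (($) y) t = y"
  by (simp add: glue_def vec_eq_iff)

lemma cube_UNIV [simp]: "cube UNIV = UNIV"
  by (simp add: cube_def)

text \<open>\<open>J\<close> is block triangular, as leaf directions have no transverse component in
  the image. Hence the leaf block of the congruent matrix involves only the leaf blocks of
  \<open>J\<close> and \<open>G'\<close>, and the identity in the transverse block is carried to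
  itself.\<close>

lemma leaf_gram_congruence:
  fixes G G' J :: "real^'n::finite^'n"
  assumes "G = transpose J ** G' ** J" "\<And>i j. i \<notin> I \<Longrightarrow> j \<in> I \<Longrightarrow> J $ i $ j = 0"
  shows "leaf_gram I G = transpose (leaf_gram I J) ** leaf_gram I G' ** leaf_gram I J"
proof -
  let ?L = "\<lambda>M. leaf_gram I (M :: real^'n^'n)"
  have "(transpose (?L J) ** ?L G' ** ?L J) $ a $ b = ?L G $ a $ b" for a b
  proof -
    have expand: "(transpose P ** Q ** P) $ a $ b = (\<Sum>k\<in>UNIV. (\<Sum>i\<in>UNIV. P $ i $ a * Q $ i $ k) * P $ k $ b)"
      for P Q :: "real^'n^'n"
      by (simp add: matrix_matrix_mult_def transpose_def)
    show ?thesis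
    proof (cases "a \<in> I")
      case a: True
      have inner: "(\<Sum>i\<in>UNIV. ?L J $ i $ a * ?L G' $ i $ k) = (if k \<in> I then \<Sum>i\<in>I. J $ i $ a * G' $ i $ k else 0)" for k
      proof -
        have "(\<Sum>i\<in>UNIV. ?L J $ i $ a * ?L G' $ i $ k) = (\<Sum>i\<in>I. ?L J $ i $ a * ?L G' $ i $ k)"
          using a by (intro sum.mono_neutral_right) (auto simp: leaf_gram_def)
        also have "\<dots> = (\<Sum>i\<in>I. if k \<in> I then J $ i $ a * G' $ i $ k else 0)"
          using a by (intro sum.cong) (auto simp: leaf_gram_def)
        finally show ?thesis by simp
      qed
      have inner': "(\<Sum>i\<in>UNIV. J $ i $ a * G' $ i $ k) = (\<Sum>i\<in>I. J $ i $ a * G' $ i $ k)" for k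
        using a assms(2) by (auto intro!: sum.mono_neutral_right)
      show ?thesis
      proof (cases "b \<in> I")
        case True
        have "(\<Sum>k\<in>UNIV. (if k \<in> I then \<Sum>i\<in>I. J $ i $ a * G' $ i $ k else 0) * ?L J $ k $ b)
            = (\<Sum>k\<in>UNIV. (\<Sum>i\<in>I. J $ i $ a * G' $ i $ k) * J $ k $ b)"
          using True assms(2) by (intro sum.cong) (auto simp: leaf_gram_def)
        then show ?thesis unfolding expand inner using True a
          by (simp add: leaf_gram_def assms(1) expand inner')
      next
        case False
        then show ?thesis unfolding expand inner using a
          by (auto simp: leaf_gram_def intro!: sum.neutral)
      qed
    next
      case a: False
      then have inner: "(\<Sum>i\<in>UNIV. ?L J $ i $ a * ?L G' $ i $ k) = (if k = a then 1 else 0)" for k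
      proof -
        have "(\<Sum>i\<in>UNIV. ?L J $ i $ a * ?L G' $ i $ k) = (\<Sum>i\<in>UNIV. if i = a then ?L G' $ a $ k else 0)"
          using a by (intro sum.cong) (auto simp: leaf_gram_def)
        also have "\<dots> = ?L G' $ a $ k" by (simp add: sum.delta)
        finally show ?thesis using a by (simp add: leaf_gram_def)
      qed
      have "(\<Sum>k\<in>UNIV. (if k = a then 1 else 0) * ?L J $ k $ b) = (\<Sum>k\<in>UNIV. if k = a then ?L J $ a $ b else 0)"
        by (intro sum.cong) auto
      also have "\<dots> = ?L J $ a $ b" by (simp add: sum.delta)
      finally show ?thesis unfolding expand inner using a by (simp add: leaf_gram_def)
    qed
  qed
  then show ?thesis by (simp add: vec_eq_iff)
qed

text \<open>On the segment from the identity to \<open>G\<close> the quadratic form stays positive,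
  so all these matrices are invertible, and the determinant keeps the sign that it has at the
  identity.\<close>

lemma det_pos_def:
  fixes G :: "real^'n::finite^'n"
  assumes "\<And>v. v \<noteq> 0 \<Longrightarrow> 0 < v \<bullet> (G *v v)"
  shows "0 < det G"
proof (rule ccontr)
  assume neg: "\<not> 0 < det G"
  define P where "P s = (1 - s) *\<^sub>R mat 1 + s *\<^sub>R G" for s :: real
  have nz: "det (P s) \<noteq> 0" if "0 \<le> s" "s \<le> 1" for s
  proof -
    have "v = 0" if "P s *v v = 0" for v
    proof (rule ccontr)
      assume v: "v \<noteq> 0"
      have "v \<bullet> (P s *v v) = (1 - s) * (v \<bullet> v) + s * (v \<bullet> (G *v v))"
        by (simp add: P_def matrix_vector_mult_add_rdistrib scaleR_matrix_vector_assoc[symmetric] inner_add_right)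
      moreover have "0 < v \<bullet> v" "0 < v \<bullet> (G *v v)" using v assms by auto
      ultimately have "0 < v \<bullet> (P s *v v)"
        using \<open>0 \<le> s\<close> \<open>s \<le> 1\<close> by (cases "s = 0") (auto intro!: add_nonneg_pos)
      then show False using that by simp
    qed
    then show ?thesis
      using matrix_left_invertible_ker[of "P s"] invertible_det_nz[of "P s"] by (auto simp: invertible_left_inverse)
  qed
  have "continuous_on {0..1} (\<lambda>s. det (P s))"
    unfolding det_def P_def by (intro continuous_intros)
  moreover have "det (P 0) = 1" "det (P 1) = det G" by (simp_all add: P_def)
  ultimately obtain s where "0 \<le> s" "s \<le> 1" "det (P s) = 0"
    using IVT2'[of "\<lambda>s. det (P s)" 1 0 0] neg by auto
  then show False using nz by blast
qed

lemma leaf_gram_mult_vec: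
  fixes G :: "real^'n::finite^'n"
  shows "(leaf_gram I G *v v) $ i = (if i \<in> I then (G *v glue I (($) v) (\<lambda>_. 0)) $ i else v $ i)"
proof (cases "i \<in> I")
  case True
  have "(\<Sum>j\<in>UNIV. leaf_gram I G $ i $ j * v $ j) = (\<Sum>j\<in>UNIV. G $ i $ j * glue I (($) v) (\<lambda>_. 0) $ j)"
    using True by (intro sum.cong) (auto simp: leaf_gram_def glue_nth)
  then show ?thesis using True by (simp add: matrix_vector_mult_def)
next
  case False
  have "(\<Sum>j\<in>UNIV. leaf_gram I G $ i $ j * v $ j) = (\<Sum>j\<in>UNIV. if j = i then v $ i else 0)"
    using False by (intro sum.cong) (auto simp: leaf_gram_def)
  then show ?thesis using False by (simp add: matrix_vector_mult_def)
qed

text \<open>With \<open>a\<close> the leaf part of \<open>v\<close> and \<open>b\<close> its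
  transverse part, the quadratic form splits as
  \<open>a \<bullet> (G *v a) + b \<bullet> b\<close>.\<close>

lemma leaf_gram_pos_def:
  fixes G :: "real^'n::finite^'n"
  assumes G: "\<And>v. v \<noteq> 0 \<Longrightarrow> 0 < v \<bullet> (G *v v)" and v: "v \<noteq> 0"
  shows "0 < v \<bullet> (leaf_gram I G *v v)"
proof -
  define a where "a = glue I (($) v) (\<lambda>_. 0)"
  define b where "b = glue I (\<lambda>_. 0) (($) v)"
  have a0: "a $ i = 0" if "i \<notin> I" for i using that by (simp add: a_def glue_nth)
  have av: "a $ i = v $ i" if "i \<in> I" for i using that by (simp add: a_def glue_nth)
  have "v \<bullet> (leaf_gram I G *v v) = (\<Sum>i\<in>UNIV. a $ i * (G *v a) $ i + b $ i * b $ i)"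
    unfolding inner_vec_def leaf_gram_mult_vec a_def[symmetric] by (intro sum.cong) (auto simp: a_def b_def glue_nth)
  also have "\<dots> = a \<bullet> (G *v a) + b \<bullet> b"
    by (simp add: inner_vec_def sum.distrib)
  finally have eq: "v \<bullet> (leaf_gram I G *v v) = a \<bullet> (G *v a) + b \<bullet> b" .
  show ?thesis
  proof (cases "a = 0")
    case True
    have "b \<noteq> 0"
    proof
      assume "b = 0"
      have "v $ i = 0" for i
      proof (cases "i \<in> I")
        case False
        have "b $ i = 0" using \<open>b = 0\<close> by simp
        then show ?thesis using False by (simp add: b_def glue_nth)
      qed (use True av in auto)
      with v show False by (simp add: vec_eq_iff)
    qed
    then show ?thesis using eq True by simp
  next
    case False
    then show ?thesis using eq G[OF False] inner_ge_zero[of b] by linarith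
  qed
qed


abbreviation leaf_density ::
    "('a, 'n::finite) metric \<Rightarrow> 'n set \<Rightarrow> ('a, 'n) chart \<Rightarrow> real^'n \<Rightarrow> real" where
  "leaf_density g I c y \<equiv> sqrt (det (leaf_gram I (g c (chart_inv c y))))"

lemma
  assumes g: "riemannian_metric A g" and c: "c \<in> maximal_atlas A"
  shows leaf_gram_metric_pos: "x \<in> chart_dom c \<Longrightarrow> 0 < det (leaf_gram I (g c x))"
    and leaf_gram_metric_C_on:
      "\<And>k i j. C_on k (chart_map c ` chart_dom c) (\<lambda>y. leaf_gram I (g c (chart_inv c y)) $ i $ j)"
    and leaf_density_C_on: "C_on k (chart_map c ` chart_dom c) (leaf_density g I c)"
proof -
  note ch = maximal_atlas_is_chart[OF c]
  show pos: "0 < det (leaf_gram I (g c x))" if "x \<in> chart_dom c" for x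
    using g c that unfolding riemannian_metric_def
    by (intro det_pos_def leaf_gram_pos_def) auto
  have gC: "C_on k (chart_map c ` chart_dom c) (g c \<circ> chart_inv c)" for k
    using g c unfolding riemannian_metric_def smooth_on_def by blast
  have bl: "bounded_linear (\<lambda>M. M $ i $ j :: real)" for i j
    using bounded_linear_compose[OF bounded_linear_vec_nth[of j] bounded_linear_vec_nth[of i]] .
  show C: "C_on k (chart_map c ` chart_dom c) (\<lambda>y. leaf_gram I (g c (chart_inv c y)) $ i $ j)" for k i j
    using C_on_bounded_linear[OF bl chart_target_open[OF ch] gC[of k], of i j]
    by (cases "i \<in> I \<and> j \<in> I"; cases "i = j") (auto simp: leaf_gram_def)
  show "C_on k (chart_map c ` chart_dom c) (leaf_density g I c)"
    by (intro C_on_sqrt C_on_det chart_target_open ch C pos chart_inv_in)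
qed

lemma leaf_density_measurable:
  fixes c :: "('a::topological_space, 'n::finite) chart"
  assumes "riemannian_metric A g" "c \<in> maximal_atlas A" "B \<in> sets borel" "B \<subseteq> chart_dom c"
  shows "(\<lambda>y. indicator (chart_map c ` B) y * leaf_density g I c y) \<in> borel_measurable borel"
proof -
  note ch = maximal_atlas_is_chart[OF assms(2)]
  have "continuous_on (chart_map c ` B) (leaf_density g I c)"
    using continuous_on_subset[OF C_on_imp_continuous[OF leaf_density_C_on[OF assms(1,2), of 0 I]]
      image_mono[OF assms(4)]] .
  from borel_measurable_continuous_on_indicator[OF chart_image_borel[OF ch assms(3,4)] this]
  show ?thesis by simp
qed

section \<open>Measures of single slices\<close>

abbreviation slice_density ::
    "('a, 'n::finite) metric \<Rightarrow> 'n set \<Rightarrow> ('a, 'n) chart \<Rightarrow> ('n \<Rightarrow> real) \<Rightarrow> 'a set \<Rightarrow> real^'n \<Rightarrow> real" where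
  "slice_density g I c t B y \<equiv> indicator (cube I) y *
     (indicator (chart_map c ` B) (on_slice I t y) * leaf_density g I c (on_slice I t y))"

text \<open>The contribution of the slice with transverse coordinates \<open>t\<close> to the
  measure of a leaf, written as an integral over the whole coordinate space; the cube gives the
  dummies total mass 1.\<close>

definition slice_measure ::
    "('a, 'n::finite) metric \<Rightarrow> 'n set \<Rightarrow> ('a, 'n) chart \<Rightarrow> ('n \<Rightarrow> real) \<Rightarrow> 'a set \<Rightarrow> ennreal" where
  "slice_measure g I c t B = (\<integral>\<^sup>+ y. ennreal (slice_density g I c t B y) \<partial>lborel)"

lemma slice_measure_integrand_measurable:
  fixes c :: "('a::topological_space, 'n::finite) chart"
  assumes "riemannian_metric A g" "c \<in> maximal_atlas A" "B \<in> sets borel" "B \<subseteq> chart_dom c"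
  shows "(\<lambda>y. slice_density g I c t B y) \<in> borel_measurable borel"
  by (rule borel_measurable_times[OF _ measurable_compose[OF glue_vec_measurable leaf_density_measurable[OF assms]]])
    auto

lemma slice_measure_eq:
  fixes c :: "('a::topological_space, 'n::finite) chart"
  assumes "riemannian_metric A g" "c \<in> maximal_atlas A" "B \<in> sets borel" "B \<subseteq> chart_dom c"
  shows "(\<integral>\<^sup>+ z. ennreal (sqrt (det (leaf_gram I (g c (chart_inv c (glue I z t))))))
                          * indicator (chart_map c ` B) (glue I z t)
                   \<partial>(\<Pi>\<^sub>M i\<in>I. lborel)) = slice_measure g I c t B"
proof -
  have *: "ennreal (leaf_density g I c y) * indicator (chart_map c ` B) y
      = ennreal (indicator (chart_map c ` B) y * leaf_density g I c y)" for y
    by (simp add: indicator_def)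
  have "(\<lambda>y. ennreal (indicator (chart_map c ` B) y * leaf_density g I c y)) \<in> borel_measurable borel"
    using leaf_density_measurable[OF assms] by measurable
  from nn_integral_slice[OF this, of I t] show ?thesis
    unfolding * slice_measure_def by (auto simp: indicator_def intro!: nn_integral_cong)
qed

lemma slice_measure_additive:
  fixes c :: "('a::topological_space, 'n::finite) chart"
  assumes "riemannian_metric A g" "c \<in> maximal_atlas A"
    and B: "range (B :: nat \<Rightarrow> 'a set) \<subseteq> sets borel" "disjoint_family B" "(\<Union>i. B i) \<subseteq> chart_dom c"
  shows "(\<Sum>i. slice_measure g I c t (B i)) = slice_measure g I c t (\<Union>i::nat. B i)"
proof -
  note ch = maximal_atlas_is_chart[OF assms(2)]
  let ?f = "\<lambda>B y. ennreal (slice_density g I c t B y)"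
  have eq: "?f B y = ennreal (indicator (cube I) y * leaf_density g I c (on_slice I t y)) *
      indicator (chart_map c ` B) (on_slice I t y)" for B y
    by (simp add: indicator_def)
  have disj: "disjoint_family (\<lambda>i. chart_map c ` B i)"
    using B(2,3) chart_inj[OF ch] unfolding disjoint_family_on_def inj_on_def by blast
  have "(\<Sum>i. slice_measure g I c t (B i)) = (\<integral>\<^sup>+ y. (\<Sum>i. ?f (B i) y) \<partial>lborel)"
    unfolding slice_measure_def
  proof (rule nn_integral_suminf[symmetric])
    fix i
    have "(\<lambda>y. slice_density g I c t (B i) y) \<in> borel_measurable borel"
      by (rule slice_measure_integrand_measurable) (use assms in auto)
    then show "?f (B i) \<in> borel_measurable lborel" by measurable
  qed
  also have "\<dots> = slice_measure g I c t (\<Union>i. B i)"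
    unfolding slice_measure_def eq by (simp add: suminf_indicator[OF disj] image_UN)
  finally show ?thesis .
qed

section \<open>Transition maps between slices\<close>

text \<open>\<open>t\<close> and \<open>t'\<close> label the same, possibly empty, slice of
  \<open>W\<close> in the two charts. Fixing the labels turns a change of foliated charts into a map
  between open sets of the coordinate space. For \<open>I = UNIV\<close> the condition on the labels
  is vacuous, and the locale describes an ordinary change of charts.\<close>

locale slice_transition =
  fixes A :: "('a::topological_space, 'n::{finite,wellorder}) chart set"
    and g :: "('a, 'n) metric" and I :: "'n set" and c c' :: "('a, 'n) chart"
    and W :: "'a set" and t t' :: "'n \<Rightarrow> real"
  assumes A: "smooth_atlas A" and g: "riemannian_metric A g"
    and c: "c \<in> maximal_atlas A" and c': "c' \<in> maximal_atlas A"
    and W: "open W" "W \<subseteq> chart_dom c" "W \<subseteq> chart_dom c'"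
    and transverse: "\<And>x. x \<in> W \<Longrightarrow>
      (\<forall>j\<in>-I. chart_map c x $ j = t j) \<longleftrightarrow> (\<forall>j\<in>-I. chart_map c' x $ j = t' j)"
begin

definition S where "S = {y. on_slice I t y \<in> chart_map c ` W}"
definition S' where "S' = {y. on_slice I t' y \<in> chart_map c' ` W}"
definition J where "J y = jacobian (transition c c') (at (on_slice I t y))"

text \<open>The leaf coordinates are changed as prescribed by the transition map; the transverse ones, which
  are dummies, are kept.\<close>

definition T where "T y = glue I (($) (transition c c' (on_slice I t y))) (($) y)"

lemmas ch = maximal_atlas_is_chart[OF c] and ch' = maximal_atlas_is_chart[OF c']

lemma mem_S:
  assumes "on_slice I t y \<in> chart_map c ` B" "B \<subseteq> W"
  obtains x where "x \<in> B" "on_slice I t y = chart_map c x" "on_slice I t' (T y) = chart_map c' x"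
proof -
  obtain x where x: "x \<in> B" "on_slice I t y = chart_map c x" using assms by auto
  then have xW: "x \<in> W" using assms by auto
  have "chart_map c x $ j = t j" if "j \<in> -I" for j
    using that x(2)[symmetric] by (simp add: glue_nth)
  then have "\<forall>j\<in>-I. chart_map c' x $ j = t' j"
    using transverse[OF xW] by blast
  moreover have "transition c c' (on_slice I t y) = chart_map c' x"
    using x xW W by (auto simp: transition_map[OF ch])
  ultimately have "on_slice I t' (T y) = chart_map c' x"
    unfolding T_def by (auto simp: vec_eq_iff glue_nth)
  with x show ?thesis using that by blast
qed

text \<open>Since \<open>T\<close> keeps the dummies, it respects the cube, so thickened slices in
  the two charts correspond to each other.\<close>

lemma T_image:
  assumes "B \<subseteq> W"
  shows "T ` {y \<in> cube I. on_slice I t y \<in> chart_map c ` B} = {y \<in> cube I. on_slice I t' y \<in> chart_map c' ` B}"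
    and "T ` {y. on_slice I t y \<in> chart_map c ` B} = {y. on_slice I t' y \<in> chart_map c' ` B}"
proof -
  have cube: "T y \<in> cube I \<longleftrightarrow> y \<in> cube I" for y
    by (auto simp: cube_def T_def glue_nth)
  have 1: "on_slice I t' (T y) \<in> chart_map c' ` B" if "on_slice I t y \<in> chart_map c ` B" for y
    using mem_S[OF that assms] by auto
  have 2: "\<exists>y. on_slice I t y \<in> chart_map c ` B \<and> T y = y'" if y': "on_slice I t' y' \<in> chart_map c' ` B" for y'
  proof -
    obtain x where x: "x \<in> B" "on_slice I t' y' = chart_map c' x" using y' by auto
    then have xW: "x \<in> W" using assms by auto
    have "chart_map c' x $ j = t' j" if "j \<in> -I" for j
      using that x(2)[symmetric] by (simp add: glue_nth)
    then have tc: "\<forall>j\<in>-I. chart_map c x $ j = t j"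
      using transverse[OF xW] by blast
    \<comment> \<open>The preimage takes its leaf coordinates from the first chart and its dummies
      from \<open>y'\<close>.\<close>
    define y where "y = glue I (($) (chart_map c x)) (($) y')"
    have y: "on_slice I t y = chart_map c x"
      using tc by (auto simp: y_def vec_eq_iff glue_nth)
    have "transition c c' (on_slice I t y) = chart_map c' x"
      using xW W by (auto simp: y transition_map[OF ch])
    then have "T y = y'"
      using x(2) by (auto simp: T_def y_def vec_eq_iff glue_nth split: if_splits)
    then show ?thesis using x(1) y by auto
  qed
  show "T ` {y. on_slice I t y \<in> chart_map c ` B} = {y. on_slice I t' y \<in> chart_map c' ` B}"
    using 1 2 by blast
  show "T ` {y \<in> cube I. on_slice I t y \<in> chart_map c ` B} = {y \<in> cube I. on_slice I t' y \<in> chart_map c' ` B}"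
    using 1 2 cube by blast
qed

lemma T_S: "T ` S = S'"
  unfolding S_def S'_def by (rule T_image(2)) simp

text \<open>The image determines the point of \<open>W\<close> and with it the leaf coordinates; the
  dummies are entries of the image itself.\<close>

lemma inj_on_T: "inj_on T S"
proof (rule inj_onI)
  fix y1 y2 assume y: "y1 \<in> S" "y2 \<in> S" "T y1 = T y2"
  obtain x1 where x1: "x1 \<in> W" "on_slice I t y1 = chart_map c x1" "on_slice I t' (T y1) = chart_map c' x1"
    using mem_S[of y1 W] y(1) unfolding S_def by blast
  obtain x2 where x2: "x2 \<in> W" "on_slice I t y2 = chart_map c x2" "on_slice I t' (T y2) = chart_map c' x2"
    using mem_S[of y2 W] y(2) unfolding S_def by blast
  have "x1 = x2" using y(3) x1 x2 W chart_inj[OF ch'] by (metis inj_onD subsetD)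
  then have "on_slice I t y1 $ i = on_slice I t y2 $ i" for i using x1 x2 by simp
  moreover have "T y1 $ i = T y2 $ i" for i using y(3) by simp
  ultimately have "y1 $ i = y2 $ i" for i
    by (cases "i \<in> I") (metis glue_nth T_def)+
  then show "y1 = y2" by (simp add: vec_eq_iff)
qed

lemma S_open: "open S" "open S'"
proof -
  have "open (on_slice I s -` V)" if "open V" for s and V :: "(real^'n::_) set"
    using that continuous_on_glue[of UNIV I s] by (simp add: continuous_on_open_vimage)
  then show "open S" "open S'"
    using chart_image_open[OF ch W(1,2)] chart_image_open[OF ch' W(1,3)]
    unfolding S_def S'_def vimage_def by auto
qed

lemma transition_C_on_image: "C_on k (chart_map c ` W) (transition c c')"
  using transition_C_on[OF A c c'] by (rule C_on_subset) (use W in auto)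

lemma T_C_on: "C_on k S T"
proof (rule C_on_vec)
  fix i
  show "C_on k S (\<lambda>y. T y $ i)"
  proof (cases "i \<in> I")
    case True
    have "C_on k S (\<lambda>y. transition c c' (on_slice I t y))"
      by (rule C_on_compose[where \<tau> = "on_slice I t" and u = "transition c c'",
            OF S_open(1) chart_image_open[OF ch W(1,2)] transition_C_on_image on_slice_C_on])
        (auto simp: S_def)
    then show ?thesis using True by (simp add: T_def glue_nth C_on_nth S_open)
  next
    case False
    then show ?thesis by (simp add: T_def glue_nth C_on_nth S_open)
  qed
qed (rule S_open)

section \<open>Derivative of a slice transition and the transformation of densities\<close>

lemma transition_differentiable:
  assumes "y \<in> S" shows "transition c c' differentiable (at (on_slice I t y))"
  using transition_C_on_image[of 1] assms by (auto simp: S_def)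

lemma jacobian_nth: "jacobian f (at y) $ i $ j = partial j f y $ i"
  by (simp add: jacobian_def matrix_def partial_def)

lemma differentiable_nth:
  assumes "u differentiable (at y)" shows "(\<lambda>y. u y $ i) differentiable (at y)"
  using bounded_linear.has_derivative[OF bounded_linear_vec_nth frechet_derivative_works[THEN iffD1, OF assms]]
  by (auto simp: differentiable_def)

lemma partial_nth:
  assumes "u differentiable (at y)" shows "partial j (\<lambda>y. u y $ i) y = partial j u y $ i"
  using bounded_linear.has_derivative[OF bounded_linear_vec_nth frechet_derivative_works[THEN iffD1, OF assms]]
  by (auto simp: partial_def intro: partial_eqI[unfolded partial_def])

text \<open>Along a slice the transverse components of the transition are the constants
  \<open>t' i\<close>, so their derivatives in leaf directions vanish.\<close>

lemma jacobian_block: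
  assumes y: "y \<in> S" and "i \<notin> I" "j \<in> I"
  shows "J y $ i $ j = 0"
proof -
  have nth: "(\<lambda>p. transition c c' p $ i) differentiable (at (on_slice I t y))"
    by (rule differentiable_nth[OF transition_differentiable[OF y]])
  have const: "transition c c' (on_slice I t z) $ i = t' i" if "z \<in> S" for z
  proof -
    obtain x where x: "x \<in> W" "on_slice I t z = chart_map c x" "on_slice I t' (T z) = chart_map c' x"
      using mem_S[of z W] \<open>z \<in> S\<close> unfolding S_def by blast
    then have "transition c c' (on_slice I t z) = on_slice I t' (T z)"
      using W by (auto simp: transition_map[OF ch])
    then show ?thesis using assms(2) by (simp add: glue_nth)
  qed
  have "partial j (\<lambda>z. transition c c' (on_slice I t z) $ i) y = partial j (\<lambda>_. t' i) y"
    by (rule partial_cong[OF S_open(1) y const])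
  also have "\<dots> = 0" by (rule partial_eqI) (rule has_derivative_const)
  finally show ?thesis
    using partial_on_slice[OF nth, of j] assms(3) partial_nth[OF transition_differentiable[OF y]]
    by (simp add: J_def jacobian_nth)
qed

text \<open>\<open>leaf_gram\<close> is applied to a Jacobian here: its leaf block is that of the
  transition map, and the identity block records that \<open>T\<close> fixes the dummies.\<close>

lemma has_derivative_T:
  assumes y: "y \<in> S"
  shows "(T has_derivative (*v) (leaf_gram I (J y))) (at y)"
proof -
  have d: "T differentiable (at y)" using T_C_on[of 1] y by auto
  have "partial j T y $ i = leaf_gram I (J y) $ i $ j" for i j
  proof -
    have "partial j T y $ i = partial j (\<lambda>y. T y $ i) y" using partial_nth[OF d] by simp
    also have "\<dots> = leaf_gram I (J y) $ i $ j"
    proof (cases "i \<in> I")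
      case True
      have nth: "(\<lambda>p. transition c c' p $ i) differentiable (at (on_slice I t y))"
        by (rule differentiable_nth[OF transition_differentiable[OF y]])
      have "partial j (\<lambda>y. T y $ i) y = partial j (\<lambda>y. transition c c' (on_slice I t y) $ i) y"
        using True by (simp add: T_def glue_nth)
      then show ?thesis
        using partial_on_slice[OF nth, of j] True partial_nth[OF transition_differentiable[OF y]]
        by (auto simp: J_def jacobian_nth leaf_gram_def)
    next
      case False
      have "partial j (\<lambda>y. T y $ i) y = partial j (\<lambda>y. y $ i) y"
        using False by (simp add: T_def glue_nth)
      also have "\<dots> = axis j 1 $ i"
        by (rule partial_eqI[OF bounded_linear_imp_has_derivative[OF bounded_linear_vec_nth]])
      finally show ?thesis using False by (auto simp: leaf_gram_def axis_def)
    qed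
    finally show ?thesis .
  qed
  then have "jacobian T (at y) = leaf_gram I (J y)"
    by (simp add: vec_eq_iff jacobian_nth)
  then show ?thesis using d jacobian_works by metis
qed

lemma gram_law:
  assumes y: "y \<in> S"
  shows "leaf_gram I (g c (chart_inv c (on_slice I t y))) =
    transpose (leaf_gram I (J y)) ** leaf_gram I (g c' (chart_inv c' (on_slice I t' (T y)))) ** leaf_gram I (J y)"
proof (rule leaf_gram_congruence)
  obtain x where x: "x \<in> W" "on_slice I t y = chart_map c x" "on_slice I t' (T y) = chart_map c' x"
    using mem_S[of y W] y unfolding S_def by blast
  then have xd: "x \<in> chart_dom c \<inter> chart_dom c'" using W by auto
  then have "g c x = transpose (jacobian (transition c c') (at (chart_map c x))) ** g c' x
      ** jacobian (transition c c') (at (chart_map c x))"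
    using g c c' unfolding riemannian_metric_def Let_def by blast
  then show "g c (chart_inv c (on_slice I t y)) =
    transpose (J y) ** g c' (chart_inv c' (on_slice I t' (T y))) ** J y"
    using x xd by (simp add: J_def chart_inv_map ch ch')
qed (use jacobian_block[OF y] in auto)

lemma on_slice_S_target:
  assumes "y \<in> S"
  shows "on_slice I t y \<in> chart_map c ` chart_dom c" "on_slice I t' (T y) \<in> chart_map c' ` chart_dom c'"
    "chart_inv c' (on_slice I t' (T y)) = chart_inv c (on_slice I t y)"
  using mem_S[of y W] assms W unfolding S_def
  by (metis (no_types, lifting) chart_inv_map[OF ch] chart_inv_map[OF ch'] image_eqI mem_Collect_eq order_refl subsetD)+

text \<open>Taking determinants in \<open>gram_law\<close> gives the square of the Jacobian
  determinant, and the root turns it into an absolute value.\<close>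

lemma density_law:
  assumes y: "y \<in> S"
  shows "leaf_density g I c (on_slice I t y) =
    \<bar>det (leaf_gram I (J y))\<bar> * leaf_density g I c' (on_slice I t' (T y))"
  unfolding gram_law[OF y] by (simp add: det_mul real_sqrt_mult mult.commute mult.left_commute)

text \<open>The Gram determinant on the left of \<open>gram_law\<close> is positive and has the
  Jacobian determinant as a factor.\<close>

lemma det_J:
  assumes y: "y \<in> S" shows "det (leaf_gram I (J y)) \<noteq> 0"
proof -
  have "0 < det (leaf_gram I (g c (chart_inv c (on_slice I t y))))"
    by (intro leaf_gram_metric_pos[OF g c] chart_inv_in ch on_slice_S_target y)
  then show ?thesis unfolding gram_law[OF y] by (auto simp: det_mul)
qed

text \<open>Change of variables along \<open>T\<close>: by \<open>density_law\<close>, the Jacobian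
  determinant is exactly the factor by which the densities differ.\<close>

lemma slice_measure_transition:
  assumes B: "B \<in> sets borel" "B \<subseteq> W"
  shows "slice_measure g I c t B = slice_measure g I c' t' B"
proof -
  let ?D = "{y \<in> cube I. on_slice I t y \<in> chart_map c ` B}"
  let ?w = "\<lambda>y. leaf_density g I c' (on_slice I t' y)"
  let ?d = "\<lambda>y. \<bar>det (matrix ((*v) (leaf_gram I (J y))))\<bar> * ?w (T y)"
  have D_S: "?D \<subseteq> S" using B by (auto simp: S_def)
  have meas: "{y \<in> cube I. on_slice I s y \<in> V} \<in> sets borel" if "V \<in> sets borel" for s V
  proof -
    have "{y \<in> cube I. on_slice I s y \<in> V} = cube I \<inter> (on_slice I s -` V \<inter> space borel)" by auto
    then show ?thesis using measurable_sets[OF glue_vec_measurable that] by simp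
  qed
  have [simp]: "T ` ?D = {y \<in> cube I. on_slice I t' y \<in> chart_map c' ` B}"
    by (rule T_image(1)) fact
  have iw: "indicator (T ` ?D) y * ?w y =
      indicator (cube I) y * (indicator (chart_map c' ` B) (on_slice I t' y) * ?w y)" for y
    by (simp add: indicator_def)
  have id: "indicator ?D y * ?d y = slice_density g I c t B y" for y
    using density_law[of y] D_S by (auto simp: indicator_def)
  have W': "(\<lambda>y. indicator (T ` ?D) y * ?w y) \<in> borel_measurable borel"
    unfolding iw by (rule slice_measure_integrand_measurable[OF g c']) (use B W in auto)
  have V': "(\<lambda>y. indicator ?D y * ?d y) \<in> borel_measurable borel"
    unfolding id by (rule slice_measure_integrand_measurable[OF g c]) (use B W in auto)
  have "(\<integral>\<^sup>+y. ennreal (indicator (T ` ?D) y * ?w y) \<partial>lborel) = (\<integral>\<^sup>+y. ennreal (indicator ?D y * ?d y) \<partial>lborel)"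
  proof (rule nn_integral_lborel_change_of_variables[OF _ _ _ W' V'])
    show "?D \<in> sets borel" by (rule meas, rule chart_image_borel[OF ch]) (use B W in auto)
    show "(T has_derivative (*v) (leaf_gram I (J y))) (at y within ?D)" if "y \<in> ?D" for y
      using has_derivative_T that D_S by (blast intro: has_derivative_at_withinI)
    show "inj_on T ?D" using inj_on_T D_S by (rule inj_on_subset)
    show "0 \<le> ?w y" if y: "y \<in> T ` ?D" for y
    proof -
      obtain z where "z \<in> ?D" "y = T z" using y by blast
      then have "z \<in> S" using D_S by auto
      then have "0 < det (leaf_gram I (g c' (chart_inv c' (on_slice I t' y))))"
        unfolding \<open>y = T z\<close> by (intro leaf_gram_metric_pos[OF g c'] chart_inv_in ch' on_slice_S_target)
      then show ?thesis by simp
    qed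
  qed
  then show ?thesis unfolding iw id slice_measure_def by simp
qed

end


section \<open>The Riemannian measure\<close>

lemma finite_chart_cover:
  fixes C :: "('a::topological_space, 'n::finite) chart set"
  assumes "compact (UNIV :: 'a set)" "\<And>c. c \<in> C \<Longrightarrow> is_chart c" "(\<Union>c\<in>C. chart_dom c) = UNIV"
  obtains F where "finite F" "F \<subseteq> C" "(\<Union>c\<in>F. chart_dom c) = UNIV"
proof -
  obtain F where "F \<subseteq> C" "finite F" "(UNIV :: 'a set) \<subseteq> (\<Union>c\<in>F. chart_dom c)"
  proof (rule compactE_image[OF assms(1), of C chart_dom])
    show "open (chart_dom c)" if "c \<in> C" for c by (rule chart_dom_open[OF assms(2)[OF that]])
    show "UNIV \<subseteq> (\<Union>c\<in>C. chart_dom c)" using assms(3) by simp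
  qed (rule that)
  then show ?thesis by (intro that) auto
qed

lemma riemannian_volume_completion:
  fixes A :: "('a::topological_space, 'n::{finite,wellorder}) chart set"
  assumes K: "compact (UNIV :: 'a set)" and A: "smooth_atlas A" and g: "riemannian_metric A g"
  obtains \<mu> where "riemannian_volume A g = completion \<mu>" "sets \<mu> = sets borel"
proof -
  let ?\<nu> = "\<lambda>c B. \<integral>\<^sup>+ y \<in> chart_map c ` B. ennreal (sqrt (det (g c (chart_inv c y)))) \<partial>lborel"
  let ?m = "\<lambda>c. slice_measure g UNIV c (\<lambda>_. 0)"
  have \<nu>: "?\<nu> c B = ?m c B" for c B
    unfolding slice_measure_def by (rule nn_integral_cong) (simp add: indicator_def)
  have cover: "(\<Union>c\<in>maximal_atlas A. chart_dom c) = UNIV"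
    using A atlas_subset_maximal[OF A] unfolding smooth_atlas_def by blast
  obtain F where F: "finite F" "F \<subseteq> maximal_atlas A" "(\<Union>c\<in>F. chart_dom c) = UNIV"
    by (rule finite_chart_cover[OF K maximal_atlas_is_chart cover])
  have "\<exists>!\<mu>. sets \<mu> = sets borel \<and> (\<forall>c\<in>maximal_atlas A. \<forall>B\<in>sets borel. B \<subseteq> chart_dom c \<longrightarrow> emeasure \<mu> B = ?\<nu> c B)"
    unfolding \<nu>
  proof (rule measure_gluing[OF F(1,2)])
    show "space borel \<subseteq> (\<Union>c\<in>F. chart_dom c)" using F(3) by simp
    show "chart_dom c \<inter> space borel \<in> sets borel" if "c \<in> maximal_atlas A" for c
      using chart_dom_open[OF maximal_atlas_is_chart[OF that]] by simp
    show "?m c {} = 0" for c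
      by (simp add: slice_measure_def)
    show "(\<Sum>i. ?m c (B i)) = ?m c (\<Union>i::nat. B i)"
      if "c \<in> maximal_atlas A" "range B \<subseteq> sets borel" "disjoint_family B" "(\<Union>i. B i) \<subseteq> chart_dom c" for c B
      by (rule slice_measure_additive[OF g that])
    fix c c' and B :: "'a set"
    assume *: "c \<in> maximal_atlas A" "c' \<in> maximal_atlas A" "B \<in> sets borel" "B \<subseteq> chart_dom c" "B \<subseteq> chart_dom c'"
    have "open (chart_dom c \<inter> chart_dom c')"
      by (intro open_Int chart_dom_open maximal_atlas_is_chart[OF *(1)] maximal_atlas_is_chart[OF *(2)])
    \<comment> \<open>Without transverse coordinates the whole overlap can serve as
      \<open>W\<close>, and the constant labels are as good as any.\<close>
    then interpret slice_transition A g UNIV c c' "chart_dom c \<inter> chart_dom c'" "\<lambda>_. 0" "\<lambda>_. 0"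
      by unfold_locales (use A g * in auto)
    show "?m c B = ?m c' B"
      by (rule slice_measure_transition) (use * in auto)
  qed
  from theI'[OF this] show ?thesis
    using that unfolding riemannian_volume_def by blast
qed

section \<open>Measures on leaves\<close>

text \<open>The value that \<open>leaf_volume\<close> prescribes inside a chart, with the inner
  integral in its thickened form.\<close>

definition leaf_measure ::
    "('a, 'n::finite) metric \<Rightarrow> 'n set \<Rightarrow> ('a, 'n) chart \<Rightarrow> 'a set \<Rightarrow> ennreal" where
  "leaf_measure g I c B = (\<integral>\<^sup>+ t. slice_measure g I c t B \<partial>count_space (\<Pi>\<^sub>E i\<in>-I. UNIV))"

definition preserves_slices :: "'n::finite set \<Rightarrow> ('a, 'n) chart \<Rightarrow> ('a, 'n) chart \<Rightarrow> 'a set \<Rightarrow> bool" where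
  "preserves_slices I c c' W \<longleftrightarrow> (\<forall>y\<in>W. \<forall>z\<in>W. (\<forall>j\<in>-I. chart_map c y $ j = chart_map c z $ j) \<longrightarrow>
     (\<forall>j\<in>-I. chart_map c' y $ j = chart_map c' z $ j))"

lemma preserves_slices_iff:
  assumes "preserves_slices I c c' W" "preserves_slices I c' c W" "y \<in> W" "z \<in> W"
  shows "(\<forall>j\<in>-I. chart_map c y $ j = chart_map c z $ j) \<longleftrightarrow> (\<forall>j\<in>-I. chart_map c' y $ j = chart_map c' z $ j)"
  using assms(1,2)[unfolded preserves_slices_def, THEN bspec, OF assms(3), THEN bspec, OF assms(4)] by blast

text \<open>The sort \<open>wellorder\<close> is inherited from the change of variables formula. The
  Hausdorff property makes compact sets closed, which allows functions with compact support in a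
  chart to be extended by zero.\<close>

locale foliated_manifold =
  fixes A :: "('a::t2_space, 'n::{finite,wellorder}) chart set"
    and g :: "('a, 'n) metric" and I :: "'n set" and \<Phi> :: "('a, 'n) chart set"
  assumes compact_UNIV: "compact (UNIV :: 'a set)"
    and A: "smooth_atlas A" and g: "riemannian_metric A g" and \<Phi>: "foliated_atlas A I \<Phi>"
begin

lemma \<Phi>_maximal: "c \<in> \<Phi> \<Longrightarrow> c \<in> maximal_atlas A"
  using \<Phi> unfolding foliated_atlas_def by auto

lemmas \<Phi>_is_chart = maximal_atlas_is_chart[OF \<Phi>_maximal]

lemma \<Phi>_cover: "(\<Union>c\<in>\<Phi>. chart_dom c) = UNIV"
  using \<Phi> unfolding foliated_atlas_def by auto

text \<open>Slice preservation passes to smaller sets, so the neighbourhoods for the two directions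
  can be intersected.\<close>

lemma foliated_neighbourhood:
  assumes "c \<in> \<Phi>" "c' \<in> \<Phi>" "x \<in> chart_dom c" "x \<in> chart_dom c'"
  obtains W where "open W" "x \<in> W" "W \<subseteq> chart_dom c" "W \<subseteq> chart_dom c'"
    "preserves_slices I c c' W" "preserves_slices I c' c W"
proof -
  have *: "\<exists>W. open W \<and> x \<in> W \<and> W \<subseteq> chart_dom c \<inter> chart_dom c' \<and> preserves_slices I c c' W"
    if "c \<in> \<Phi>" "c' \<in> \<Phi>" "x \<in> chart_dom c \<inter> chart_dom c'" for c c'
    using \<Phi> that unfolding foliated_atlas_def preserves_slices_def by blast
  obtain W1 where W1: "open W1" "x \<in> W1" "W1 \<subseteq> chart_dom c \<inter> chart_dom c'" "preserves_slices I c c' W1"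
    using *[of c c'] assms by auto
  obtain W2 where W2: "open W2" "x \<in> W2" "preserves_slices I c' c W2"
    using *[of c' c] assms by auto
  show ?thesis
  proof (rule that[of "W1 \<inter> W2"])
    show "open (W1 \<inter> W2)" using W1(1) W2(1) by (rule open_Int)
    show "preserves_slices I c c' (W1 \<inter> W2)" "preserves_slices I c' c (W1 \<inter> W2)"
      using W1(4) W2(3) unfolding preserves_slices_def by blast+
  qed (use W1(2,3) W2(2) in auto)
qed

text \<open>On \<open>W\<close> the charts have the same slices under different labels. The
  relabelling \<open>\<theta>\<close> is a bijection between the labels that occur, and the sum over
  slices is reindexed along it.\<close>

lemma leaf_measure_local:
  assumes c: "c \<in> \<Phi>" "c' \<in> \<Phi>" and W: "open W" "W \<subseteq> chart_dom c" "W \<subseteq> chart_dom c'"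
    and ps: "preserves_slices I c c' W" "preserves_slices I c' c W"
    and B: "B \<in> sets borel" "B \<subseteq> W"
  shows "leaf_measure g I c B = leaf_measure g I c' B"
proof -
  note tr = preserves_slices_iff[OF ps]
  \<comment> \<open>Restriction to \<open>-I\<close> makes the label an element of the extensional
    product over which the leaf measure sums.\<close>
  define R where "R c x = restrict (($) (chart_map c x)) (-I)" for c :: "('a, 'n) chart" and x
  have R_eq: "R c x = R c y \<longleftrightarrow> (\<forall>j\<in>-I. chart_map c x $ j = chart_map c y $ j)" for c x y
    by (auto simp: R_def fun_eq_iff restrict_def)
  have zero: "slice_measure g I d t B = 0" if "t \<in> (\<Pi>\<^sub>E i\<in>-I. UNIV)" "t \<notin> R d ` W" for d t
  proof -
    have "on_slice I t y \<notin> chart_map d ` B" for y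
    proof
      assume "on_slice I t y \<in> chart_map d ` B"
      then obtain x where x: "x \<in> B" "on_slice I t y = chart_map d x" by auto
      have "R d x = t"
        using that(1) unfolding R_def x(2)[symmetric]
        by (auto simp: fun_eq_iff glue_nth PiE_def extensional_def)
      with that(2) x(1) B(2) show False by auto
    qed
    then show ?thesis by (simp add: slice_measure_def)
  qed
  have sum_R: "leaf_measure g I d B = (\<integral>\<^sup>+ t. slice_measure g I d t B \<partial>count_space (R d ` W))" for d
    unfolding leaf_measure_def
    by (rule nn_integral_count_space_eq) (use zero in \<open>auto simp: R_def\<close>)
  define \<theta> where "\<theta> t = R c' (inv_into W (R c) t)" for t
  have \<theta>: "\<theta> (R c x) = R c' x" if "x \<in> W" for x
  proof -
    have "R c (inv_into W (R c) (R c x)) = R c x" "inv_into W (R c) (R c x) \<in> W"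
      using that by (auto intro: f_inv_into_f inv_into_into)
    then show ?thesis unfolding \<theta>_def R_eq using tr[OF _ that] by blast
  qed
  have bij: "bij_betw \<theta> (R c ` W) (R c' ` W)"
    unfolding bij_betw_def
  proof
    show "inj_on \<theta> (R c ` W)"
    proof (rule inj_onI)
      fix s t assume "s \<in> R c ` W" "t \<in> R c ` W" "\<theta> s = \<theta> t"
      then obtain x y where "x \<in> W" "y \<in> W" "s = R c x" "t = R c y" "R c' x = R c' y"
        using \<theta> by auto
      then show "s = t" using tr[of x y] unfolding R_eq[symmetric] by simp
    qed
    show "\<theta> ` R c ` W = R c' ` W" using \<theta> by (auto simp: image_image)
  qed
  have "slice_measure g I c t B = slice_measure g I c' (\<theta> t) B" if t: "t \<in> R c ` W" for t
  proof -
    obtain x where x: "x \<in> W" "t = R c x" using t by blast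
    interpret slice_transition A g I c c' W "R c x" "R c' x"
    proof
      show "(\<forall>j\<in>-I. chart_map c y $ j = R c x j) \<longleftrightarrow> (\<forall>j\<in>-I. chart_map c' y $ j = R c' x j)" if "y \<in> W" for y
        using tr[OF that x(1)] by (simp add: R_def)
    qed (use A g c \<Phi>_maximal W in auto)
    show ?thesis using slice_measure_transition[OF B] x \<theta> by simp
  qed
  then have "leaf_measure g I c B = (\<integral>\<^sup>+ t. slice_measure g I c' (\<theta> t) B \<partial>count_space (R c ` W))"
    unfolding sum_R by (intro nn_integral_cong) simp
  also have "\<dots> = leaf_measure g I c' B"
    unfolding sum_R by (rule nn_integral_bij_count_space[OF bij])
  finally show ?thesis .
qed

lemma leaf_measure_additive:
  assumes "c \<in> \<Phi>" "range B \<subseteq> sets borel" "disjoint_family B" "(\<Union>i. B i) \<subseteq> chart_dom c"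
  shows "(\<Sum>i. leaf_measure g I c (B i)) = leaf_measure g I c (\<Union>i::nat. B i)"
  unfolding leaf_measure_def
  using slice_measure_additive[OF g \<Phi>_maximal[OF assms(1)] assms(2-4)]
  by (simp add: nn_integral_suminf[symmetric])

text \<open>On the whole overlap of two foliated charts the slices need not agree: a slice of one
  may meet several slices of the other. By Lindelof's theorem countably many neighbourhoods with
  agreeing slices suffice, and countable additivity joins the pieces.\<close>

lemma leaf_measure_consistent:
  assumes c: "c \<in> \<Phi>" "c' \<in> \<Phi>" and B: "B \<in> sets borel" "B \<subseteq> chart_dom c" "B \<subseteq> chart_dom c'"
  shows "leaf_measure g I c B = leaf_measure g I c' B"
proof (cases "B = {}")
  case True
  then show ?thesis by (simp add: leaf_measure_def slice_measure_def)
next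
  case False
  define adapted where "adapted W \<longleftrightarrow> open W \<and> W \<subseteq> chart_dom c \<and> W \<subseteq> chart_dom c' \<and>
     preserves_slices I c c' W \<and> preserves_slices I c' c W" for W
  have ad: "\<exists>W. adapted W \<and> x \<in> W" if "x \<in> chart_dom c" "x \<in> chart_dom c'" for x
    by (rule foliated_neighbourhood[OF c that]) (auto simp: adapted_def)
  note ch = \<Phi>_is_chart[OF c(1)]
  \<comment> \<open>The cover is moved to the coordinate space, where families of open sets have
    countable subfamilies with the same union.\<close>
  let ?F = "(`) (chart_map c) ` Collect adapted"
  have op: "open S" if "S \<in> ?F" for S
    using that chart_image_open[OF ch] unfolding adapted_def by auto
  obtain F' where F': "F' \<subseteq> ?F" "countable F'" "\<Union>F' = \<Union>?F"
    by (rule Lindelof[OF op])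
  obtain \<W> where \<W>: "\<W> \<subseteq> Collect adapted" "countable \<W>" "F' = (`) (chart_map c) ` \<W>"
    using iffD1[OF countable_subset_image conjI[OF F'(2,1)]] by (elim exE conjE)
  have cover: "B \<subseteq> \<Union>\<W>"
  proof
    fix x assume x: "x \<in> B"
    then obtain W where W: "adapted W" "x \<in> W" using ad B by blast
    then have "chart_map c x \<in> \<Union>F'" unfolding F'(3) by auto
    then obtain V where V: "V \<in> \<W>" "chart_map c x \<in> chart_map c ` V" using \<W>(3) by auto
    then have "V \<subseteq> chart_dom c" using \<W>(1) unfolding adapted_def by blast
    then have "x \<in> V" using V chart_image_mem_iff[OF ch] x B by blast
    then show "x \<in> \<Union>\<W>" using V by auto
  qed
  then have "\<W> \<noteq> {}" using False by auto
  define W where "W = from_nat_into \<W>"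
  have W: "adapted (W n)" for n
    using from_nat_into[OF \<open>\<W> \<noteq> {}\<close>] \<W>(1) by (auto simp: W_def)
  have un: "(\<Union>n. W n) = \<Union>\<W>"
    unfolding W_def using range_from_nat_into[OF \<open>\<W> \<noteq> {}\<close> \<W>(2)] by simp
  define D where "D n = B \<inter> disjointed W n" for n
  have Wb: "range W \<subseteq> sets borel" using W by (auto simp: adapted_def)
  have D: "range D \<subseteq> sets borel" "disjoint_family D" "(\<Union>n. D n) = B" "D n \<subseteq> W n" for n
  proof -
    show "range D \<subseteq> sets borel"
      using sets.range_disjointed_sets[OF Wb] B(1) by (auto simp: D_def)
    show "disjoint_family D"
      using disjoint_family_disjointed[of W] by (auto simp: D_def disjoint_family_on_def)
    show "(\<Union>n. D n) = B"
      using cover un UN_disjointed_eq[of W] unfolding D_def by (simp add: Int_UN_distrib[symmetric] inf_absorb1)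
    show "D n \<subseteq> W n" using disjointed_subset[of W n] by (auto simp: D_def)
  qed
  have "leaf_measure g I c (D n) = leaf_measure g I c' (D n)" for n
    by (rule leaf_measure_local[OF c, of "W n"]) (use W[of n] D in \<open>auto simp: adapted_def\<close>)
  then have "(\<Sum>n. leaf_measure g I c (D n)) = (\<Sum>n. leaf_measure g I c' (D n))" by simp
  then show ?thesis
    using leaf_measure_additive[OF c(1) D(1,2)] leaf_measure_additive[OF c(2) D(1,2)] B D(3) by simp
qed

abbreviation "vol \<equiv> leaf_volume g I \<Phi>"

text \<open>For closed \<open>L\<close> the trace sigma-algebra consists of the Borel sets of the
  manifold that lie in \<open>L\<close>, so the chartwise results apply to it.\<close>

lemma leaf_volume_completion:
  assumes L: "closed L"
  obtains \<mu> where "vol L = completion \<mu>" "sets \<mu> = sets (restrict_space borel L)"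
    "\<And>c B. c \<in> \<Phi> \<Longrightarrow> B \<in> sets borel \<Longrightarrow> B \<subseteq> L \<Longrightarrow> B \<subseteq> chart_dom c \<Longrightarrow> emeasure \<mu> B = leaf_measure g I c B"
proof -
  let ?\<nu> = "\<lambda>c B. \<integral>\<^sup>+ t. (\<integral>\<^sup>+ z. ennreal (sqrt (det (leaf_gram I (g c (chart_inv c (glue I z t))))))
                          * indicator (chart_map c ` B) (glue I z t)
                   \<partial>(\<Pi>\<^sub>M i\<in>I. lborel)) \<partial>count_space (\<Pi>\<^sub>E i\<in>-I. UNIV)"
  have \<nu>: "?\<nu> c B = leaf_measure g I c B" if "c \<in> \<Phi>" "B \<in> sets borel" "B \<subseteq> chart_dom c" for c B
    unfolding leaf_measure_def using slice_measure_eq[OF g \<Phi>_maximal[OF that(1)] that(2,3)] by simp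
  have Lb: "B \<in> sets (restrict_space borel L) \<longleftrightarrow> B \<in> sets borel \<and> B \<subseteq> L" for B
    using L by (subst sets_restrict_space_iff) auto
  obtain F where F: "finite F" "F \<subseteq> \<Phi>" "(\<Union>c\<in>F. chart_dom c) = UNIV"
    by (rule finite_chart_cover[OF compact_UNIV \<Phi>_is_chart \<Phi>_cover])
  have "\<exists>!\<mu>. sets \<mu> = sets (restrict_space borel L) \<and>
      (\<forall>c\<in>\<Phi>. \<forall>B\<in>sets (restrict_space borel L). B \<subseteq> chart_dom c \<longrightarrow> emeasure \<mu> B = ?\<nu> c B)"
  proof (rule measure_gluing[OF F(1,2)])
    show "space (restrict_space borel L) \<subseteq> (\<Union>c\<in>F. chart_dom c)" using F(3) by simp
    show "chart_dom c \<inter> space (restrict_space borel L) \<in> sets (restrict_space borel L)" if "c \<in> \<Phi>" for c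
      using chart_dom_open[OF \<Phi>_is_chart[OF that]] L by (simp add: Lb space_restrict_space)
    show "?\<nu> c {} = 0" if "c \<in> \<Phi>" for c by simp
    show "(\<Sum>i. ?\<nu> c (B i)) = ?\<nu> c (\<Union>i::nat. B i)"
      if c: "c \<in> \<Phi>" and B: "range B \<subseteq> sets (restrict_space borel L)" "disjoint_family B" "(\<Union>i. B i) \<subseteq> chart_dom c" for c B
    proof -
      have Bb: "B i \<in> sets borel" "B i \<subseteq> chart_dom c" for i using B Lb by auto
      then have "(\<Sum>i. ?\<nu> c (B i)) = (\<Sum>i. leaf_measure g I c (B i))" using \<nu>[OF c] by simp
      also have "\<dots> = leaf_measure g I c (\<Union>i. B i)"
        by (rule leaf_measure_additive) (use c B Bb in auto)
      also have "\<dots> = ?\<nu> c (\<Union>i. B i)" using B Bb by (intro \<nu>[OF c, symmetric]) auto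
      finally show ?thesis .
    qed
    show "?\<nu> c B = ?\<nu> c' B" if "c \<in> \<Phi>" "c' \<in> \<Phi>" "B \<in> sets (restrict_space borel L)" "B \<subseteq> chart_dom c" "B \<subseteq> chart_dom c'" for c c' B
      using that \<nu>[of c B] \<nu>[of c' B] leaf_measure_consistent[of c c' B] Lb[of B] by simp
  qed
  from theI'[OF this] obtain \<mu> where \<mu>: "vol L = completion \<mu>" "sets \<mu> = sets (restrict_space borel L)"
    "\<forall>c\<in>\<Phi>. \<forall>B\<in>sets (restrict_space borel L). B \<subseteq> chart_dom c \<longrightarrow> emeasure \<mu> B = ?\<nu> c B"
    unfolding leaf_volume_def by blast
  show ?thesis
    by (rule that[OF \<mu>(1,2)]) (use \<mu>(3) \<nu> Lb in auto)
qed

end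

text \<open>\<open>T\<close> may be uncountable. The induction over measurable functions still
  works, because integrals over a counting measure obey monotone convergence on any index
  set.\<close>

lemma nn_integral_sum_of_measures:
  assumes N: "\<And>t. t \<in> T \<Longrightarrow> sets (N t) = sets M"
    and em: "\<And>B. B \<in> sets M \<Longrightarrow> emeasure M B = (\<integral>\<^sup>+ t. emeasure (N t) B \<partial>count_space T)"
    and v: "v \<in> borel_measurable M"
  shows "(\<integral>\<^sup>+ x. v x \<partial>M) = (\<integral>\<^sup>+ t. (\<integral>\<^sup>+ x. v x \<partial>N t) \<partial>count_space T)"
  using v
proof (induction rule: borel_measurable_induct)
  case (cong f h)
  have "(\<integral>\<^sup>+ x. f x \<partial>M) = (\<integral>\<^sup>+ x. h x \<partial>M)" using cong by (intro nn_integral_cong)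
  moreover have "(\<integral>\<^sup>+ t. (\<integral>\<^sup>+ x. f x \<partial>N t) \<partial>count_space T) = (\<integral>\<^sup>+ t. (\<integral>\<^sup>+ x. h x \<partial>N t) \<partial>count_space T)"
    using cong sets_eq_imp_space_eq[OF N] by (intro nn_integral_cong) auto
  ultimately show ?case using cong by simp
next
  case (set B)
  have "(\<integral>\<^sup>+ t. (\<integral>\<^sup>+ x. indicator B x \<partial>N t) \<partial>count_space T) = (\<integral>\<^sup>+ t. emeasure (N t) B \<partial>count_space T)"
    using set N by (intro nn_integral_cong) simp
  then show ?case using set em by simp
next
  case (mult u a)
  have "(\<integral>\<^sup>+ t. (\<integral>\<^sup>+ x. a * u x \<partial>N t) \<partial>count_space T) = (\<integral>\<^sup>+ t. a * (\<integral>\<^sup>+ x. u x \<partial>N t) \<partial>count_space T)"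
    using mult by (intro nn_integral_cong nn_integral_cmult) (simp add: measurable_cong_sets[OF N])
  then show ?case using mult by (simp add: nn_integral_cmult)
next
  case (add u v)
  have "(\<integral>\<^sup>+ t. (\<integral>\<^sup>+ x. v x + u x \<partial>N t) \<partial>count_space T)
      = (\<integral>\<^sup>+ t. (\<integral>\<^sup>+ x. v x \<partial>N t) + (\<integral>\<^sup>+ x. u x \<partial>N t) \<partial>count_space T)"
    using add by (intro nn_integral_cong nn_integral_add) (simp_all add: measurable_cong_sets[OF N])
  then show ?case using add by (simp add: nn_integral_add)
next
  case (seq U)
  have m: "U i \<in> borel_measurable M" for i using seq by auto
  have sup: "(SUP i. U i) x = (SUP i. U i x)" for x by (simp add: image_image)
  have mono: "incseq (\<lambda>i t. \<integral>\<^sup>+ x. U i x \<partial>N t)"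
    using seq(3) by (auto simp: incseq_def le_fun_def intro!: nn_integral_mono)
  have "(\<integral>\<^sup>+ x. (SUP i. U i x) \<partial>M) = (SUP i. \<integral>\<^sup>+ x. U i x \<partial>M)"
    by (rule nn_integral_monotone_convergence_SUP[OF seq(3) m])
  also have "\<dots> = (SUP i. \<integral>\<^sup>+ t. (\<integral>\<^sup>+ x. U i x \<partial>N t) \<partial>count_space T)" using seq by simp
  also have "\<dots> = (\<integral>\<^sup>+ t. (SUP i. \<integral>\<^sup>+ x. U i x \<partial>N t) \<partial>count_space T)"
    by (rule nn_integral_monotone_convergence_SUP[OF mono, symmetric]) simp
  also have "\<dots> = (\<integral>\<^sup>+ t. (\<integral>\<^sup>+ x. (SUP i. U i x) \<partial>N t) \<partial>count_space T)"
    using m by (intro nn_integral_cong nn_integral_monotone_convergence_SUP[OF seq(3), symmetric])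
      (simp add: measurable_cong_sets[OF N])
  finally show ?case by (simp only: sup)
qed

text \<open>A vanishing integral restated in \<open>[0, \<infinity>]\<close>. In this form it can be
  summed over arbitrarily many slices, even if the sum diverges.\<close>

lemma nn_integral_parts_eq:
  assumes "integrable M u" "(\<integral>x. u x \<partial>M) = (0::real)"
  shows "(\<integral>\<^sup>+ x. ennreal (u x) \<partial>M) = (\<integral>\<^sup>+ x. ennreal (- u x) \<partial>M)"
proof -
  have fin: "(\<integral>\<^sup>+ x. ennreal (u x) \<partial>M) \<noteq> \<infinity>" "(\<integral>\<^sup>+ x. ennreal (- u x) \<partial>M) \<noteq> \<infinity>"
    using assms(1) by (auto simp: real_integrable_def)
  have "enn2real (\<integral>\<^sup>+ x. ennreal (u x) \<partial>M) = enn2real (\<integral>\<^sup>+ x. ennreal (- u x) \<partial>M)"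
    using real_lebesgue_integral_def[OF assms(1)] assms(2) by simp
  then have "ennreal (enn2real (\<integral>\<^sup>+ x. ennreal (u x) \<partial>M)) = ennreal (enn2real (\<integral>\<^sup>+ x. ennreal (- u x) \<partial>M))"
    by simp
  then show ?thesis using fin by (metis ennreal_enn2real infinity_ennreal_def top.not_eq_extremum)
qed

context foliated_manifold
begin

text \<open>Inside the chart the leaf measure is a sum of pushforwards \<open>N t\<close> of
  weighted Lebesgue measures on slices, and balance on each slice adds up to balance on the leaf.
  The totals may be infinite, hence a comparison of two parts instead of an integral.\<close>

lemma leaf_integral_balanced:
  assumes L: "closed L" and c: "c \<in> \<Phi>" and v: "v \<in> borel_measurable borel" "\<And>x. x \<notin> chart_dom c \<Longrightarrow> v x = 0"
    and D: "\<And>t. integrable lborel (\<lambda>y. slice_density g I c t (chart_dom c \<inter> L) y * v (chart_inv c (on_slice I t y)))"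
      "\<And>t. (\<integral>y. slice_density g I c t (chart_dom c \<inter> L) y * v (chart_inv c (on_slice I t y)) \<partial>lborel) = 0"
  shows "(\<integral>\<^sup>+ x. ennreal (v x) \<partial>vol L) = (\<integral>\<^sup>+ x. ennreal (- v x) \<partial>vol L)"
proof -
  note ch = \<Phi>_is_chart[OF c]
  obtain \<mu> where \<mu>: "vol L = completion \<mu>" "sets \<mu> = sets (restrict_space borel L)"
    "\<And>c B. c \<in> \<Phi> \<Longrightarrow> B \<in> sets borel \<Longrightarrow> B \<subseteq> L \<Longrightarrow> B \<subseteq> chart_dom c \<Longrightarrow> emeasure \<mu> B = leaf_measure g I c B"
    using leaf_volume_completion[OF L] by blast
  have Lb: "B \<in> sets \<mu> \<longleftrightarrow> B \<in> sets borel \<and> B \<subseteq> L" for B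
    unfolding \<mu>(2) using L by (subst sets_restrict_space_iff) auto
  let ?U = "chart_dom c \<inter> L"
  let ?k = "\<lambda>t y. slice_density g I c t ?U y"
  have U: "?U \<in> sets borel" using chart_dom_open[OF ch] L by auto
  have km: "?k t \<in> borel_measurable borel" for t
    by (rule slice_measure_integrand_measurable[OF g \<Phi>_maximal[OF c] U]) auto
  define S where "S t = {y. on_slice I t y \<in> chart_map c ` ?U}" for t
  have S: "S t \<in> sets borel" for t
  proof -
    have "S t = on_slice I t -` (chart_map c ` ?U) \<inter> space borel" by (auto simp: S_def)
    then show ?thesis
      using measurable_sets[OF glue_vec_measurable chart_image_borel[OF ch U]] by simp
  qed
  define p where "p t y = chart_inv c (on_slice I t y)" for t y
  have pm: "p t \<in> measurable (restrict_space lborel (S t)) (restrict_space borel L)" for t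
  proof (rule measurable_restrict_space2)
    show "p t \<in> space (restrict_space lborel (S t)) \<rightarrow> L"
      using chart_inv_map[OF ch] by (auto simp: p_def S_def space_restrict_space)
    have "continuous_on (S t) (p t)"
      unfolding p_def
      by (rule continuous_on_compose2[OF continuous_on_chart_inv[OF ch] continuous_on_glue]) (auto simp: S_def)
    from borel_measurable_continuous_on_restrict[OF this]
    show "p t \<in> borel_measurable (restrict_space lborel (S t))"
      by (simp add: measurable_cong_sets[OF sets_restrict_space_cong[OF sets_lborel]])
  qed
  \<comment> \<open>The restriction to \<open>S t\<close> matters: there \<open>p t\<close> is
    continuous with values in \<open>L\<close>, whereas \<open>chart_inv\<close> is arbitrary
    outside the image of the chart.\<close>
  define N where "N t = distr (density (restrict_space lborel (S t)) (\<lambda>y. ennreal (?k t y))) (restrict_space borel L) (p t)" for t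
  have km': "(\<lambda>y. ennreal (?k t y)) \<in> borel_measurable (restrict_space lborel (S t))" for t
    using measurable_compose[OF km measurable_ennreal] by (intro measurable_restrict_space1) simp
  have int_N: "(\<integral>\<^sup>+ x. f x \<partial>N t) = (\<integral>\<^sup>+ y. ennreal (?k t y) * f (p t y) \<partial>lborel)"
    if "f \<in> borel_measurable (restrict_space borel L)" for f t
  proof -
    have "(\<integral>\<^sup>+ x. f x \<partial>N t) = (\<integral>\<^sup>+ y. ennreal (?k t y) * f (p t y) \<partial>restrict_space lborel (S t))"
      unfolding N_def using that pm km' measurable_compose[OF pm that]
      by (simp add: nn_integral_distr nn_integral_density)
    also have "\<dots> = (\<integral>\<^sup>+ y. ennreal (?k t y) * f (p t y) * indicator (S t) y \<partial>lborel)"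
      using S by (simp add: nn_integral_restrict_space)
    also have "\<dots> = (\<integral>\<^sup>+ y. ennreal (?k t y) * f (p t y) \<partial>lborel)"
      by (rule nn_integral_cong) (auto simp: S_def indicator_def)
    finally show ?thesis .
  qed
  have setsN: "sets (N t) = sets (restrict_space borel L)" for t by (simp add: N_def)
  let ?\<mu> = "density \<mu> (indicator ?U)"
  have sum: "(\<integral>\<^sup>+ x. f x \<partial>?\<mu>) = (\<integral>\<^sup>+ t. (\<integral>\<^sup>+ x. f x \<partial>N t) \<partial>count_space (\<Pi>\<^sub>E i\<in>-I. UNIV))"
    if "f \<in> borel_measurable (restrict_space borel L)" for f
  proof (rule nn_integral_sum_of_measures)
    show "sets (N t) = sets ?\<mu>" for t by (simp add: setsN \<mu>)
    show "f \<in> borel_measurable ?\<mu>" using that by (simp add: measurable_cong_sets[OF \<mu>(2)])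
    fix B assume "B \<in> sets ?\<mu>"
    then have B: "B \<in> sets \<mu>" by simp
    have Us: "?U \<in> sets \<mu>" using U Lb by simp
    have "emeasure ?\<mu> B = emeasure \<mu> (B \<inter> ?U)"
      using B Us by (simp add: emeasure_density inf_commute flip: indicator_inter_arith)
    also have "\<dots> = leaf_measure g I c (B \<inter> ?U)"
      by (rule \<mu>(3)[OF c]) (use B Us Lb in auto)
    also have "\<dots> = (\<integral>\<^sup>+ t. emeasure (N t) B \<partial>count_space (\<Pi>\<^sub>E i\<in>-I. UNIV))"
      unfolding leaf_measure_def
    proof (rule nn_integral_cong)
      fix t
      have "emeasure (N t) B = (\<integral>\<^sup>+ x. indicator B x \<partial>N t)" using B setsN \<mu>(2) by simp
      also have "\<dots> = (\<integral>\<^sup>+ y. ennreal (?k t y) * indicator B (p t y) \<partial>lborel)"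
        using B \<mu>(2) by (intro int_N) simp
      also have "\<dots> = slice_measure g I c t (B \<inter> ?U)"
        unfolding slice_measure_def
      proof (rule nn_integral_cong)
        fix y
        have "on_slice I t y \<in> chart_map c ` (B \<inter> ?U) \<longleftrightarrow> on_slice I t y \<in> chart_map c ` ?U \<and> p t y \<in> B"
          using chart_inv_map[OF ch] by (force simp: p_def)
        then show "ennreal (?k t y) * indicator B (p t y) = ennreal (slice_density g I c t (B \<inter> ?U) y)"
          by (auto simp: indicator_def)
      qed
      finally show "slice_measure g I c t (B \<inter> ?U) = emeasure (N t) B" by simp
    qed
    finally show "emeasure ?\<mu> B = (\<integral>\<^sup>+ t. emeasure (N t) B \<partial>count_space (\<Pi>\<^sub>E i\<in>-I. UNIV))" .
  qed
  \<comment> \<open>The values 1 and -1 of \<open>s\<close> treat both parts by one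
    computation.\<close>
  have vol: "(\<integral>\<^sup>+ x. ennreal (s * v x) \<partial>vol L)
      = (\<integral>\<^sup>+ t. (\<integral>\<^sup>+ y. ennreal (s * (?k t y * v (p t y))) \<partial>lborel) \<partial>count_space (\<Pi>\<^sub>E i\<in>-I. UNIV))" for s
  proof -
    have vm: "(\<lambda>x. ennreal (s * v x)) \<in> borel_measurable (restrict_space borel L)"
      using v(1) by (intro measurable_restrict_space1) measurable
    then have vm': "(\<lambda>x. ennreal (s * v x)) \<in> borel_measurable \<mu>"
      by (simp add: measurable_cong_sets[OF \<mu>(2)])
    have Us: "?U \<in> sets \<mu>" using U Lb by simp
    have "(\<integral>\<^sup>+ x. ennreal (s * v x) \<partial>vol L) = (\<integral>\<^sup>+ x. ennreal (s * v x) \<partial>\<mu>)"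
      unfolding \<mu>(1) by (rule nn_integral_completion)
    also have "\<dots> = (\<integral>\<^sup>+ x. indicator ?U x * ennreal (s * v x) \<partial>\<mu>)"
    proof (rule nn_integral_cong)
      fix x assume "x \<in> space \<mu>"
      then have "x \<in> L" using sets_eq_imp_space_eq[OF \<mu>(2)] by (simp add: space_restrict_space)
      then show "ennreal (s * v x) = indicator ?U x * ennreal (s * v x)"
        using v(2)[of x] by (cases "x \<in> chart_dom c") auto
    qed
    also have "\<dots> = (\<integral>\<^sup>+ x. ennreal (s * v x) \<partial>?\<mu>)"
      using vm' Us by (simp add: nn_integral_density)
    also have "\<dots> = (\<integral>\<^sup>+ t. (\<integral>\<^sup>+ y. ennreal (?k t y) * ennreal (s * v (p t y)) \<partial>lborel) \<partial>count_space (\<Pi>\<^sub>E i\<in>-I. UNIV))"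
      unfolding sum[OF vm] int_N[OF vm] ..
    also have "\<dots> = (\<integral>\<^sup>+ t. (\<integral>\<^sup>+ y. ennreal (s * (?k t y * v (p t y))) \<partial>lborel) \<partial>count_space (\<Pi>\<^sub>E i\<in>-I. UNIV))"
    proof (intro nn_integral_cong)
      fix t y
      have "0 \<le> ?k t y"
      proof (cases "on_slice I t y \<in> chart_map c ` ?U")
        case True
        then have "0 < det (leaf_gram I (g c (chart_inv c (on_slice I t y))))"
          by (intro leaf_gram_metric_pos[OF g \<Phi>_maximal[OF c]] chart_inv_in[OF ch]) auto
        then show ?thesis by simp
      qed simp
      from ennreal_mult'[OF this, of "s * v (p t y)"]
      show "ennreal (?k t y) * ennreal (s * v (p t y)) = ennreal (s * (?k t y * v (p t y)))"
        by (simp only: mult.left_commute)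
    qed
    finally show ?thesis .
  qed
  have "(\<integral>\<^sup>+ y. ennreal (?k t y * v (p t y)) \<partial>lborel) = (\<integral>\<^sup>+ y. ennreal (- (?k t y * v (p t y))) \<partial>lborel)" for t
    using nn_integral_parts_eq[OF D[of t]] by (simp add: p_def)
  then show ?thesis using vol[of 1] vol[of "-1"] by simp
qed

end


section \<open>Bump functions\<close>

text \<open>At 0 the difference quotient is dominated by a positive power of \<open>max 0 h\<close>.
  This takes an exponent of at least 2, hence the two successors.\<close>

lemma DERIV_max_power:
  "((\<lambda>s::real. max 0 s ^ Suc (Suc k)) has_real_derivative real (Suc (Suc k)) * max 0 s ^ Suc k) (at s)"
proof -
  consider "s > 0" | "s < 0" | "s = 0" by linarith
  then show ?thesis
  proof cases
    case 1
    have "((\<lambda>s::real. s ^ Suc (Suc k)) has_real_derivative real (Suc (Suc k)) * max 0 s ^ Suc k) (at s)"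
      using DERIV_pow[of "Suc (Suc k)" s] 1 by (simp add: max_def)
    then show ?thesis
      by (rule has_field_derivative_transform_within_open[where S="{0<..}"]) (use 1 in auto)
  next
    case 2
    have "((\<lambda>s::real. 0) has_real_derivative real (Suc (Suc k)) * max 0 s ^ Suc k) (at s)"
      using 2 by simp
    then show ?thesis
      by (rule has_field_derivative_transform_within_open[where S="{..<0}"]) (use 2 in auto)
  next
    case 3
    have "((\<lambda>h::real. max 0 h ^ Suc (Suc k) / h) \<longlongrightarrow> 0) (at 0)"
    proof (rule Lim_null_comparison)
      show "\<forall>\<^sub>F h in at 0. norm (max 0 h ^ Suc (Suc k) / h) \<le> max 0 (h::real) ^ Suc k"
        by (rule always_eventually) (auto simp: max_def)
      have "((\<lambda>h::real. max 0 h ^ Suc k) \<longlongrightarrow> max 0 0 ^ Suc k) (at 0)"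
        by (intro tendsto_intros)
      then show "((\<lambda>h::real. max 0 h ^ Suc k) \<longlongrightarrow> 0) (at 0)" by simp
    qed
    then show ?thesis using 3 by (simp add: has_field_derivative_iff)
  qed
qed

text \<open>Each differentiation lowers the exponent by one, and exponent 1 is still continuous;
  this fixes the exponent \<open>Suc k\<close>.\<close>

lemma C_on_max_power:
  fixes u :: "real^'n::finite \<Rightarrow> real"
  assumes "open S" "C_on k S u"
  shows "C_on k S (\<lambda>y. max 0 (u y) ^ Suc k)"
  using assms(2)
proof (induction k)
  case 0
  then show ?case by (auto intro!: continuous_intros)
next
  case (Suc k)
  have 1: "((\<lambda>y. max 0 (u y) ^ Suc (Suc k)) has_derivative
      (\<lambda>h. real (Suc (Suc k)) * max 0 (u y) ^ Suc k * frechet_derivative u (at y) h)) (at y)" if "y \<in> S" for y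
    using has_derivative_compose[OF C_on_has_derivative[OF Suc.prems that]
        DERIV_max_power[of k "u y", unfolded has_field_derivative_def]] .
  have "C_on k S (\<lambda>y. real (Suc (Suc k)) * max 0 (u y) ^ Suc k * partial i u y)" for i
    using Suc.prems C_on_Suc_imp[OF Suc.prems]
    by (intro C_on_mult assms Suc.IH C_on_const) auto
  then show ?case by (intro C_on_SucI[OF assms(1) 1]) (simp_all add: partial_def)
qed

text \<open>A truncated paraboloid in place of the usual exponential bump: exponent 3 makes it C^2,
  the order of the Laplacian.\<close>

definition bump :: "real^'n::finite \<Rightarrow> real \<Rightarrow> real^'n \<Rightarrow> real" where
  "bump p r y = max 0 (r\<^sup>2 - (y - p) \<bullet> (y - p)) ^ 3"

lemma bump_C_on: "C_on 2 (UNIV :: (real^'n::finite) set) (bump p r)"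
proof -
  have "C_on 2 (UNIV :: (real^'n) set) (\<lambda>y. r\<^sup>2 - (\<Sum>i\<in>UNIV. (y - p) $ i * (y - p) $ i))"
    by (intro C_on_diff C_on_sum C_on_mult C_on_nth C_on_const C_on_ident open_UNIV)
  then have "C_on 2 (UNIV :: (real^'n) set) (\<lambda>y. r\<^sup>2 - (y - p) \<bullet> (y - p))"
    by (simp add: inner_vec_def)
  from C_on_max_power[OF open_UNIV this] show ?thesis
    by (simp add: bump_def[abs_def] numeral_3_eq_3 numeral_2_eq_2)
qed

lemma bump_nonneg: "0 \<le> bump p r y"
  by (simp add: bump_def)

lemma bump_pos_iff:
  assumes "0 < r" shows "0 < bump p r y \<longleftrightarrow> dist p y < r"
proof -
  have "0 < bump p r y \<longleftrightarrow> (norm (y - p))\<^sup>2 < r\<^sup>2"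
    by (auto simp: bump_def power2_norm_eq_inner max_def)
  also have "\<dots> \<longleftrightarrow> norm (y - p) < r"
    using assms by (meson norm_ge_zero order_less_imp_le power2_less_imp_less power_strict_mono zero_less_numeral)
  finally show ?thesis by (simp add: dist_norm norm_minus_commute)
qed

lemma bump_eq_0_iff: "0 < r \<Longrightarrow> bump p r y = 0 \<longleftrightarrow> y \<notin> ball p r"
  using bump_pos_iff[of r p y] bump_nonneg[of p r y] by auto

section \<open>The divergence theorem for compactly supported fields\<close>

lemma has_real_derivative_along_axis:
  fixes z :: "real^'n::finite \<Rightarrow> real"
  assumes "z differentiable (at y)"
  shows "((\<lambda>s. z (y + s *\<^sub>R axis i 1)) has_real_derivative partial i z y) (at 0)"
proof -
  have 1: "((\<lambda>s::real. y + s *\<^sub>R axis i 1) has_derivative (\<lambda>s. s *\<^sub>R axis i 1)) (at 0)"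
    by (auto intro!: derivative_eq_intros)
  have 2: "(z has_derivative frechet_derivative z (at y)) (at (y + 0 *\<^sub>R axis i 1))"
    using iffD1[OF frechet_derivative_works assms] by simp
  have lin: "linear (frechet_derivative z (at y))"
    using assms by (rule linear_frechet_derivative)
  from has_derivative_compose[OF 1 2] show ?thesis
    unfolding has_field_derivative_def partial_def
    by (rule has_derivative_eq_rhs) (simp add: linear_cmul[OF lin] fun_eq_iff)
qed

text \<open>The weight \<open>m\<close> restricts the integral to a part of \<open>S\<close> without boundary in the direction \<open>i\<close>.\<close>

lemma integral_weighted_partial_eq_0:
  fixes z m :: "real^'n::finite \<Rightarrow> real"
  assumes S: "open S" and z: "C_on 1 S z" and K: "closed K" "K \<subseteq> S" "\<And>y. y \<in> S - K \<Longrightarrow> z y = 0"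
    and m: "m \<in> borel_measurable borel" "\<And>y. \<bar>m y\<bar> \<le> 1"
      "\<And>y. y \<in> S \<Longrightarrow> \<exists>\<epsilon>>0. \<forall>s. \<bar>s\<bar> < \<epsilon> \<longrightarrow> m (y + s *\<^sub>R axis i 1) = m y"
    and bound: "\<And>y. y \<in> K \<Longrightarrow> \<bar>z y\<bar> \<le> B" "\<And>y. y \<in> K \<Longrightarrow> \<bar>partial i z y\<bar> \<le> B"
    and supp: "\<And>y. y \<in> K \<Longrightarrow> m y \<noteq> 0 \<Longrightarrow> norm y \<le> R"
  shows "integrable lborel (\<lambda>y. m y * (indicator S y * partial i z y))"
    and "(\<integral>y. m y * (indicator S y * partial i z y) \<partial>lborel) = 0"
proof -
  let ?v = "\<lambda>y. m y * (indicator S y * z y)" and ?D = "\<lambda>y. m y * (indicator S y * partial i z y)"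
  have zero: "partial i z y = 0" if "y \<in> S - K" for y
  proof -
    have "partial i z y = partial i (\<lambda>_. 0) y"
      by (rule partial_cong[of "S - K"]) (use S K that in \<open>auto intro: open_Diff\<close>)
    also have "\<dots> = 0" by (rule partial_eqI) (rule has_derivative_const)
    finally show ?thesis .
  qed
  have der: "((\<lambda>s. ?v (y + s *\<^sub>R axis i 1)) has_real_derivative ?D y) (at 0)" for y
  proof -
    have cont: "((\<lambda>s::real. y + s *\<^sub>R axis i 1) \<longlongrightarrow> y + 0 *\<^sub>R axis i 1) (at 0)"
      by (intro tendsto_intros)
    have ev: "\<forall>\<^sub>F s in nhds 0. y + s *\<^sub>R axis i 1 \<in> U" if "open U" "y \<in> U" for U
    proof -
      have "isCont (\<lambda>s::real. y + s *\<^sub>R axis i 1) 0" using cont by (simp add: isCont_def)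
      then show ?thesis using that by (simp add: continuous_at_open eventually_nhds)
    qed
    show ?thesis
    proof (cases "y \<in> S")
      case True
      obtain \<epsilon> where \<epsilon>: "\<epsilon> > 0" "\<And>s. \<bar>s\<bar> < \<epsilon> \<Longrightarrow> m (y + s *\<^sub>R axis i 1) = m y"
        using m(3)[OF True] by blast
      have "\<forall>\<^sub>F s in nhds 0. \<bar>s\<bar> < \<epsilon>"
        using \<epsilon>(1) by (auto simp: eventually_nhds_metric dist_real_def)
      then have "\<forall>\<^sub>F s in nhds 0. ?v (y + s *\<^sub>R axis i 1) = m y * z (y + s *\<^sub>R axis i 1)"
        using ev[OF S True] by eventually_elim (simp add: \<epsilon>(2))
      moreover have "((\<lambda>s. m y * z (y + s *\<^sub>R axis i 1)) has_real_derivative m y * partial i z y) (at 0)"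
        using z True by (intro DERIV_cmult has_real_derivative_along_axis) auto
      ultimately show ?thesis using True by (subst DERIV_cong_ev) auto
    next
      case False
      \<comment> \<open>Outside \<open>S\<close> nothing is known about \<open>z\<close>, but a
        neighbourhood of \<open>y\<close> misses \<open>K\<close>, and there the product with the
        indicator of \<open>S\<close> vanishes.\<close>
      then have "y \<in> - K" using K by auto
      from ev[OF _ this] have "\<forall>\<^sub>F s in nhds 0. y + s *\<^sub>R axis i 1 \<in> - K" using K by auto
      then have "\<forall>\<^sub>F s in nhds 0. ?v (y + s *\<^sub>R axis i 1) = 0"
        by eventually_elim (use K(3) in \<open>auto simp: indicator_def\<close>)
      then show ?thesis using False by (subst DERIV_cong_ev[of 0 0 _ "\<lambda>_. 0"]) auto
    qed
  qed
  have vm: "?v \<in> borel_measurable borel"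
  proof -
    have "(\<lambda>y. indicator S y *\<^sub>R z y) \<in> borel_measurable borel"
      using S C_on_imp_continuous[OF z] by (intro borel_measurable_continuous_on_indicator) auto
    then show ?thesis using m(1) by simp
  qed
  have le: "\<bar>m y * (indicator S y * a)\<bar> \<le> \<bar>B\<bar>" if "y \<in> K \<Longrightarrow> \<bar>a\<bar> \<le> B" "y \<in> S - K \<Longrightarrow> a = 0" for y a
  proof (cases "y \<in> K")
    case True
    have "\<bar>m y\<bar> * \<bar>a\<bar> \<le> 1 * \<bar>B\<bar>" using that(1)[OF True] m(2)[of y] by (intro mult_mono) auto
    then show ?thesis by (simp add: abs_mult indicator_def)
  qed (use that in \<open>auto simp: indicator_def\<close>)
  have s: "norm y \<le> R" if "?v y \<noteq> 0" for y
    using that K(3)[of y] supp[of y] by (cases "y \<in> K") (auto simp: indicator_def split: if_splits)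
  show "integrable lborel ?D" "(\<integral>y. ?D y \<partial>lborel) = 0"
    by (rule integral_directional_derivative_eq_0[OF der vm, where K = "\<bar>B\<bar>" and R = R];
        use le bound zero K(3) s in blast)+
qed

lemma compact_abs_bound:
  fixes u :: "'a::topological_space \<Rightarrow> real"
  assumes "compact K" "continuous_on K u"
  obtains B where "\<And>y. y \<in> K \<Longrightarrow> \<bar>u y\<bar> \<le> B"
  using compact_imp_bounded[OF compact_continuous_image[OF assms(2,1)]] unfolding bounded_iff by auto

text \<open>The coordinate divergence without a volume factor: the density is made part of the
  vector fields to which it is applied.\<close>

definition divergence :: "(real^'n::finite \<Rightarrow> real^'n) \<Rightarrow> real^'n \<Rightarrow> real" where
  "divergence Y y = (\<Sum>i\<in>UNIV. partial i (\<lambda>z. Y z $ i) y)"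

lemma divergence_theorem:
  fixes Z :: "real^'n::finite \<Rightarrow> real^'n"
  assumes S: "open S" and Z: "\<And>i. C_on 1 S (\<lambda>y. Z y $ i)"
    and K: "compact K" "K \<subseteq> S" "\<And>y. y \<in> S - K \<Longrightarrow> Z y = 0"
  shows "integrable lborel (\<lambda>y. indicator S y * divergence Z y)"
    and "(\<integral>y. indicator S y * divergence Z y \<partial>lborel) = 0"
proof -
  have *: "integrable lborel (\<lambda>y. indicator S y * partial i (\<lambda>y. Z y $ i) y) \<and>
      (\<integral>y. indicator S y * partial i (\<lambda>y. Z y $ i) y \<partial>lborel) = 0" for i
  proof -
    have "continuous_on K (\<lambda>y. Z y $ i)" "continuous_on K (partial i (\<lambda>y. Z y $ i))"
      using C_on_imp_continuous[OF Z[of i]] Z[of i] K(2) by (auto intro: continuous_on_subset)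
    then obtain B1 B2 where B: "\<And>y. y \<in> K \<Longrightarrow> \<bar>Z y $ i\<bar> \<le> B1" "\<And>y. y \<in> K \<Longrightarrow> \<bar>partial i (\<lambda>y. Z y $ i) y\<bar> \<le> B2"
      using compact_abs_bound[OF K(1)] by meson
    obtain R where R: "\<And>y. y \<in> K \<Longrightarrow> norm y \<le> R"
      using compact_imp_bounded[OF K(1)] unfolding bounded_iff by blast
    have \<epsilon>: "\<exists>\<epsilon>>0::real. \<forall>s. \<bar>s\<bar> < \<epsilon> \<longrightarrow> (1::real) = 1" by (rule exI[of _ 1]) auto
    have zK: "Z y $ i = 0" if "y \<in> S - K" for y using K(3)[OF that] by simp
    note lem = integral_weighted_partial_eq_0[OF S Z[of i] compact_imp_closed[OF K(1)] K(2) zK,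
        where m = "\<lambda>_. 1" and B = "max B1 B2" and R = R and i = i]
    show ?thesis using lem \<epsilon> B R by (simp add: le_max_iff_disj)
  qed
  show "integrable lborel (\<lambda>y. indicator S y * divergence Z y)"
    unfolding divergence_def sum_distrib_left
    by (intro Bochner_Integration.integrable_sum) (use * in blast)
  have "(\<integral>y. indicator S y * divergence Z y \<partial>lborel)
      = (\<Sum>i\<in>UNIV. \<integral>y. indicator S y * partial i (\<lambda>y. Z y $ i) y \<partial>lborel)"
    unfolding divergence_def sum_distrib_left
    by (intro Bochner_Integration.integral_sum) (use * in blast)
  then show "(\<integral>y. indicator S y * divergence Z y \<partial>lborel) = 0" using * by simp
qed

lemma divergence_scale:
  fixes Y :: "real^'n::finite \<Rightarrow> real^'n"
  assumes "\<phi> differentiable (at y)" "\<And>i. (\<lambda>y. Y y $ i) differentiable (at y)"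
  shows "divergence (\<lambda>y. \<phi> y *\<^sub>R Y y) y = \<phi> y * divergence Y y + (\<chi> i. partial i \<phi> y) \<bullet> Y y"
proof -
  have "partial i (\<lambda>y. \<phi> y * Y y $ i) y = \<phi> y * partial i (\<lambda>y. Y y $ i) y + partial i \<phi> y * Y y $ i" for i
    unfolding partial_def[of _ _ y]
    using assms frechet_derivative_works
    by (subst frechet_derivative_at[symmetric, OF has_derivative_mult]) blast+
  then show ?thesis
    by (simp add: divergence_def inner_vec_def sum.distrib sum_distrib_left)
qed

text \<open>
  Both divergences integrate to zero against test functions up to the same gradient term, because the
  pairing of a gradient with a vector field is invariant.
\<close>

lemma divergence_transformation:
  fixes T :: "real^'n::{finite,wellorder} \<Rightarrow> real^'n::_" and Y Y' :: "real^'n::_ \<Rightarrow> real^'n::_"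
  assumes S: "open S" "open S'" "T ` S = S'" "inj_on T S"
    and T: "C_on 1 S T"
    and der: "\<And>y. y \<in> S \<Longrightarrow> (T has_derivative (*v) (J y)) (at y)" and J: "\<And>y. y \<in> S \<Longrightarrow> det (J y) \<noteq> 0"
    and Y: "\<And>i. C_on 1 S (\<lambda>y. Y y $ i)" and Y': "\<And>i. C_on 1 S' (\<lambda>y. Y' y $ i)"
    and push: "\<And>y. y \<in> S \<Longrightarrow> J y *v Y y = \<bar>det (J y)\<bar> *\<^sub>R Y' (T y)"
    and y0: "y0 \<in> S"
  shows "divergence Y y0 = \<bar>det (J y0)\<bar> * divergence Y' (T y0)"
proof (rule ccontr)
  assume neq: "\<not> ?thesis"
  \<comment> \<open>The defect of the claimed identity is continuous. Testing it against a bump near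
    a point where it is nonzero leads to a contradiction.\<close>
  define e where "e y = divergence Y y - \<bar>det (J y)\<bar> * divergence Y' (T y)" for y
  have J_nth: "J y $ i $ j = partial j T y $ i" if "y \<in> S" for y i j
    using partial_eqI[OF der[OF that], of j] by (simp add: matrix_vector_mul_component inner_axis row_def matrix_vector_mult_basis column_def)
  have contJ: "continuous_on S (\<lambda>y. det (J y))"
  proof -
    have "C_on 0 S (\<lambda>y. det (\<chi> i j. partial j T y $ i))"
      by (rule C_on_det[OF S(1)]) (use T in \<open>auto intro!: C_on_nth[OF S(1), where k=0, simplified]\<close>)
    moreover have "det (\<chi> i j. partial j T y $ i) = det (J y)" if "y \<in> S" for y
      by (rule arg_cong[where f=det]) (simp add: vec_eq_iff J_nth[OF that])
    ultimately show ?thesis by (simp cong: continuous_on_cong)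
  qed
  have contT: "continuous_on S T" using T by (rule C_on_imp_continuous)
  have contdiv: "continuous_on S (divergence Y)" "continuous_on S' (divergence Y')"
    unfolding divergence_def using Y Y' by (auto intro!: continuous_on_sum)
  have cont_e: "continuous_on S e"
    unfolding e_def
    by (intro continuous_intros contJ contdiv continuous_on_compose2[OF contdiv(2) contT]) (use S in auto)
  have "e y0 \<noteq> 0" using neq by (simp add: e_def)
  define U where "U = {y \<in> S. 0 < e y * e y0}"
  have "open U"
  proof -
    have "continuous_on S (\<lambda>y. e y * e y0)" by (intro continuous_intros cont_e)
    then have "open ((\<lambda>y. e y * e y0) -` {0<..} \<inter> S)"
      using S(1) continuous_on_open_vimage[OF S(1)] open_greaterThan by blast
    moreover have "(\<lambda>y. e y * e y0) -` {0<..} \<inter> S = U" by (auto simp: U_def)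
    ultimately show ?thesis by simp
  qed
  have "y0 \<in> U" using \<open>e y0 \<noteq> 0\<close> y0 by (auto simp: U_def zero_less_mult_iff)
  have "open (T ` U)"
  proof (rule invariance_of_domain)
    show "continuous_on U T" using contT by (rule continuous_on_subset) (auto simp: U_def)
    show "inj_on T U" using S(4) by (rule inj_on_subset) (auto simp: U_def)
  qed fact
  \<comment> \<open>Invariance of domain makes the image of \<open>U\<close> open. The test function
    is a bump on a ball in the target, pulled back by \<open>T\<close>, so its support is compact on
    both sides.\<close>
  then obtain r where r: "r > 0" "cball (T y0) r \<subseteq> T ` U"
    using \<open>y0 \<in> U\<close> open_contains_cball by (metis imageI)
  define K' where "K' = cball (T y0) r"
  define K where "K = {y \<in> S. T y \<in> K'}"
  have K': "compact K'" "K' \<subseteq> S'" using r(2) S(3) by (auto simp: K'_def U_def)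
  have KU: "K \<subseteq> U"
  proof
    fix y assume y: "y \<in> K"
    then obtain z where "z \<in> U" "T y = T z" using r(2) by (auto simp: K_def K'_def)
    then have "y = z" using y S(4) by (auto simp: K_def U_def inj_on_def)
    then show "y \<in> U" using \<open>z \<in> U\<close> by simp
  qed
  obtain \<Xi> where \<Xi>: "homeomorphism S S' T \<Xi>"
    using invariance_of_domain_homeomorphism[OF S(1) contT _ S(4)] S(3) by auto
  have "K = \<Xi> ` K'"
    using \<Xi> K'(2) unfolding homeomorphism_def K_def by (auto simp: image_iff) (metis subsetD)+
  moreover have "continuous_on K' \<Xi>"
    using \<Xi> K'(2) unfolding homeomorphism_def by (blast intro: continuous_on_subset)
  ultimately have K: "compact K" using compact_continuous_image K'(1) by blast
  define \<phi>' where "\<phi>' = bump (T y0) r"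
  define \<phi> where "\<phi> y = \<phi>' (T y)" for y
  have \<phi>'C: "C_on 1 UNIV \<phi>'" unfolding \<phi>'_def by (rule C_on_mono[OF bump_C_on]) simp
  have \<phi>C: "C_on 1 S \<phi>" unfolding \<phi>_def
    by (rule C_on_compose[OF S(1) open_UNIV \<phi>'C T]) simp
  have \<phi>'0: "\<phi>' y = 0" if "y \<notin> K'" for y using that r(1) by (simp add: \<phi>'_def K'_def bump_eq_0_iff)
  let ?D = "divergence (\<lambda>y. \<phi> y *\<^sub>R Y y)" and ?D' = "divergence (\<lambda>y. \<phi>' y *\<^sub>R Y' y)"
  have ZC: "C_on 1 S (\<lambda>y. (\<phi> y *\<^sub>R Y y) $ i)" for i
    using C_on_mult[OF S(1) \<phi>C Y] by simp
  have ZC': "C_on 1 S' (\<lambda>y. (\<phi>' y *\<^sub>R Y' y) $ i)" for i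
    using C_on_mult[OF S(2) C_on_subset[OF \<phi>'C] Y'] by simp
  have Z0: "\<phi> y *\<^sub>R Y y = 0" if "y \<in> S - K" for y
    using that \<phi>'0 by (simp add: \<phi>_def K_def)
  have D: "integrable lborel (\<lambda>y. indicator S y * ?D y)" "(\<integral>y. indicator S y * ?D y \<partial>lborel) = 0"
    by (rule divergence_theorem[OF S(1) ZC K _ Z0]; force simp: K_def)+
  have D': "integrable lborel (\<lambda>y. indicator S' y * ?D' y)" "(\<integral>y. indicator S' y * ?D' y \<partial>lborel) = 0"
    by (rule divergence_theorem[OF S(2) ZC' K']; use \<phi>'0 in force)+
  \<comment> \<open>By \<open>push\<close> the gradient terms of the two product rules cancel, and
    only the test function times the defect remains.\<close>
  have diff: "?D y - \<bar>det (J y)\<bar> * ?D' (T y) = \<phi> y * e y" if y: "y \<in> S" for y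
  proof -
    have "T y \<in> S'" using y S(3) by auto
    have 1: "?D y = \<phi> y * divergence Y y + (\<chi> i. partial i \<phi> y) \<bullet> Y y"
      using Y \<phi>C y by (intro divergence_scale) auto
    have 2: "?D' (T y) = \<phi>' (T y) * divergence Y' (T y) + (\<chi> i. partial i \<phi>' (T y)) \<bullet> Y' (T y)"
      using Y' \<phi>'C \<open>T y \<in> S'\<close> by (intro divergence_scale) auto
    let ?G = "\<chi> i. partial i \<phi>' (T y)"
    have "\<phi>' differentiable (at (T y))" using \<phi>'C by simp
    from has_derivative_compose[OF der[OF y] has_derivative_partial_sum[OF this]]
    have d: "(\<phi> has_derivative (\<lambda>h. ?G \<bullet> (J y *v h))) (at y)"
      unfolding \<phi>_def by (simp add: inner_vec_def mult.commute)
    have "(\<chi> i. partial i \<phi> y) \<bullet> Y y = (\<Sum>i\<in>UNIV. Y y $ i * (?G \<bullet> (J y *v axis i 1)))"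
      by (simp add: inner_vec_def partial_eqI[OF d] mult.commute)
    also have "\<dots> = ?G \<bullet> (J y *v (\<Sum>i\<in>UNIV. Y y $ i *\<^sub>R axis i 1))"
      by (simp add: inner_sum_right linear_sum[OF matrix_vector_mul_linear] linear_cmul[OF matrix_vector_mul_linear])
    also have "(\<Sum>i\<in>UNIV. Y y $ i *\<^sub>R axis i 1) = Y y"
      using basis_expansion[of "Y y"] by (simp add: scalar_mult_eq_scaleR)
    finally have "(\<chi> i. partial i \<phi> y) \<bullet> Y y = \<bar>det (J y)\<bar> * (?G \<bullet> Y' (T y))"
      by (simp add: push[OF y])
    then show ?thesis unfolding 1 2 e_def by (simp add: \<phi>_def algebra_simps)
  qed
  let ?V = "\<lambda>y. indicator S y * (\<bar>det (matrix ((*v) (J y)))\<bar> * ?D' (T y))"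
  have D'm: "(\<lambda>y. indicator (T ` S) y * ?D' y) \<in> borel_measurable borel"
    using D'(1) S(3) by simp
  have cont_D': "continuous_on S' ?D'"
  proof -
    show ?thesis using ZC' unfolding divergence_def by (auto intro!: continuous_on_sum)
  qed
  have Vm: "?V \<in> borel_measurable borel"
  proof -
    have "continuous_on S (\<lambda>y. \<bar>det (J y)\<bar> * ?D' (T y))"
      by (intro continuous_intros contJ continuous_on_compose2[OF cont_D' contT]) (use S(3) in auto)
    then have "(\<lambda>y. indicator S y *\<^sub>R (\<bar>det (J y)\<bar> * ?D' (T y))) \<in> borel_measurable borel"
      using S(1) by (intro borel_measurable_continuous_on_indicator) auto
    then show ?thesis by simp
  qed
  have setsS: "S \<in> sets borel" using S(1) by simp
  note cov = integrable_lborel_change_of_variables[OF setsS has_derivative_at_withinI[OF der] S(4) D'm Vm]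
    integral_lborel_change_of_variables[OF setsS has_derivative_at_withinI[OF der] S(4) D'm Vm]
  have V: "integrable lborel ?V" "integral\<^sup>L lborel ?V = 0"
    using cov D' S(3) by simp_all
  have eq: "indicator S y * ?D y - ?V y = indicator S y * (\<phi> y * e y)" for y
    using diff[of y] by (auto simp: indicator_def)
  have "integrable lborel (\<lambda>y. indicator S y * ?D y - ?V y)" "(\<integral>y. indicator S y * ?D y - ?V y \<partial>lborel) = 0"
    using D V by simp_all
  then have int: "integrable lborel (\<lambda>y. indicator S y * (\<phi> y * e y) * e y0)"
      "(\<integral>y. indicator S y * (\<phi> y * e y) * e y0 \<partial>lborel) = 0"
    unfolding eq by simp_all
  \<comment> \<open>On the support of the test function the defect has the sign of
    \<open>e y0\<close>, so this factor makes the integrand nonnegative.\<close>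
  have nn: "0 \<le> indicator S y * (\<phi> y * e y) * e y0" for y
  proof (cases "y \<in> K")
    case True
    then have "0 < e y * e y0" using KU by (auto simp: U_def)
    then have "0 \<le> \<phi> y * (e y * e y0)" using bump_nonneg[of "T y0" r "T y"] by (simp add: \<phi>_def \<phi>'_def)
    then show ?thesis by (simp add: indicator_def mult.assoc)
  next
    case False
    then show ?thesis using \<phi>'0 by (auto simp: K_def \<phi>_def indicator_def)
  qed
  have "AE y in lborel. indicator S y * (\<phi> y * e y) * e y0 = 0"
    using integral_nonneg_eq_0_iff_AE[OF int(1)] nn int(2) by simp
  then have "AE y in lborel. y \<notin> {y \<in> U. T y \<in> ball (T y0) r}"
  proof eventually_elim
    case (elim y)
    show ?case
    proof
      assume y: "y \<in> {y \<in> U. T y \<in> ball (T y0) r}"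
      then have "0 < \<phi> y" using bump_pos_iff[OF r(1), of "T y0" "T y"] by (simp add: \<phi>_def \<phi>'_def)
      moreover have "e y * e y0 > 0" "y \<in> S" using y by (auto simp: U_def)
      ultimately show False using elim by auto
    qed
  qed
  moreover have "open {y \<in> U. T y \<in> ball (T y0) r}"
  proof -
    have "open (T -` ball (T y0) r \<inter> U)"
      using continuous_on_open_vimage[OF \<open>open U\<close>] continuous_on_subset[OF contT, of U] by (auto simp: U_def)
    moreover have "T -` ball (T y0) r \<inter> U = {y \<in> U. T y \<in> ball (T y0) r}" by auto
    ultimately show ?thesis by simp
  qed
  ultimately have "{y \<in> U. T y \<in> ball (T y0) r} \<in> null_sets lborel"
    by (subst AE_iff_null_sets) auto
  then have "{y \<in> U. T y \<in> ball (T y0) r} = {}"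
    using open_not_negligible[OF \<open>open {y \<in> U. T y \<in> ball (T y0) r}\<close>]
    by (auto simp: negligible_iff_null_sets dest: null_sets_completionI)
  then show False using \<open>y0 \<in> U\<close> r(1) by auto
qed


section \<open>The leafwise Laplacian\<close>

text \<open>The tangential part of the gradient is the gradient of the restriction to the leaf for
  the induced metric: under \<open>G\<close>, both pair with a leaf direction as the differential
  \<open>d\<close> does.\<close>

lemma tangential_part_eq:
  fixes G :: "real^'n::finite^'n"
  assumes G: "\<And>v. v \<noteq> 0 \<Longrightarrow> 0 < v \<bullet> (G *v v)"
  shows "tangential_part I G (matrix_inv G *v d)
    = matrix_inv (leaf_gram I G) *v (\<chi> i. if i \<in> I then d $ i else 0)" (is "_ = ?w")
  unfolding tangential_part_def
proof (rule the_equality)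
  let ?v = "matrix_inv G *v d"
  have "det G \<noteq> 0" using det_pos_def[OF G] by auto
  then have Gv: "G *v ?v = d" by (simp add: matrix_vector_mul_assoc matrix_inv_inverse)
  have "det (leaf_gram I G) \<noteq> 0" using det_pos_def[OF leaf_gram_pos_def[OF G]] by (metis less_irrefl)
  then have Lw: "leaf_gram I G *v ?w = (\<chi> i. if i \<in> I then d $ i else 0)"
    by (simp add: matrix_vector_mul_assoc matrix_inv_inverse)
  have w0: "?w $ j = 0" if "j \<notin> I" for j
    using leaf_gram_mult_vec[of I G ?w j] that unfolding Lw by simp
  then have "glue I (($) ?w) (\<lambda>_. 0) = ?w" by (auto simp: vec_eq_iff glue_nth)
  then have Gw: "(G *v ?w) $ i = d $ i" if "i \<in> I" for i
    using leaf_gram_mult_vec[of I G ?w i] that unfolding Lw by simp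
  show w: "(\<forall>j\<in>-I. ?w $ j = 0) \<and> (\<forall>u. (\<forall>j\<in>-I. u $ j = 0) \<longrightarrow> u \<bullet> (G *v (?v - ?w)) = 0)"
  proof (intro conjI ballI allI impI)
    fix u :: "real^'n" assume u: "\<forall>j\<in>-I. u $ j = 0"
    have "u $ i * (d $ i - (G *v ?w) $ i) = 0" for i
      using u Gw by (cases "i \<in> I") auto
    then show "u \<bullet> (G *v (?v - ?w)) = 0"
      unfolding matrix_vector_mult_diff_distrib Gv inner_vec_def by (intro sum.neutral) simp
  qed (use w0 in auto)
  fix w' assume w': "(\<forall>j\<in>-I. w' $ j = 0) \<and> (\<forall>u. (\<forall>j\<in>-I. u $ j = 0) \<longrightarrow> u \<bullet> (G *v (?v - w')) = 0)"
  define u where "u = ?w - w'"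
  have "\<forall>j\<in>-I. u $ j = 0" using w w' by (simp add: u_def)
  then have "u \<bullet> (G *v (?v - w')) = 0" "u \<bullet> (G *v (?v - ?w)) = 0" using w w' by blast+
  then have "u \<bullet> (G *v u) = 0"
    by (simp add: u_def matrix_vector_mult_diff_distrib inner_diff_right)
  then have "u = 0" using G[of u] by auto
  then show "w' = ?w" by (simp add: u_def)
qed

text \<open>The leafwise gradient as a vector density. With the factor \<open>leaf_density\<close>,
  its plain coordinate divergence is the Laplacian times that density.\<close>

definition leaf_flux ::
    "('a, 'n::finite) metric \<Rightarrow> 'n set \<Rightarrow> ('a, 'n) chart \<Rightarrow> ('a \<Rightarrow> real) \<Rightarrow> real^'n \<Rightarrow> real^'n" where
  "leaf_flux g I c f y = leaf_density g I c y *\<^sub>R (matrix_inv (leaf_gram I (g c (chart_inv c y))) *v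
     (\<chi> i. if i \<in> I then partial i (f \<circ> chart_inv c) y else 0))"

definition leaf_laplacian ::
    "('a, 'n::finite) metric \<Rightarrow> 'n set \<Rightarrow> ('a, 'n) chart \<Rightarrow> ('a \<Rightarrow> real) \<Rightarrow> real^'n \<Rightarrow> real" where
  "leaf_laplacian g I c f y = (\<Sum>i\<in>I. partial i (\<lambda>u. leaf_flux g I c f u $ i) y) / leaf_density g I c y"

lemma leaf_divergence_gradient:
  assumes g: "riemannian_metric A g" and c: "c \<in> maximal_atlas A" and y: "y \<in> chart_map c ` chart_dom c"
  shows "leaf_divergence g I c (\<lambda>y. tangential_part I (g c (chart_inv c y)) (gradient g c f y)) y
    = leaf_laplacian g I c f y"
proof -
  note ch = maximal_atlas_is_chart[OF c]
  have "leaf_density g I c u * tangential_part I (g c (chart_inv c u)) (gradient g c f u) $ i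
      = leaf_flux g I c f u $ i" if u: "u \<in> chart_map c ` chart_dom c" for u i
  proof -
    have "0 < v \<bullet> (g c (chart_inv c u) *v v)" if "v \<noteq> 0" for v
      using g c chart_inv_in[OF ch u] that unfolding riemannian_metric_def by blast
    then show ?thesis
      unfolding gradient_def leaf_flux_def by (subst tangential_part_eq) (simp_all cong: if_cong)
  qed
  then have "partial i (\<lambda>u. leaf_density g I c u * tangential_part I (g c (chart_inv c u)) (gradient g c f u) $ i) y
      = partial i (\<lambda>u. leaf_flux g I c f u $ i) y" for i
    by (rule partial_cong[OF chart_target_open[OF ch] y])
  then show ?thesis by (simp add: leaf_divergence_def leaf_laplacian_def Let_def)
qed

text \<open>One derivative is spent on \<open>f\<close>. The metric enters through a determinant and
  a linear system, both of which preserve regularity.\<close>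

lemma leaf_flux_C_on:
  assumes g: "riemannian_metric A g" and c: "c \<in> maximal_atlas A"
    and S: "open S" "S \<subseteq> chart_map c ` chart_dom c" and f: "C_on 2 S (f \<circ> chart_inv c)"
  shows "C_on 1 S (\<lambda>y. leaf_flux g I c f y $ i)"
proof -
  note ch = maximal_atlas_is_chart[OF c]
  have "C_on 1 S (\<lambda>y. leaf_density g I c y * (matrix_inv (leaf_gram I (g c (chart_inv c y))) *v
     (\<chi> i. if i \<in> I then partial i (f \<circ> chart_inv c) y else 0)) $ i)"
  proof (rule C_on_mult[OF S(1) C_on_subset[OF leaf_density_C_on[OF g c] S(2)] C_on_solve[OF S(1)]])
    show "C_on 1 S (\<lambda>y. leaf_gram I (g c (chart_inv c y)) $ i $ j)" for i j
      by (rule C_on_subset[OF leaf_gram_metric_C_on[OF g c] S(2)])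
    show "C_on 1 S (\<lambda>y. (\<chi> i. if i \<in> I then partial i (f \<circ> chart_inv c) y else 0) $ i)" for i
      using f by (cases "i \<in> I") (auto simp: numeral_2_eq_2)
    show "det (leaf_gram I (g c (chart_inv c y))) \<noteq> 0" if "y \<in> S" for y
      using leaf_gram_metric_pos[OF g c chart_inv_in[OF ch]] S(2) that by (metis less_irrefl subsetD)
  qed
  then show ?thesis by (simp add: leaf_flux_def)
qed

text \<open>The dummies do not influence the field, so only derivatives in leaf directions
  survive.\<close>

lemma divergence_on_slice:
  fixes X :: "real^'n::finite \<Rightarrow> real^'n"
  assumes "\<And>i. (\<lambda>u. X u $ i) differentiable (at (on_slice I t y))"
  shows "divergence (\<lambda>y. X (on_slice I t y)) y = (\<Sum>i\<in>I. partial i (\<lambda>u. X u $ i) (on_slice I t y))"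
  unfolding divergence_def using partial_on_slice[OF assms]
  by (simp add: sum.If_cases)

context slice_transition
begin

text \<open>Pulled back to slices, the two fluxes are related by \<open>T\<close> as vector
  densities, which is the hypothesis of \<open>divergence_transformation\<close>. The factor between
  the divergences is cancelled by \<open>density_law\<close>.\<close>

lemma leaf_laplacian_transition:
  assumes f: "C_on 2 (chart_map c ` W) (f \<circ> chart_inv c)" "C_on 2 (chart_map c' ` W) (f \<circ> chart_inv c')"
    and y: "y \<in> S"
  shows "leaf_laplacian g I c f (on_slice I t y) = leaf_laplacian g I c' f (on_slice I t' (T y))"
proof -
  let ?J = "\<lambda>y. leaf_gram I (J y)"
  let ?X = "leaf_flux g I c f" and ?X' = "leaf_flux g I c' f"
  define Y where "Y y = ?X (on_slice I t y)" for y
  define Y' where "Y' y = ?X' (on_slice I t' y)" for y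
  have op: "open (chart_map c ` W)" "open (chart_map c' ` W)"
    by (rule chart_image_open[OF ch W(1,2)], rule chart_image_open[OF ch' W(1,3)])
  have X: "C_on 1 (chart_map c ` W) (\<lambda>y. ?X y $ i)" for i
    by (rule leaf_flux_C_on[OF g c op(1) _ f(1)]) (use W in auto)
  have X': "C_on 1 (chart_map c' ` W) (\<lambda>y. ?X' y $ i)" for i
    by (rule leaf_flux_C_on[OF g c' op(2) _ f(2)]) (use W in auto)
  have Y: "C_on 1 S (\<lambda>y. Y y $ i)" for i
    unfolding Y_def by (rule C_on_compose[OF S_open(1) op(1) X on_slice_C_on]) (auto simp: S_def)
  have Y': "C_on 1 S' (\<lambda>y. Y' y $ i)" for i
    unfolding Y'_def by (rule C_on_compose[OF S_open(2) op(2) X' on_slice_C_on]) (auto simp: S'_def)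
  have onS: "on_slice I t y \<in> chart_map c ` W" "T y \<in> S'" "on_slice I t' (T y) \<in> chart_map c' ` W" if "y \<in> S" for y
    using that T_S by (auto simp: S_def S'_def)
  have push: "?J y *v Y y = \<bar>det (?J y)\<bar> *\<^sub>R Y' (T y)" if y: "y \<in> S" for y
  proof -
    define H where "H = leaf_gram I (g c (chart_inv c (on_slice I t y)))"
    define H' where "H' = leaf_gram I (g c' (chart_inv c' (on_slice I t' (T y))))"
    define m where "m = (\<chi> i. if i \<in> I then partial i (f \<circ> chart_inv c) (on_slice I t y) else 0)"
    define m' where "m' = (\<chi> i. if i \<in> I then partial i (f \<circ> chart_inv c') (on_slice I t' (T y)) else 0)"
    define F where "F y = (f \<circ> chart_inv c) (on_slice I t y)" for y
    define F' where "F' y = (f \<circ> chart_inv c') (on_slice I t' y)" for y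
    have df: "(f \<circ> chart_inv c) differentiable (at (on_slice I t y))"
      "(f \<circ> chart_inv c') differentiable (at (on_slice I t' (T y)))"
      using f onS[OF y] by (auto simp: numeral_2_eq_2)
    have mF: "m $ j = partial j F y" for j
      unfolding F_def using partial_on_slice[OF df(1), of j] by (simp add: m_def)
    have mF': "m' $ j = partial j F' (T y)" for j
      unfolding F'_def using partial_on_slice[OF df(2), of j] by (simp add: m'_def)
    have "C_on 1 S' F'"
      unfolding F'_def
      by (rule C_on_compose[OF S_open(2) op(2) C_on_mono[OF f(2)] on_slice_C_on]) (auto simp: S'_def)
    then have "F' differentiable (at (T y))" using onS[OF y] by auto
    from has_derivative_compose[OF has_derivative_T[OF y] has_derivative_partial_sum[OF this]]
    have d: "((\<lambda>y. F' (T y)) has_derivative (\<lambda>h. \<Sum>i\<in>UNIV. (?J y *v h) $ i * m' $ i)) (at y)"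
      by (simp add: mF')
    have "F z = F' (T z)" if "z \<in> S" for z
      using on_slice_S_target(3)[OF that] by (simp add: F_def F'_def)
    then have "m $ j = partial j (\<lambda>y. F' (T y)) y" for j
      unfolding mF by (rule partial_cong[OF S_open(1) y])
    \<comment> \<open>Chain rule: the leafwise differential is pulled back by the transposed
      Jacobian.\<close>
    then have "m $ j = (transpose (?J y) *v m') $ j" for j
      using partial_eqI[OF d, of j]
      by (simp add: matrix_vector_mult_basis column_def) (simp add: matrix_vector_mult_def vector_matrix_mult_def transpose_def mult.commute)
    then have m: "m = transpose (?J y) *v m'" by (simp add: vec_eq_iff)
    have H: "H = transpose (?J y) ** H' ** ?J y" unfolding H_def H'_def by (rule gram_law[OF y])
    have pos: "0 < det H" "0 < det H'"
      unfolding H_def H'_def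
      by (intro leaf_gram_metric_pos[OF g c] leaf_gram_metric_pos[OF g c'] chart_inv_in ch ch' on_slice_S_target y)+
    have Yy: "Y y = leaf_density g I c (on_slice I t y) *\<^sub>R (matrix_inv H *v m)"
      by (simp add: Y_def leaf_flux_def H_def m_def)
    have Y'y: "Y' (T y) = leaf_density g I c' (on_slice I t' (T y)) *\<^sub>R (matrix_inv H' *v m')"
      by (simp add: Y'_def leaf_flux_def H'_def m'_def)
    \<comment> \<open>Cancelling the invertible matrices \<open>transpose (?J y)\<close> and
      \<open>H'\<close> in turn shows that the Jacobian maps one leafwise gradient to the
      other.\<close>
    have "transpose (?J y) *v (H' *v (?J y *v (matrix_inv H *v m))) = H *v (matrix_inv H *v m)"
      by (simp add: H matrix_vector_mul_assoc matrix_mul_assoc)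
    also have "\<dots> = transpose (?J y) *v m'"
      using pos by (simp add: matrix_vector_mul_assoc matrix_inv_inverse m)
    finally have "H' *v (?J y *v (matrix_inv H *v m)) = m'"
      by (rule matrix_vector_mult_left_cancel[rotated]) (simp add: det_J[OF y])
    then have "H' *v (?J y *v (matrix_inv H *v m)) = H' *v (matrix_inv H' *v m')"
      using pos by (simp add: matrix_vector_mul_assoc matrix_inv_inverse)
    then have "?J y *v (matrix_inv H *v m) = matrix_inv H' *v m'"
      by (rule matrix_vector_mult_left_cancel[rotated]) (use pos in simp)
    then show ?thesis
      unfolding Yy Y'y density_law[OF y] by (simp add: matrix_vector_mult_scaleR)
  qed
  have "divergence Y y = \<bar>det (?J y)\<bar> * divergence Y' (T y)"
    by (rule divergence_transformation[OF S_open T_S inj_on_T T_C_on has_derivative_T det_J Y Y' push y])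
  moreover have "divergence Y y = (\<Sum>i\<in>I. partial i (\<lambda>u. ?X u $ i) (on_slice I t y))"
    unfolding Y_def by (rule divergence_on_slice) (use X onS[OF y] in auto)
  moreover have "divergence Y' (T y) = (\<Sum>i\<in>I. partial i (\<lambda>u. ?X' u $ i) (on_slice I t' (T y)))"
    unfolding Y'_def by (rule divergence_on_slice) (use X' onS[OF y] in auto)
  ultimately show ?thesis
    unfolding leaf_laplacian_def density_law[OF y] using det_J[OF y] by simp
qed

end

text \<open>Two derivatives in foliated charts are all that the Laplacian sees. The class is wide
  enough for products with cutoffs built from \<open>bump\<close>.\<close>

definition C2_fun :: "('a::topological_space, 'n::finite) chart set \<Rightarrow> ('a \<Rightarrow> real) \<Rightarrow> bool" where
  "C2_fun \<Phi> f \<longleftrightarrow> (\<forall>c\<in>\<Phi>. C_on 2 (chart_map c ` chart_dom c) (f \<circ> chart_inv c))"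

context foliated_manifold
begin

abbreviation "\<Delta> \<equiv> leafwise_laplacian g I \<Phi>"

lemma smooth_fun_imp_C2_fun: "smooth_fun A f \<Longrightarrow> C2_fun \<Phi> f"
  unfolding smooth_fun_def C2_fun_def smooth_on_def using \<Phi>_maximal by blast

text \<open>Independence of the chart is \<open>leaf_laplacian_transition\<close> on the slice
  through \<open>x\<close>. As some chart contains \<open>x\<close>, the description by
  \<open>THE\<close> has exactly one solution.\<close>

lemma leafwise_laplacian_eq:
  assumes f: "C2_fun \<Phi> f" and c: "c \<in> \<Phi>" and x: "x \<in> chart_dom c"
  shows "\<Delta> f x = leaf_laplacian g I c f (chart_map c x)"
  unfolding leafwise_laplacian_def
proof (rule the_equality)
  have eq: "leaf_laplacian g I c f (chart_map c x) = leaf_laplacian g I c' f (chart_map c' x)"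
    if c': "c' \<in> \<Phi>" "x \<in> chart_dom c'" for c'
  proof -
    obtain W where nb: "open W" "x \<in> W" "W \<subseteq> chart_dom c" "W \<subseteq> chart_dom c'"
      "preserves_slices I c c' W" "preserves_slices I c' c W"
      by (rule foliated_neighbourhood[OF c c'(1) x c'(2)], rule that)
    have flat: "C_on 2 (chart_map c ` W) (f \<circ> chart_inv c)" "C_on 2 (chart_map c' ` W) (f \<circ> chart_inv c')"
      using f c c'(1) nb(3,4) unfolding C2_fun_def by (blast intro: C_on_subset)+
    interpret slice_transition A g I c c' W "($) (chart_map c x)" "($) (chart_map c' x)"
      using A g \<Phi>_maximal[OF c] \<Phi>_maximal[OF c'(1)] nb(1,3,4) preserves_slices_iff[OF nb(5,6) _ nb(2)] by unfold_locales
    have y: "chart_map c x \<in> S" using nb(2) by (auto simp: S_def)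
    have "on_slice I (($) (chart_map c' x)) (T (chart_map c x)) = chart_map c' x"
      using x by (simp add: T_def transition_map[OF ch])
    then show ?thesis
      using leaf_laplacian_transition[OF flat y] by simp
  qed
  show "\<forall>c'\<in>\<Phi>. x \<in> chart_dom c' \<longrightarrow> leaf_laplacian g I c f (chart_map c x) =
      leaf_divergence g I c' (\<lambda>y. tangential_part I (g c' (chart_inv c' y)) (gradient g c' f y)) (chart_map c' x)"
    using eq leaf_divergence_gradient[OF g \<Phi>_maximal] by simp
  show "r = leaf_laplacian g I c f (chart_map c x)"
    if "\<forall>c\<in>\<Phi>. x \<in> chart_dom c \<longrightarrow> r = leaf_divergence g I c
      (\<lambda>y. tangential_part I (g c (chart_inv c y)) (gradient g c f y)) (chart_map c x)" for r
    using that c x leaf_divergence_gradient[OF g \<Phi>_maximal[OF c]] by simp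
qed

section \<open>Continuity and additivity of the leafwise Laplacian\<close>

lemma leaf_laplacian_continuous:
  assumes f: "C2_fun \<Phi> f" and c: "c \<in> \<Phi>"
  shows "continuous_on (chart_map c ` chart_dom c) (leaf_laplacian g I c f)"
proof -
  note cm = \<Phi>_maximal[OF c] and ch = \<Phi>_is_chart[OF c]
  have "C_on 1 (chart_map c ` chart_dom c) (\<lambda>y. leaf_flux g I c f y $ i)" for i
    by (rule leaf_flux_C_on[OF g cm chart_target_open[OF ch]]) (use f c in \<open>auto simp: C2_fun_def\<close>)
  moreover have "leaf_density g I c y \<noteq> 0" if "y \<in> chart_map c ` chart_dom c" for y
    using leaf_gram_metric_pos[OF g cm chart_inv_in[OF ch that], of I] by simp
  ultimately show ?thesis
    unfolding leaf_laplacian_def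
    by (intro continuous_on_divide continuous_on_sum C_on_imp_continuous[OF leaf_density_C_on[OF g cm, of 0]]) auto
qed

lemma leafwise_laplacian_continuous:
  assumes f: "C2_fun \<Phi> f"
  shows "continuous_on UNIV (\<Delta> f)"
proof -
  have "isCont (\<Delta> f) x" for x
  proof -
    obtain c where c: "c \<in> \<Phi>" "x \<in> chart_dom c" using \<Phi>_cover by blast
    note ch = \<Phi>_is_chart[OF c(1)]
    have "continuous_on (chart_dom c) (\<lambda>x. leaf_laplacian g I c f (chart_map c x))"
      by (rule continuous_on_compose2[OF leaf_laplacian_continuous[OF f c(1)] continuous_on_chart[OF ch]]) simp
    then have "continuous_on (chart_dom c) (\<Delta> f)"
      using leafwise_laplacian_eq[OF f c(1)] by (simp cong: continuous_on_cong)
    then show ?thesis using c(2) chart_dom_open[OF ch] by (simp add: continuous_on_eq_continuous_at)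
  qed
  then show ?thesis by (simp add: continuous_at_imp_continuous_on)
qed

lemma leaf_laplacian_sum:
  assumes F: "finite F" and f: "\<And>k. k \<in> F \<Longrightarrow> C2_fun \<Phi> (f k)"
    and c: "c \<in> \<Phi>" and y: "y \<in> chart_map c ` chart_dom c"
  shows "leaf_laplacian g I c (\<lambda>x. \<Sum>k\<in>F. f k x) y = (\<Sum>k\<in>F. leaf_laplacian g I c (f k) y)"
proof -
  note cm = \<Phi>_maximal[OF c] and ch = \<Phi>_is_chart[OF c]
  let ?T = "chart_map c ` chart_dom c"
  have fC: "C_on 2 ?T (f k \<circ> chart_inv c)" if "k \<in> F" for k
    using f[OF that] c by (simp add: C2_fun_def)
  have has: "((f k \<circ> chart_inv c) has_derivative frechet_derivative (f k \<circ> chart_inv c) (at u)) (at u)"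
    if "k \<in> F" "u \<in> ?T" for k u
    using C_on_has_derivative[of 1 ?T] fC[OF that(1)] that(2) by (simp add: numeral_2_eq_2)
  have "partial i ((\<lambda>x. \<Sum>k\<in>F. f k x) \<circ> chart_inv c) u = (\<Sum>k\<in>F. partial i (f k \<circ> chart_inv c) u)" if "u \<in> ?T" for u i
  proof -
    have "((\<lambda>v. \<Sum>k\<in>F. (f k \<circ> chart_inv c) v) has_derivative
        (\<lambda>h. \<Sum>k\<in>F. frechet_derivative (f k \<circ> chart_inv c) (at u) h)) (at u)"
      by (rule has_derivative_sum) (rule has[OF _ that])
    from partial_eqI[OF this, of i] show ?thesis by (simp add: partial_def o_def)
  qed
  then have "leaf_flux g I c (\<lambda>x. \<Sum>k\<in>F. f k x) u = (\<Sum>k\<in>F. leaf_flux g I c (f k) u)" if "u \<in> ?T" for u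
  proof -
    have "(\<chi> i. if i \<in> I then partial i ((\<lambda>x. \<Sum>k\<in>F. f k x) \<circ> chart_inv c) u else 0)
        = (\<Sum>k\<in>F. \<chi> i. if i \<in> I then partial i (f k \<circ> chart_inv c) u else 0)"
      using \<open>\<And>u i. u \<in> ?T \<Longrightarrow> partial i _ u = _\<close>[OF that] by (simp add: vec_eq_iff)
    then show ?thesis
      by (simp add: leaf_flux_def linear_sum[OF matrix_vector_mul_linear] scaleR_sum_right)
  qed
  then have "partial i (\<lambda>u. leaf_flux g I c (\<lambda>x. \<Sum>k\<in>F. f k x) u $ i) y
      = partial i (\<lambda>u. \<Sum>k\<in>F. leaf_flux g I c (f k) u $ i) y" for i
    by (intro partial_cong[OF chart_target_open[OF ch] y]) simp
  also have "\<dots> i = (\<Sum>k\<in>F. partial i (\<lambda>u. leaf_flux g I c (f k) u $ i) y)" for i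
  proof -
    have "((\<lambda>u. \<Sum>k\<in>F. leaf_flux g I c (f k) u $ i) has_derivative
        (\<lambda>h. \<Sum>k\<in>F. frechet_derivative (\<lambda>u. leaf_flux g I c (f k) u $ i) (at y) h)) (at y)"
    proof (rule has_derivative_sum)
      fix k assume "k \<in> F"
      have "C_on 1 ?T (\<lambda>y. leaf_flux g I c (f k) y $ i)"
        by (rule leaf_flux_C_on[OF g cm chart_target_open[OF ch] _ fC[OF \<open>k \<in> F\<close>]]) simp
      then show "((\<lambda>u. leaf_flux g I c (f k) u $ i) has_derivative frechet_derivative (\<lambda>u. leaf_flux g I c (f k) u $ i) (at y)) (at y)"
        using C_on_has_derivative[of 0 ?T] y by simp
    qed
    from partial_eqI[OF this, of i] show ?thesis by (simp add: partial_def)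
  qed
  finally show ?thesis
    by (simp add: leaf_laplacian_def sum.swap[of _ F I] sum_divide_distrib)
qed

lemma leafwise_laplacian_sum:
  assumes F: "finite F" and f: "\<And>k. k \<in> F \<Longrightarrow> C2_fun \<Phi> (f k)" and s: "C2_fun \<Phi> (\<lambda>x. \<Sum>k\<in>F. f k x)"
  shows "\<Delta> (\<lambda>x. \<Sum>k\<in>F. f k x) x = (\<Sum>k\<in>F. \<Delta> (f k) x)"
proof -
  obtain c where c: "c \<in> \<Phi>" "x \<in> chart_dom c" using \<Phi>_cover by blast
  then show ?thesis
    using leaf_laplacian_sum[OF F f c(1), where y = "chart_map c x"] leafwise_laplacian_eq[OF s c] leafwise_laplacian_eq[OF f c]
    by simp
qed

end


section \<open>Leafwise Laplacians have mean zero on leaves of finite volume\<close>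

lemma on_slice_add_axis:
  "i \<in> I \<Longrightarrow> on_slice I t (y + s *\<^sub>R axis i 1) = on_slice I t y + s *\<^sub>R axis i 1"
  by (auto simp: glue_def vec_eq_iff axis_def)

text \<open>\<open>leaf_rel\<close> is only a reflexive transitive closure, so moving back along a
  plaque rests on the symmetry of the generating steps: points of a slice define the same slice, and
  connected components are symmetric.\<close>

lemma leaf_saturated:
  assumes L: "L \<in> leaves I \<Phi>" and c: "c \<in> \<Phi>" and xy: "y \<in> connected_component_set (slice I c x) x"
  shows "x \<in> L \<longleftrightarrow> y \<in> L"
proof -
  let ?R = "{(x, y). \<exists>c\<in>\<Phi>. y \<in> connected_component_set (slice I c x) x}"
  obtain z where z: "L = ?R\<^sup>* `` {z}"
    using L unfolding leaves_def leaf_rel_def by (auto elim: quotientE)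
  have "y \<in> slice I c x" using xy connected_component_in by fastforce
  then have "slice I c y = slice I c x" by (auto simp: slice_def)
  then have "x \<in> connected_component_set (slice I c y) y"
    using xy by (simp add: connected_component_sym_eq)
  then have "(x, y) \<in> ?R" "(y, x) \<in> ?R" using c xy by blast+
  then show ?thesis unfolding z by (meson Image_singleton_iff rtrancl.rtrancl_into_rtrancl)
qed

text \<open>A short segment in a leaf direction is a connected part of a slice and so stays in one
  plaque. The indicator of a leaf is therefore a weight without boundary in leaf directions, as
  integration by parts demands.\<close>

lemma leaf_locally_constant:
  fixes c :: "('a::topological_space, 'n::finite) chart"
  assumes L: "L \<in> leaves I \<Phi>" and c: "c \<in> \<Phi>" "is_chart c" and i: "i \<in> I" and p: "p \<in> chart_map c ` chart_dom c"
  shows "\<exists>\<epsilon>>0. \<forall>s. \<bar>s\<bar> < \<epsilon> \<longrightarrow>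
    (p + s *\<^sub>R axis i 1 \<in> chart_map c ` (chart_dom c \<inter> L) \<longleftrightarrow> p \<in> chart_map c ` (chart_dom c \<inter> L))"
proof -
  obtain \<epsilon> where \<epsilon>: "\<epsilon> > 0" "ball p \<epsilon> \<subseteq> chart_map c ` chart_dom c"
    using chart_target_open[OF c(2)] p by (meson openE)
  have mem: "q \<in> chart_map c ` (chart_dom c \<inter> L) \<longleftrightarrow> chart_inv c q \<in> L" if "q \<in> chart_map c ` chart_dom c" for q
    using that chart_image_mem_iff[OF c(2), of "chart_dom c \<inter> L"] chart_inv_map[OF c(2)] by auto
  have "p + s *\<^sub>R axis i 1 \<in> chart_map c ` (chart_dom c \<inter> L) \<longleftrightarrow> p \<in> chart_map c ` (chart_dom c \<inter> L)"
    if s: "\<bar>s\<bar> < \<epsilon>" for s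
  proof -
    let ?q = "p + s *\<^sub>R axis i 1"
    let ?S = "closed_segment p ?q"
    have "?q \<in> ball p \<epsilon>" using s by (simp add: dist_norm)
    then have S: "?S \<subseteq> chart_map c ` chart_dom c"
      using \<epsilon> by (meson centre_in_ball closed_segment_subset convex_ball order_trans)
    have conn: "connected (chart_inv c ` ?S)"
      by (intro connected_continuous_image continuous_on_subset[OF continuous_on_chart_inv[OF c(2)] S] connected_segment)
    have sub: "chart_inv c ` ?S \<subseteq> slice I c (chart_inv c p)"
    proof
      fix x assume "x \<in> chart_inv c ` ?S"
      then obtain u where u: "u \<in> ?S" "x = chart_inv c u" by auto
      then obtain a where a: "u = p + a *\<^sub>R (s *\<^sub>R axis i 1)"
        by (auto simp: in_segment algebra_simps)
      have "u \<in> chart_map c ` chart_dom c" using u S by auto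
      then show "x \<in> slice I c (chart_inv c p)"
        using chart_inv_in[OF c(2)] chart_map_inv[OF c(2)] p i u(2)
        by (auto simp: slice_def a axis_def)
    qed
    have "chart_inv c ?q \<in> connected_component_set (slice I c (chart_inv c p)) (chart_inv c p)"
      using conn sub by (auto intro!: connected_componentI)
    then have "chart_inv c p \<in> L \<longleftrightarrow> chart_inv c ?q \<in> L"
      by (rule leaf_saturated[OF L c(1)])
    then show ?thesis using mem[OF p] mem[of ?q] S by auto
  qed
  then show ?thesis using \<epsilon>(1) by blast
qed

context foliated_manifold
begin

lemma leaf_laplacian_eq_0:
  assumes c: "c \<in> \<Phi>" and W: "open W" "W \<subseteq> chart_map c ` chart_dom c" "y \<in> W"
    and h: "\<And>u. u \<in> W \<Longrightarrow> h (chart_inv c u) = 0"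
  shows "leaf_flux g I c h y = 0" "leaf_laplacian g I c h y = 0"
proof -
  have "partial i (h \<circ> chart_inv c) u = 0" if "u \<in> W" for i u
  proof -
    have "partial i (h \<circ> chart_inv c) u = partial i (\<lambda>_. 0) u"
      by (rule partial_cong[OF W(1) that]) (simp add: h)
    also have "\<dots> = 0" by (rule partial_eqI) (rule has_derivative_const)
    finally show ?thesis .
  qed
  then have flux: "leaf_flux g I c h u = 0" if "u \<in> W" for u
    using that unfolding leaf_flux_def
    by (simp cong: if_cong add: vec_eq_iff[of "\<chi> i. _ i", symmetric]) (simp add: zero_vec_def[symmetric])
  have "partial i (\<lambda>u. leaf_flux g I c h u $ i) y = partial i (\<lambda>_. 0) y" for i
    by (rule partial_cong[OF W(1,3)]) (simp add: flux)
  moreover have "partial i (\<lambda>_. 0) y = (0::real)" for i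
    by (rule partial_eqI) (rule has_derivative_const)
  ultimately show "leaf_laplacian g I c h y = 0" by (simp add: leaf_laplacian_def)
  show "leaf_flux g I c h y = 0" using flux W(3) .
qed

text \<open>On a slice, density times Laplacian is the coordinate divergence of the flux, and each
  of its terms integrates to zero against the weight \<open>m\<close>.\<close>

lemma leaf_integral_laplacian_balanced:
  assumes h: "C2_fun \<Phi> h" and c: "c \<in> \<Phi>" and K: "compact K" "K \<subseteq> chart_dom c" "\<And>x. x \<notin> K \<Longrightarrow> h x = 0"
    and L: "L \<in> leaves I \<Phi>" "closed L"
  shows "(\<integral>\<^sup>+ x. ennreal (\<Delta> h x) \<partial>vol L)
       = (\<integral>\<^sup>+ x. ennreal (- \<Delta> h x) \<partial>vol L)"
proof -
  note cm = \<Phi>_maximal[OF c] and ch = \<Phi>_is_chart[OF c]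
  let ?X = "leaf_flux g I c h" and ?T = "chart_map c ` chart_dom c" and ?U = "chart_dom c \<inter> L" and ?v = "\<Delta> h"
  have clK: "closed K" using K(1) by (rule compact_imp_closed)
  have cK: "compact (chart_map c ` K)"
    by (rule compact_continuous_image[OF continuous_on_subset[OF continuous_on_chart[OF ch] K(2)] K(1)])
  \<comment> \<open>Here \<open>x\<close> may lie outside \<open>chart_dom c\<close>, so the
    Laplacian is computed in another chart \<open>d\<close> around \<open>x\<close>.\<close>
  have v0: "?v x = 0" if "x \<notin> K" for x
  proof -
    obtain d where d: "d \<in> \<Phi>" "x \<in> chart_dom d" using \<Phi>_cover by blast
    note chd = \<Phi>_is_chart[OF d(1)]
    have "leaf_laplacian g I d h (chart_map d x) = 0"
    proof (rule leaf_laplacian_eq_0(2)[OF d(1), of "chart_map d ` (chart_dom d - K)"])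
      show "open (chart_map d ` (chart_dom d - K))"
        by (intro chart_image_open[OF chd] open_Diff chart_dom_open[OF chd] clK) auto
      show "h (chart_inv d u) = 0" if "u \<in> chart_map d ` (chart_dom d - K)" for u
        using that K(3) by (auto simp: chart_inv_map[OF chd])
    qed (use d that in auto)
    then show ?thesis using leafwise_laplacian_eq[OF h d] by simp
  qed
  have flux0: "?X q = 0" if "q \<in> ?T - chart_map c ` K" for q
  proof (rule leaf_laplacian_eq_0(1)[OF c, of "?T - chart_map c ` K"])
    show "open (?T - chart_map c ` K)"
      by (intro open_Diff chart_target_open[OF ch] compact_imp_closed[OF cK])
    show "h (chart_inv c u) = 0" if "u \<in> ?T - chart_map c ` K" for u
    proof (rule K(3))
      show "chart_inv c u \<notin> K"
        using that chart_map_inv[OF ch, of u] by (metis DiffE imageI)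
    qed
  qed (use that in auto)
  have fluxC: "C_on 1 ?T (\<lambda>y. ?X y $ i)" for i
    by (rule leaf_flux_C_on[OF g cm chart_target_open[OF ch]]) (use h c in \<open>auto simp: C2_fun_def\<close>)
  have KT: "chart_map c ` K \<subseteq> ?T" using K(2) by auto
  have "\<exists>B. \<forall>q\<in>chart_map c ` K. \<bar>?X q $ i\<bar> \<le> B \<and> \<bar>partial i (\<lambda>y. ?X y $ i) q\<bar> \<le> B" for i
  proof -
    have "continuous_on (chart_map c ` K) (\<lambda>y. ?X y $ i)"
      "continuous_on (chart_map c ` K) (partial i (\<lambda>y. ?X y $ i))"
      using C_on_imp_continuous[OF fluxC[of i]] fluxC[of i] KT by (auto intro: continuous_on_subset)
    then obtain B1 B2 where "\<And>q. q \<in> chart_map c ` K \<Longrightarrow> \<bar>?X q $ i\<bar> \<le> B1"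
      "\<And>q. q \<in> chart_map c ` K \<Longrightarrow> \<bar>partial i (\<lambda>y. ?X y $ i) q\<bar> \<le> B2"
      using compact_abs_bound[OF cK] by meson
    then show ?thesis by (intro exI[of _ "max B1 B2"]) (auto simp: le_max_iff_disj)
  qed
  then obtain B where B: "\<And>i q. q \<in> chart_map c ` K \<Longrightarrow> \<bar>?X q $ i\<bar> \<le> B i"
    "\<And>i q. q \<in> chart_map c ` K \<Longrightarrow> \<bar>partial i (\<lambda>y. ?X y $ i) q\<bar> \<le> B i"
    by metis
  obtain R where R: "\<And>q. q \<in> chart_map c ` K \<Longrightarrow> norm q \<le> R"
    using compact_imp_bounded[OF cK] unfolding bounded_iff by blast
  have Ub: "?U \<in> sets borel" using chart_dom_open[OF ch] L(2) by auto
  have main: "integrable lborel (\<lambda>y. slice_density g I c t ?U y * ?v (chart_inv c (on_slice I t y))) \<and>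
      (\<integral>y. slice_density g I c t ?U y * ?v (chart_inv c (on_slice I t y)) \<partial>lborel) = 0" for t
  proof -
    define S where "S = {y. on_slice I t y \<in> ?T}"
    \<comment> \<open>One factor cuts the dummies down to the cube, the other selects the slices of
      \<open>L\<close>. Within \<open>S\<close> neither changes under small moves in a leaf
      direction.\<close>
    define m where "m y = (indicator (cube I) y * indicator (chart_map c ` ?U) (on_slice I t y) :: real)" for y
    define z where "z i y = ?X (on_slice I t y) $ i" for i y
    define K' where "K' = {y. on_slice I t y \<in> chart_map c ` K}"
    have "open (on_slice I t -` ?T)"
      using chart_target_open[OF ch] continuous_on_glue[of UNIV I t] by (simp add: continuous_on_open_vimage)
    then have S: "open S" by (simp add: S_def vimage_def)
    have "closed (on_slice I t -` (chart_map c ` K))"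
      by (rule closed_vimage[OF compact_imp_closed[OF cK] continuous_on_glue])
    then have K': "closed K'" "K' \<subseteq> S" using KT by (auto simp: K'_def S_def vimage_def)
    have zC: "C_on 1 S (z i)" for i
      unfolding z_def by (rule C_on_compose[OF S chart_target_open[OF ch] fluxC on_slice_C_on]) (auto simp: S_def)
    have z0: "z i y = 0" if "y \<in> S - K'" for i y
      using flux0[of "on_slice I t y"] that by (simp add: z_def S_def K'_def)
    have zp: "partial i (z i) y = partial i (\<lambda>q. ?X q $ i) (on_slice I t y)" if "y \<in> S" "i \<in> I" for i y
    proof -
      have "(\<lambda>q. ?X q $ i) differentiable (at (on_slice I t y))"
        using fluxC[of i] that(1) unfolding S_def One_nat_def C_on.simps by blast
      from partial_on_slice[OF this, of i] show ?thesis unfolding z_def using that(2) by simp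
    qed
    have mb: "m \<in> borel_measurable borel"
      unfolding m_def
      by (intro borel_measurable_times borel_measurable_indicator cube_borel
          measurable_compose[OF glue_vec_measurable] chart_image_borel[OF ch Ub]) auto
    have mloc: "\<exists>\<epsilon>>0. \<forall>s. \<bar>s\<bar> < \<epsilon> \<longrightarrow> m (y + s *\<^sub>R axis i 1) = m y" if yi: "y \<in> S" "i \<in> I" for y i
    proof -
      have cube: "y + s *\<^sub>R axis i 1 \<in> cube I \<longleftrightarrow> y \<in> cube I" for s
        using yi(2) by (auto simp: cube_def axis_def)
      obtain \<epsilon> where "\<epsilon> > 0" "\<forall>s. \<bar>s\<bar> < \<epsilon> \<longrightarrow> (on_slice I t y + s *\<^sub>R axis i 1 \<in> chart_map c ` ?U \<longleftrightarrow>
          on_slice I t y \<in> chart_map c ` ?U)"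
        using leaf_locally_constant[OF L(1) c ch yi(2), of "on_slice I t y"] yi(1) by (auto simp: S_def)
      then show ?thesis
        by (intro exI[of _ \<epsilon>]) (auto simp: m_def cube on_slice_add_axis[OF yi(2)] indicator_def)
    qed
    \<comment> \<open>\<open>K\<close> bounds the leaf coordinates by \<open>R\<close>, the cube
      bounds the dummies by 1, and \<open>\<bar>R\<bar> + 1\<close> covers both.\<close>
    have supp: "norm y \<le> (\<Sum>j\<in>(UNIV::'n set). \<bar>R\<bar> + 1)" if "y \<in> K'" "m y \<noteq> 0" for y
    proof -
      have "\<bar>y $ j\<bar> \<le> \<bar>R\<bar> + 1" for j
      proof (cases "j \<in> I")
        case True
        have "\<bar>on_slice I t y $ j\<bar> \<le> R"
          using component_le_norm_cart[of "on_slice I t y" j] R[of "on_slice I t y"] that(1) by (simp add: K'_def)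
        then show ?thesis using True by (simp add: glue_nth)
      next
        case False
        have "y \<in> cube I" using that(2) by (auto simp: m_def indicator_def split: if_splits)
        then have "0 \<le> y $ j" "y $ j \<le> 1" using False by (auto simp: cube_def)
        then show ?thesis by simp
      qed
      then show ?thesis using norm_le_l1_cart[of y] by (meson order_trans sum_mono)
    qed
    have bz: "\<bar>z i y\<bar> \<le> B i" "i \<in> I \<Longrightarrow> \<bar>partial i (z i) y\<bar> \<le> B i" if "y \<in> K'" for i y
      using B[of "on_slice I t y" i] that zp[of y i] K'(2) by (auto simp: K'_def z_def)
    have m1: "\<bar>m y\<bar> \<le> 1" for y by (simp add: m_def indicator_def)
    have part: "integrable lborel (\<lambda>y. m y * (indicator S y * partial i (z i) y))"
      "(\<integral>y. m y * (indicator S y * partial i (z i) y) \<partial>lborel) = 0" if "i \<in> I" for i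
      using integral_weighted_partial_eq_0[OF S zC K' z0 mb m1 mloc[OF _ that] bz(1) bz(2)[OF _ that] supp] by blast+
    have eq: "slice_density g I c t ?U y * ?v (chart_inv c (on_slice I t y))
        = (\<Sum>i\<in>I. m y * (indicator S y * partial i (z i) y))" for y
    proof (cases "on_slice I t y \<in> chart_map c ` ?U")
      case True
      then have y: "y \<in> S" and T: "on_slice I t y \<in> ?T" by (auto simp: S_def)
      have "?v (chart_inv c (on_slice I t y)) = leaf_laplacian g I c h (on_slice I t y)"
        using leafwise_laplacian_eq[OF h c chart_inv_in[OF ch T]] chart_map_inv[OF ch T] by simp
      moreover have "0 < leaf_density g I c (on_slice I t y)"
        using leaf_gram_metric_pos[OF g cm chart_inv_in[OF ch T], of I] by simp
      moreover have "(\<Sum>i\<in>I. partial i (\<lambda>q. ?X q $ i) (on_slice I t y)) = (\<Sum>i\<in>I. partial i (z i) y)"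
        using zp[OF y] by simp
      ultimately have "leaf_density g I c (on_slice I t y) * ?v (chart_inv c (on_slice I t y)) = (\<Sum>i\<in>I. partial i (z i) y)"
        by (simp add: leaf_laplacian_def)
      then have "slice_density g I c t ?U y * ?v (chart_inv c (on_slice I t y))
          = m y * (\<Sum>i\<in>I. partial i (z i) y)"
        using True by (auto simp: m_def indicator_def)
      also have "\<dots> = (\<Sum>i\<in>I. m y * (indicator S y * partial i (z i) y))"
        using y by (subst sum_distrib_left) simp
      finally show ?thesis .
    next
      case False
      then show ?thesis by (simp add: m_def)
    qed
    have "(\<integral>y. (\<Sum>i\<in>I. m y * (indicator S y * partial i (z i) y)) \<partial>lborel)
        = (\<Sum>i\<in>I. \<integral>y. m y * (indicator S y * partial i (z i) y) \<partial>lborel)"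
      by (rule Bochner_Integration.integral_sum) (rule part(1))
    then show ?thesis unfolding eq using part by (auto intro!: Bochner_Integration.integrable_sum)
  qed
  show ?thesis
  proof (rule leaf_integral_balanced[OF L(2) c])
    show "?v \<in> borel_measurable borel"
      by (rule borel_measurable_continuous_onI[OF leafwise_laplacian_continuous[OF h]])
    show "?v x = 0" if "x \<notin> chart_dom c" for x using v0 K(2) that by blast
  qed (use main in blast)+
qed

text \<open>The bumps live on closed coordinate balls inside chart images. Their extensions by zero
  are C^2 because the preimages \<open>K x\<close> are compact and hence closed. Compactness of the
  manifold selects finitely many with positive sum, by which all are divided.\<close>

lemma C2_partition_of_unity:
  obtains X :: "'a set" and \<eta> :: "'a \<Rightarrow> 'a \<Rightarrow> real" and d :: "'a \<Rightarrow> ('a, 'n) chart" and K :: "'a \<Rightarrow> 'a set"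
  where "finite X" "\<And>x. d x \<in> \<Phi>" "\<And>x. compact (K x)" "\<And>x. K x \<subseteq> chart_dom (d x)"
    "\<And>x q. q \<notin> K x \<Longrightarrow> \<eta> x q = 0" "\<And>x. C2_fun \<Phi> (\<eta> x)" "\<And>q. (\<Sum>x\<in>X. \<eta> x q) = 1"
proof -
  have "\<exists>d r. d \<in> \<Phi> \<and> x \<in> chart_dom d \<and> r > 0 \<and> cball (chart_map d x) r \<subseteq> chart_map d ` chart_dom d" for x
  proof -
    obtain d where d: "d \<in> \<Phi>" "x \<in> chart_dom d" using \<Phi>_cover by blast
    then show ?thesis
      using chart_target_open[OF \<Phi>_is_chart[OF d(1)]] open_contains_cball by (metis imageI)
  qed
  then obtain d r where d: "\<And>x. d x \<in> \<Phi>" "\<And>x. x \<in> chart_dom (d x)" "\<And>x. r x > 0"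
    "\<And>x. cball (chart_map (d x) x) (r x) \<subseteq> chart_map (d x) ` chart_dom (d x)"
    by metis
  note ch = \<Phi>_is_chart[OF d(1)]
  define K where "K x = chart_inv (d x) ` cball (chart_map (d x) x) (r x)" for x
  define \<beta> where "\<beta> x q = (if q \<in> chart_dom (d x) then bump (chart_map (d x) x) (r x) (chart_map (d x) q) else 0)" for x q
  have K: "compact (K x)" "K x \<subseteq> chart_dom (d x)" for x
  proof -
    show "compact (K x)"
      unfolding K_def
      by (intro compact_continuous_image continuous_on_subset[OF continuous_on_chart_inv[OF ch] d(4)] compact_cball)
    show "K x \<subseteq> chart_dom (d x)"
      unfolding K_def using chart_inv_in[OF ch subsetD[OF d(4)]] by blast
  qed
  have \<beta>0: "\<beta> x q = 0" if "q \<notin> K x" for x q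
  proof (cases "q \<in> chart_dom (d x)")
    case True
    have "chart_map (d x) q \<notin> ball (chart_map (d x) x) (r x)"
    proof
      assume "chart_map (d x) q \<in> ball (chart_map (d x) x) (r x)"
      then have "chart_inv (d x) (chart_map (d x) q) \<in> K x" unfolding K_def by auto
      then show False using that chart_inv_map[OF ch True] by simp
    qed
    then show ?thesis by (simp add: \<beta>_def bump_eq_0_iff[OF d(3)])
  qed (simp add: \<beta>_def)
  have \<beta>C: "C2_fun \<Phi> (\<beta> x)" for x
    unfolding C2_fun_def
  proof (intro ballI C_on_local)
    fix c p assume c: "c \<in> \<Phi>" and "p \<in> chart_map c ` chart_dom c"
    then obtain q where q: "q \<in> chart_dom c" "p = chart_map c q" by auto
    note chc = \<Phi>_is_chart[OF c]
    show "\<exists>W. open W \<and> p \<in> W \<and> C_on 2 W (\<beta> x \<circ> chart_inv c)"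
    proof (cases "q \<in> chart_dom (d x)")
      case True
      let ?W = "chart_map c ` (chart_dom c \<inter> chart_dom (d x))"
      have W: "open ?W" by (intro chart_image_open[OF chc] open_Int chart_dom_open chc ch) auto
      have "C_on 2 ?W (\<lambda>y. bump (chart_map (d x) x) (r x) (transition c (d x) y))"
        by (rule C_on_compose[OF W open_UNIV bump_C_on transition_C_on[OF A \<Phi>_maximal[OF c] \<Phi>_maximal[OF d(1)]]]) simp
      moreover have "(\<beta> x \<circ> chart_inv c) y = bump (chart_map (d x) x) (r x) (transition c (d x) y)" if "y \<in> ?W" for y
        using that by (auto simp: \<beta>_def transition_map[OF chc] chart_inv_map[OF chc])
      ultimately have "C_on 2 ?W (\<beta> x \<circ> chart_inv c)"
        by (subst C_on_cong[OF W, where v = "\<lambda>y. bump (chart_map (d x) x) (r x) (transition c (d x) y)"])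
      then show ?thesis using W q True by blast
    next
      case False
      let ?W = "chart_map c ` (chart_dom c - K x)"
      have W: "open ?W"
        by (intro chart_image_open[OF chc] open_Diff chart_dom_open[OF chc] compact_imp_closed K) auto
      have "(\<beta> x \<circ> chart_inv c) y = 0" if "y \<in> ?W" for y
        using that \<beta>0 by (auto simp: chart_inv_map[OF chc])
      then have "C_on 2 ?W (\<beta> x \<circ> chart_inv c)" 
        by (subst C_on_cong[OF W, where v = "\<lambda>_. 0"]) simp_all
      moreover have "p \<in> ?W" using q False K(2)[of x] by auto
      ultimately show ?thesis using W by blast
    qed
  qed
  let ?V = "\<lambda>x. chart_dom (d x) \<inter> chart_map (d x) -` ball (chart_map (d x) x) (r x)"
  obtain X where X: "finite X" "UNIV \<subseteq> (\<Union>x\<in>X. ?V x)"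
  proof (rule compactE_image[OF compact_UNIV, of UNIV ?V])
    show "open (?V x)" for x by (rule chart_vimage_open[OF ch open_ball])
    show "UNIV \<subseteq> (\<Union>x. ?V x)" using d by auto
  qed
  have \<beta>nn: "0 \<le> \<beta> x q" for x q by (simp add: \<beta>_def bump_nonneg)
  have S: "0 < (\<Sum>x\<in>X. \<beta> x q)" for q
  proof -
    obtain x where "x \<in> X" "q \<in> ?V x" using X(2) by blast
    then have "0 < \<beta> x q" by (simp add: \<beta>_def bump_pos_iff[OF d(3)])
    then show ?thesis using \<open>x \<in> X\<close> X(1) \<beta>nn by (intro sum_pos2[of X x]) auto
  qed
  define \<eta> where "\<eta> x q = \<beta> x q / (\<Sum>x\<in>X. \<beta> x q)" for x q
  have \<eta>C: "C2_fun \<Phi> (\<eta> x)" for x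
    unfolding C2_fun_def
  proof
    fix c assume c: "c \<in> \<Phi>"
    let ?T = "chart_map c ` chart_dom c"
    have \<beta>T: "C_on 2 ?T (\<beta> x \<circ> chart_inv c)" for x using \<beta>C c by (auto simp: C2_fun_def)
    have S0: "(\<Sum>x\<in>X. \<beta> x q) \<noteq> 0" for q using S[of q] by simp
    have "C_on 2 ?T (\<lambda>y. (\<beta> x \<circ> chart_inv c) y / (\<Sum>x\<in>X. (\<beta> x \<circ> chart_inv c) y))"
      by (intro C_on_divide C_on_sum chart_target_open \<Phi>_is_chart c \<beta>T) (simp add: S0)
    then show "C_on 2 ?T (\<eta> x \<circ> chart_inv c)" by (simp add: \<eta>_def o_def)
  qed
  have \<eta>1: "(\<Sum>x\<in>X. \<eta> x q) = 1" for q
    using S[of q] by (simp add: \<eta>_def sum_divide_distrib[symmetric])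
  have \<eta>0: "\<eta> x q = 0" if "q \<notin> K x" for x q
    using \<beta>0[OF that] by (simp add: \<eta>_def)
  show ?thesis by (rule that[OF X(1) d(1) K(1) K(2) \<eta>0 \<eta>C \<eta>1])
qed

lemma C2_fun_mult:
  assumes "C2_fun \<Phi> f" "C2_fun \<Phi> h"
  shows "C2_fun \<Phi> (\<lambda>x. f x * h x)"
  unfolding C2_fun_def
proof
  fix c assume c: "c \<in> \<Phi>"
  have "C_on 2 (chart_map c ` chart_dom c) (\<lambda>y. (f \<circ> chart_inv c) y * (h \<circ> chart_inv c) y)"
    using assms c unfolding C2_fun_def by (intro C_on_mult chart_target_open \<Phi>_is_chart) blast+
  then show "C_on 2 (chart_map c ` chart_dom c) ((\<lambda>x. f x * h x) \<circ> chart_inv c)" by (simp add: o_def)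
qed

lemma leaf_volume_borel_measurable:
  fixes v :: "'a \<Rightarrow> 'b::topological_space"
  assumes "closed L" "v \<in> borel_measurable borel"
  shows "v \<in> borel_measurable (vol L)"
proof -
  obtain \<mu> where \<mu>: "vol L = completion \<mu>" "sets \<mu> = sets (restrict_space borel L)"
    by (rule leaf_volume_completion[OF assms(1)], rule that)
  have "v \<in> borel_measurable \<mu>"
    using measurable_restrict_space1[OF assms(2)] by (simp add: measurable_cong_sets[OF \<mu>(2)])
  then show ?thesis unfolding \<mu>(1) by (rule measurable_completion)
qed

lemma continuous_bounded:
  fixes v :: "'a \<Rightarrow> real"
  assumes "continuous_on UNIV v"
  obtains B where "B > 0" "\<And>x. \<bar>v x\<bar> \<le> B"
proof -
  have "bounded (range v)" using compact_continuous_image[OF assms compact_UNIV] by (rule compact_imp_bounded)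
  then show ?thesis using that unfolding bounded_pos by auto
qed

text \<open>Finite volume makes the bounded Laplacians integrable, so balance of the two parts
  becomes a vanishing integral. The partition splits \<open>f\<close> into products
  \<open>h x\<close> with compact support in a chart.\<close>

lemma leaf_integral_laplacian:
  assumes f: "C2_fun \<Phi> f" and L: "L \<in> leaves I \<Phi>" "closed L"
    and fin: "emeasure (vol L) (space (vol L)) < \<infinity>"
  shows "integrable (vol L) (\<Delta> f)"
    and "(\<integral>x. \<Delta> f x \<partial>vol L) = 0"
proof -
  let ?M = "vol L"
  obtain X :: "'a set" and \<eta> d K where X: "finite X" "\<And>x. d x \<in> \<Phi>" "\<And>x. compact (K x)" "\<And>x. K x \<subseteq> chart_dom (d x)"
    "\<And>x q. q \<notin> K x \<Longrightarrow> \<eta> x q = 0" "\<And>x. C2_fun \<Phi> (\<eta> x)" "\<And>q. (\<Sum>x\<in>X. \<eta> x q) = (1::real)"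
    by (rule C2_partition_of_unity, rule that)
  define h where "h x q = f q * \<eta> x q" for x q
  have h: "C2_fun \<Phi> (h x)" for x unfolding h_def by (rule C2_fun_mult[OF f X(6)])
  have fh: "(\<Sum>x\<in>X. h x q) = f q" for q using X(7)[of q] by (simp add: h_def sum_distrib_left[symmetric])
  have int: "integrable ?M (\<Delta> u)" if u: "C2_fun \<Phi> u" for u
  proof -
    obtain B where B: "\<And>x. \<bar>\<Delta> u x\<bar> \<le> B"
      using continuous_bounded[OF leafwise_laplacian_continuous[OF u]] by metis
    interpret finite_measure ?M by (rule finite_measureI) (use fin in auto)
    show ?thesis
      by (rule integrable_const_bound[of _ B])
        (use B leaf_volume_borel_measurable[OF L(2)] borel_measurable_continuous_onI[OF leafwise_laplacian_continuous[OF u]] in auto)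
  qed
  have zero: "(\<integral>q. \<Delta> (h x) q \<partial>?M) = 0" for x
  proof -
    have "(\<integral>\<^sup>+ q. ennreal (\<Delta> (h x) q) \<partial>?M) = (\<integral>\<^sup>+ q. ennreal (- \<Delta> (h x) q) \<partial>?M)"
      by (rule leaf_integral_laplacian_balanced[OF h X(2)[of x] X(3)[of x] X(4)[of x] _ L]) (simp add: h_def X(5))
    then show ?thesis by (simp add: real_lebesgue_integral_def[OF int[OF h]])
  qed
  have sum: "\<Delta> f q = (\<Sum>x\<in>X. \<Delta> (h x) q)" for q
    using leafwise_laplacian_sum[where f = h and x = q, OF X(1) h] f by (simp add: fh)
  show "integrable ?M (\<Delta> f)" by (rule int[OF f])
  show "(\<integral>x. \<Delta> f x \<partial>?M) = 0"
    unfolding sum using zero int[OF h] by (simp add: Bochner_Integration.integral_sum)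
qed

end


section \<open>Variation of the norm\<close>

lemma powr_above_tangent:
  fixes x y p :: real
  assumes "0 < x" "0 < y" "1 \<le> p"
  shows "p * x powr (p - 1) * (y - x) \<le> y powr p - x powr p"
proof (rule convex_on_imp_above_tangent[of "{0<..}"])
  show "convex_on {0<..} (\<lambda>x. x powr p)" by (rule powr_convex) fact
  show "((\<lambda>x. x powr p) has_real_derivative p * x powr (p - 1)) (at x within {0<..})"
    using has_real_derivative_powr[OF assms(1), of p] by (rule has_field_derivative_at_within)
qed (use assms in \<open>auto simp: interior_open\<close>)

text \<open>Convexity bounds the increase of the integral by \<open>p * t n\<close> times the
  integral of \<open>?u n\<close>, which tends to the first variation by dominated convergence.
  Minimality gives these bounds a sign, and the two signs of \<open>t n\<close> give
  equality.\<close>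

lemma first_variation_eq_0:
  fixes f h :: "'a \<Rightarrow> real"
  assumes f: "f \<in> borel_measurable M" and h: "h \<in> borel_measurable M"
    and p: "1 < p" and c: "0 < c" "\<And>x. c \<le> f x" and B: "0 < B" "\<And>x. \<bar>h x\<bar> \<le> B"
    and int: "integrable M (\<lambda>x. f x powr p)"
    and int': "\<And>t. \<bar>t\<bar> * B \<le> c / 2 \<Longrightarrow> integrable M (\<lambda>x. (f x + t * h x) powr p)"
    and min: "\<And>t. \<bar>t\<bar> * B \<le> c / 2 \<Longrightarrow> (\<integral>x. f x powr p \<partial>M) \<le> (\<integral>x. (f x + t * h x) powr p \<partial>M)"
  shows "integrable M (\<lambda>x. f x powr (p - 1) * h x)" "(\<integral>x. f x powr (p - 1) * h x \<partial>M) = 0"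
proof -
  let ?v = "\<lambda>x. f x powr (p - 1) * h x"
  have main: "integrable M ?v \<and> 0 \<le> s * integral\<^sup>L M ?v" if s: "s = 1 \<or> s = -1" for s
  proof -
    \<comment> \<open>A null sequence of sign \<open>s\<close>; the factor
      \<open>c / (2 * B)\<close> keeps the perturbation within \<open>c / 2\<close>.\<close>
    define t where "t n = s * (c / (2 * B) / real (Suc n))" for n
    have t: "0 < s * t n" "\<bar>t n\<bar> * B \<le> c / 2" for n
    proof -
      show "0 < s * t n" using c(1) B(1) s by (auto simp: t_def)
      have "\<bar>t n\<bar> * B = c / 2 / real (Suc n)" using B(1) c(1) s by (auto simp: t_def)
      also have "\<dots> \<le> c / 2 / 1" using c(1) by (intro divide_left_mono) auto
      finally show "\<bar>t n\<bar> * B \<le> c / 2" by simp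
    qed
    have t_lim: "t \<longlonglongrightarrow> 0"
      unfolding t_def by (intro tendsto_mult_right_zero LIMSEQ_Suc[OF lim_const_over_n])
    have th: "\<bar>t n * h x\<bar> \<le> c / 2" for n x
    proof -
      have "\<bar>t n\<bar> * \<bar>h x\<bar> \<le> \<bar>t n\<bar> * B" by (intro mult_left_mono B) simp
      then show ?thesis using t(2)[of n] by (simp add: abs_mult)
    qed
    have pos: "0 < f x + t n * h x" "f x + t n * h x \<le> 2 * f x" for n x
      using th[of n x] c(1) c(2)[of x] by linarith+
    \<comment> \<open>The perturbed value lies between 0 and \<open>2 * f x\<close>, and
      \<open>f x\<close> is at least \<open>c\<close>. Its power \<open>p - 1\<close> is thus
      controlled by the integrable power \<open>p\<close> of \<open>f\<close>.\<close>
    let ?u = "\<lambda>n x. (f x + t n * h x) powr (p - 1) * h x" and ?w = "\<lambda>x. B * (2 powr p * f x powr p / c)"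
    have bound: "norm (?u n x) \<le> ?w x" for n x
    proof -
      have "(f x + t n * h x) powr (p - 1) \<le> (2 * f x) powr (p - 1)"
        using pos[of x n] p by (intro powr_mono2) auto
      also have "\<dots> = (2 * f x) powr p / (2 * f x)"
        using c(1) c(2)[of x] by (simp add: powr_diff)
      also have "\<dots> \<le> (2 * f x) powr p / c"
        using c(1) c(2)[of x] by (intro divide_left_mono) auto
      also have "\<dots> = 2 powr p * f x powr p / c" using c(1) c(2)[of x] by (simp add: powr_mult)
      finally have "(f x + t n * h x) powr (p - 1) * \<bar>h x\<bar> \<le> (2 powr p * f x powr p / c) * B"
        by (intro mult_mono B) (use c(1) in auto)
      then show ?thesis by (simp add: abs_mult mult.commute)
    qed
    have w: "integrable M ?w"
      by (intro integrable_mult_right integrable_divide int)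
    have um: "?u n \<in> borel_measurable M" "?v \<in> borel_measurable M" for n
      using f h by measurable
    have u_lim: "(\<lambda>n. ?u n x) \<longlonglongrightarrow> ?v x" for x
    proof -
      have "(\<lambda>n. ?u n x) \<longlonglongrightarrow> (f x + 0 * h x) powr (p - 1) * h x"
        using c(1) c(2)[of x] by (intro tendsto_intros t_lim) auto
      then show ?thesis by simp
    qed
    have u_int: "integrable M (?u n)" for n
    proof (rule Bochner_Integration.integrable_bound[OF w um(1)], rule AE_I2)
      show "norm (?u n x) \<le> norm (?w x)" for x
        using order_trans[OF bound abs_ge_self] by (simp only: real_norm_def)
    qed
    have "0 \<le> s * integral\<^sup>L M (?u n)" for n
    proof -
      let ?f = "\<lambda>x. (f x + t n * h x) powr p"
      have "(\<integral>x. ?f x - f x powr p \<partial>M) \<le> (\<integral>x. p * t n * ?u n x \<partial>M)"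
      proof (rule integral_mono)
        \<comment> \<open>The tangent is taken at the perturbed value, which turns convexity into an
          upper bound for the difference.\<close>
        show "?f x - f x powr p \<le> p * t n * ?u n x" for x
          using powr_above_tangent[of "f x + t n * h x" "f x" p] pos[of x n] c(1) c(2)[of x] p
          by (simp add: algebra_simps)
      qed (use int int'[OF t(2)] u_int in auto)
      then have "0 \<le> p * t n * integral\<^sup>L M (?u n)"
        using min[OF t(2)[of n]] int int'[OF t(2)[of n]] by simp
      also have "\<dots> = (p * (s * t n)) * (s * integral\<^sup>L M (?u n))" using s by auto
      finally show ?thesis
        using mult_pos_pos[OF _ t(1)[of n], of p] p by (simp only: zero_le_mult_iff) auto
    qed
    moreover have "(\<lambda>n. s * integral\<^sup>L M (?u n)) \<longlonglongrightarrow> s * integral\<^sup>L M ?v"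
      by (intro tendsto_mult_left integral_dominated_convergence[where w = ?w]) (use um w u_lim bound in auto)
    ultimately have "0 \<le> s * integral\<^sup>L M ?v" by (intro LIMSEQ_le_const) auto
    moreover have "integrable M ?v"
      by (rule integrable_dominated_convergence[where w = ?w and s = ?u]) (use um w u_lim bound in auto)
    ultimately show ?thesis by simp
  qed
  show "integrable M ?v" "integral\<^sup>L M ?v = 0" using main[of 1] main[of "-1"] by auto
qed

text \<open>The comparison is made leaf by leaf: wherever \<open>f0\<close> satisfies the condition,
  so does the perturbation. The exceptional leaves are among those of \<open>f0\<close>, and in a
  completed measure subsets of null sets are null.\<close>

lemma (in foliated_manifold) admissible_perturbation:
  assumes f0: "f0 \<in> adm A g I \<Phi> p" and closed: "\<forall>L\<in>leaves I \<Phi>. closed L"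
    and c: "0 < c" and f: "C2_fun \<Phi> f" and small: "\<And>x. \<bar>u x\<bar> \<le> c / 2"
    and u: "u = (\<lambda>x. t * \<Delta> f x)"
    and Lp: "(\<lambda>x. max (f0 x) c + u x) \<in> Lp (riemannian_volume A g) p"
  shows "(\<lambda>x. max (f0 x) c + u x) \<in> adm A g I \<Phi> p"
proof -
  let ?f = "\<lambda>x. max (f0 x) c + u x"
  let ?P = "\<lambda>v L. v \<in> borel_measurable (vol L) \<and> 1 \<le> (\<integral>\<^sup>+ x. ennreal (v x) \<partial>vol L)"
  have lower: "c / 2 \<le> ?f x" for x using small[of x] by linarith
  have ub: "u \<in> borel_measurable borel"
    unfolding u by (intro borel_measurable_times borel_measurable_const
        borel_measurable_continuous_onI[OF leafwise_laplacian_continuous[OF f]])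
  have P: "?P ?f L" if L: "L \<in> leaves I \<Phi>" and P0: "?P f0 L" for L
  proof -
    let ?M = "vol L"
    have cl: "closed L" using closed L by blast
    have um[measurable]: "u \<in> borel_measurable ?M" by (rule leaf_volume_borel_measurable[OF cl ub])
    have f0m[measurable]: "f0 \<in> borel_measurable ?M" using P0 by blast
    have fm[measurable]: "?f \<in> borel_measurable ?M" by measurable
    have "1 \<le> (\<integral>\<^sup>+ x. ennreal (?f x) \<partial>?M)"
    proof (cases "emeasure ?M (space ?M) < \<infinity>")
      case True
      note lap = leaf_integral_laplacian[OF f L cl True]
      have "integrable ?M u" "(\<integral>x. u x \<partial>?M) = 0" unfolding u using lap by simp_all
      then have bal: "(\<integral>\<^sup>+ x. ennreal (u x) \<partial>?M) = (\<integral>\<^sup>+ x. ennreal (- u x) \<partial>?M)"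
        and fin: "(\<integral>\<^sup>+ x. ennreal (- u x) \<partial>?M) \<noteq> \<infinity>"
        by (rule nn_integral_parts_eq) (use \<open>integrable ?M u\<close> in \<open>simp add: real_integrable_def\<close>)
      \<comment> \<open>Subtraction is avoided in \<open>[0, \<infinity>]\<close> by moving the
        negative part of \<open>u\<close> to the other side. The lower bound \<open>c / 2\<close>
        keeps \<open>?f x\<close> nonnegative, so the sum is not truncated.\<close>
      have split: "ennreal (max (f0 x) c) + ennreal (u x) = ennreal (?f x) + ennreal (- u x)" for x
      proof (cases "0 \<le> u x")
        case True
        then show ?thesis using c by (simp add: ennreal_plus ennreal_neg)
      next
        case False
        then have "ennreal (max (f0 x) c) = ennreal (?f x + - u x)" by simp
        also have "\<dots> = ennreal (?f x) + ennreal (- u x)"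
          by (rule ennreal_plus) (use False lower[of x] c in auto)
        finally show ?thesis using False by (simp add: ennreal_neg)
      qed
      have "(\<integral>\<^sup>+ x. ennreal (max (f0 x) c) \<partial>?M) + (\<integral>\<^sup>+ x. ennreal (u x) \<partial>?M)
          = (\<integral>\<^sup>+ x. ennreal (max (f0 x) c) + ennreal (u x) \<partial>?M)"
        by (intro nn_integral_add[symmetric]) measurable
      also have "\<dots> = (\<integral>\<^sup>+ x. ennreal (?f x) \<partial>?M) + (\<integral>\<^sup>+ x. ennreal (- u x) \<partial>?M)"
        unfolding split by (intro nn_integral_add) measurable
      \<comment> \<open>The integrals of the two parts of \<open>u\<close> are equal and finite, so
        they cancel.\<close>
      finally have "(\<integral>\<^sup>+ x. ennreal (max (f0 x) c) \<partial>?M) = (\<integral>\<^sup>+ x. ennreal (?f x) \<partial>?M)"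
        unfolding bal using fin by (simp add: ennreal_add_left_cancel add.commute)
      moreover have "(\<integral>\<^sup>+ x. ennreal (f0 x) \<partial>?M) \<le> (\<integral>\<^sup>+ x. ennreal (max (f0 x) c) \<partial>?M)"
        by (intro nn_integral_mono ennreal_leI) simp
      ultimately show ?thesis using P0 by (auto intro: order_trans)
    next
      case False
      then have inf: "emeasure ?M (space ?M) = \<infinity>" by (metis infinity_ennreal_def top.not_eq_extremum)
      have "(\<integral>\<^sup>+ x. ennreal (c / 2) \<partial>?M) \<le> (\<integral>\<^sup>+ x. ennreal (?f x) \<partial>?M)"
        by (intro nn_integral_mono ennreal_leI lower)
      moreover have "(\<integral>\<^sup>+ x. ennreal (c / 2) \<partial>?M) = \<infinity>"
        using c by (simp add: inf ennreal_mult_top)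
      ultimately show ?thesis by (simp add: top_unique)
    qed
    then show ?thesis using fm by blast
  qed
  obtain \<mu> where \<mu>: "riemannian_volume A g = completion \<mu>"
    by (rule riemannian_volume_completion[OF compact_UNIV A g])
  have "\<Union>{L \<in> leaves I \<Phi>. \<not> ?P f0 L} \<in> null_sets (completion \<mu>)"
    using f0 unfolding adm_def almost_every_leaf_def \<mu> by blast
  then have "\<Union>{L \<in> leaves I \<Phi>. \<not> ?P ?f L} \<in> null_sets (completion \<mu>)"
    by (rule completion.complete2[rotated]) (use P in blast)
  then have "almost_every_leaf A g I \<Phi> (?P ?f)"
    unfolding almost_every_leaf_def \<mu> .
  moreover have "\<forall>x. 0 \<le> ?f x" using lower c by (meson half_gt_zero less_eq_real_def order_trans)
  ultimately show ?thesis using Lp unfolding adm_def by simp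
qed

section \<open>Minimality of the extremal function among its perturbations\<close>

lemma integrable_powr_bound:
  fixes f v :: "'a \<Rightarrow> real"
  assumes "integrable M (\<lambda>x. f x powr p)" "0 \<le> p" "v \<in> borel_measurable M"
    and "\<And>x. 0 \<le> v x" "\<And>x. 0 \<le> f x" "AE x in M. v x \<le> a * f x" "0 \<le> a"
  shows "integrable M (\<lambda>x. v x powr p)"
proof (rule Bochner_Integration.integrable_bound)
  show "integrable M (\<lambda>x. a powr p * f x powr p)" using assms(1) by simp
  show "AE x in M. norm (v x powr p) \<le> norm (a powr p * f x powr p)"
    using assms(6)
  proof eventually_elim
    case (elim x)
    then have "v x powr p \<le> (a * f x) powr p" using assms by (intro powr_mono2) auto
    then show ?case using assms by (simp add: powr_mult)
  qed
qed (use assms in measurable)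

theorem corollary4p6:
  fixes A :: "('a::t2_space, 'n::{finite,wellorder}) chart set"
    and g :: "('a, 'n) metric"
    and I :: "'n set"
    and \<Phi> :: "('a, 'n) chart set"
    and p :: real
    and f\<^sub>0 :: "'a \<Rightarrow> real"
  assumes "compact (UNIV :: 'a set)"
    and "smooth_atlas A"
    and "riemannian_metric A g"
    and "foliated_atlas A I \<Phi>"
    and "\<forall>L\<in>leaves I \<Phi>. closed L"
    and "p > 1"
    and "extremal A g I \<Phi> p f\<^sub>0"
    and "ess_inf (riemannian_volume A g) f\<^sub>0 > 0"
  shows "harmonic_measure A g I \<Phi> (density (riemannian_volume A g) (\<lambda>x. ennreal (f\<^sub>0 x powr (p - 1))))"
  unfolding harmonic_measure_def
proof (intro allI impI)
  fix f assume "smooth_fun A f"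
  interpret foliated_manifold A g I \<Phi> by unfold_locales fact+
  let ?V = "riemannian_volume A g" and ?h = "leafwise_laplacian g I \<Phi> f"
  have f: "C2_fun \<Phi> f" by (rule smooth_fun_imp_C2_fun) fact
  note h_cont = leafwise_laplacian_continuous[OF f]
  obtain \<mu> where \<mu>: "?V = completion \<mu>" "sets \<mu> = sets borel"
    by (rule riemannian_volume_completion[OF compact_UNIV A g])
  have hm: "?h \<in> borel_measurable ?V"
    unfolding \<mu>(1) using borel_measurable_continuous_onI[OF h_cont]
    by (intro measurable_completion) (simp add: measurable_cong_sets[OF \<mu>(2)])
  obtain B where B: "B > 0" "\<And>x. \<bar>?h x\<bar> \<le> B" using continuous_bounded[OF h_cont] by metis
  have adm0: "f\<^sub>0 \<in> adm A g I \<Phi> p" and mod: "modulus A g I \<Phi> p = ennreal (Lp_norm ?V p f\<^sub>0)"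
    using assms(7) by (auto simp: extremal_def)
  have f0: "f\<^sub>0 \<in> borel_measurable ?V" "integrable ?V (\<lambda>x. f\<^sub>0 x powr p)" "\<And>x. 0 \<le> f\<^sub>0 x"
    using adm0 by (auto simp: adm_def Lp_def)
  \<comment> \<open>The essential infimum is an extended real, possibly infinite; a real number
    strictly between 0 and it serves as lower bound.\<close>
  obtain c where c: "0 < c" "AE x in ?V. c \<le> f\<^sub>0 x"
  proof -
    obtain c where c: "0 < ereal c" "ereal c < ess_inf ?V f\<^sub>0"
      using ereal_dense2[OF assms(8)] by blast
    have "AE x in ?V. c \<le> f\<^sub>0 x"
      using esssup_AE[of "\<lambda>x. - ereal (f\<^sub>0 x)" ?V]
    proof eventually_elim
      case (elim x)
      then have "ess_inf ?V f\<^sub>0 \<le> ereal (f\<^sub>0 x)" unfolding ess_inf_def by (simp add: ereal_uminus_le_reorder)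
      then have "ereal c \<le> ereal (f\<^sub>0 x)" using c(2) by (meson less_le_trans less_imp_le)
      then show ?case by simp
    qed
    then show ?thesis using that c(1) by simp
  qed
  text \<open>Truncation changes \<open>f\<^sub>0\<close> on a null set only, but makes the lower bound hold on every leaf.\<close>
  define f1 where "f1 x = max (f\<^sub>0 x) c" for x
  have f1m: "f1 \<in> borel_measurable ?V" unfolding f1_def using f0(1) by measurable
  have f1c: "c \<le> f1 x" for x by (simp add: f1_def)
  have f1_eq: "AE x in ?V. f1 x = f\<^sub>0 x" using c(2) by eventually_elim (simp add: f1_def)
  have small: "\<bar>t * ?h x\<bar> \<le> c / 2" if "\<bar>t\<bar> * B \<le> c / 2" for t x
  proof -
    have "\<bar>t\<bar> * \<bar>?h x\<bar> \<le> \<bar>t\<bar> * B" by (intro mult_left_mono B) simp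
    then show ?thesis using that by (simp add: abs_mult)
  qed
  have pos: "0 < f1 x + t * ?h x" "f1 x + t * ?h x \<le> 2 * f1 x" if "\<bar>t\<bar> * B \<le> c / 2" for t x
    using small[OF that, of x] f1c[of x] c(1) by linarith+
  have int: "integrable ?V (\<lambda>x. (f1 x + t * ?h x) powr p)" if t: "\<bar>t\<bar> * B \<le> c / 2" for t
  proof (rule integrable_powr_bound[OF f0(2), where a = 2])
    show "(\<lambda>x. f1 x + t * ?h x) \<in> borel_measurable ?V" using f1m hm by measurable
    show "AE x in ?V. f1 x + t * ?h x \<le> 2 * f\<^sub>0 x"
      using f1_eq by eventually_elim (use pos(2)[OF t] in metis)
    show "0 \<le> f1 x + t * ?h x" for x using pos(1)[OF t, of x] by simp
  qed (use assms(6) f0 in auto)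
  have min: "(\<integral>x. f1 x powr p \<partial>?V) \<le> (\<integral>x. (f1 x + t * ?h x) powr p \<partial>?V)" if t: "\<bar>t\<bar> * B \<le> c / 2" for t
  proof -
    let ?f = "\<lambda>x. f1 x + t * ?h x"
    have abs: "\<bar>?f x\<bar> = ?f x" for x using pos(1)[OF t, of x] by simp
    have "?f \<in> Lp ?V p"
      unfolding Lp_def using int[OF t] f1m hm by (auto simp: abs)
    then have "?f \<in> adm A g I \<Phi> p"
      unfolding f1_def using small[OF t]
      by (intro admissible_perturbation[OF adm0 assms(5) c(1) f _ refl]) auto
    then have "modulus A g I \<Phi> p \<le> ennreal (Lp_norm ?V p ?f)"
      unfolding modulus_def by (rule INF_lower)
    then have "Lp_norm ?V p f\<^sub>0 \<le> Lp_norm ?V p ?f"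
      unfolding mod by (subst (asm) ennreal_le_iff) (simp add: Lp_norm_def)
    then have le: "(\<integral>x. f\<^sub>0 x powr p \<partial>?V) powr (1 / p) \<le> (\<integral>x. ?f x powr p \<partial>?V) powr (1 / p)"
      using f0(3) by (simp add: Lp_norm_def abs)
    \<comment> \<open>Strict monotonicity of the \<open>p\<close>-th root turns the comparison of
      norms into one of integrals.\<close>
    have "(\<integral>x. f\<^sub>0 x powr p \<partial>?V) \<le> (\<integral>x. ?f x powr p \<partial>?V)"
    proof (rule ccontr)
      assume "\<not> ?thesis"
      moreover have "0 \<le> (\<integral>x. ?f x powr p \<partial>?V)" by simp
      ultimately have "(\<integral>x. ?f x powr p \<partial>?V) powr (1 / p) < (\<integral>x. f\<^sub>0 x powr p \<partial>?V) powr (1 / p)"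
        using assms(6) by (intro powr_less_mono2) auto
      with le show False by simp
    qed
    moreover have "(\<integral>x. f1 x powr p \<partial>?V) = (\<integral>x. f\<^sub>0 x powr p \<partial>?V)"
      using f1_eq f1m f0(1) by (intro integral_cong_AE) auto
    ultimately show ?thesis by simp
  qed
  have int1: "integrable ?V (\<lambda>x. f1 x powr p)" using int[of 0] c(1) by simp
  note var = first_variation_eq_0[OF f1m hm assms(6) c(1) f1c B int1 int min]
  \<comment> \<open>Return from the truncated function to \<open>f\<^sub>0\<close>: the integrands
    agree almost everywhere.\<close>
  have eq: "AE x in ?V. f\<^sub>0 x powr (p - 1) *\<^sub>R ?h x = f1 x powr (p - 1) * ?h x"
    using f1_eq by eventually_elim simp
  have m: "(\<lambda>x. f\<^sub>0 x powr (p - 1) *\<^sub>R ?h x) \<in> borel_measurable ?V" using f0(1) hm by measurable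
  have "integrable ?V (\<lambda>x. f\<^sub>0 x powr (p - 1) *\<^sub>R ?h x)"
    using var(1) eq m by (subst integrable_cong_AE) auto
  moreover have "(\<integral>x. f\<^sub>0 x powr (p - 1) *\<^sub>R ?h x \<partial>?V) = 0"
    using var eq m by (subst integral_cong_AE) auto
  ultimately show "integrable (density ?V (\<lambda>x. ennreal (f\<^sub>0 x powr (p - 1)))) ?h \<and>
      (\<integral>x. ?h x \<partial>density ?V (\<lambda>x. ennreal (f\<^sub>0 x powr (p - 1)))) = 0"
    using hm f0(1) by (simp add: integrable_density integral_density)
qed

end
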